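(* For all $\mu\in\mathrm{Par}^k$, $\tilde A^{(k)}_\mu=\mathfrak s^{(k)}_\mu$.
   Context: Fix $k\ge1$. $\Lambda=\mathbb Z[t][h_1,h_2,\dots]$ ($h_0=1$, $h_d=0$ for $d<0$); $s_\gamma=\det(h_{\gamma_i+j-i})_{1\le i,j\le\ell}$ for $\gamma\in\mathbb Z^\ell$. For a root ideal $\Psi\subseteq\Delta^+_\ell=\{(i,j):1\le i<j\le\ell\}$ (upper order ideal for $(a,b)\le(c,d)$ iff $a\ge c$, $b\le d$) and $\gamma\in\mathbb Z^\ell$, $H(\Psi;\gamma)=\sum_{m:\Psi\to\mathbb Z_{\ge0}}t^{\sum m}s_{\gamma+\sum_{(i,j)\in\Psi}m_{ij}(\epsilon_i-\epsilon_j)}\in\Lambda$. $\mathrm{Par}^k_\ell=\{\mu\in\mathbb Z^\ell:k\ge\mu_1\ge\dots\ge\mu_\ell\ge0\}$, $\mathrm{Par}^k$ = partitions with parts $\le k$. For $\mu\in\mathrm{Par}^k_\ell$, $\mathfrak s^{(k)}_\mu=H(\{(i,j):k-\mu_i+i<j\};\mu)$ (unchanged by appending zeros). $\Lambda^k=\mathrm{span}_{\mathbb Z[t]}\{H(\Delta^+_{\ell(\mu)};\mu):\mu\in\mathrm{Par}^k\}$. $\mathcal B_m=\sum_{i,j\ge0}(-1)^it^jh_{m+i+j}e_i^\perp h_j^\perp$ (Hall adjoints); $\tilde{\mathcal B}_\alpha=\mathcal B_{\alpha_1}\cdots\mathcal B_{\alpha_\ell}$; $\mathcal B_\alpha=\prod_{1\le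 i<j\le\ell}(1-t\mathbf R_{ij})\tilde{\mathcal B}_\alpha$ with $\mathbf R_{ij}\tilde{\mathcal B}_\beta=\tilde{\mathcal B}_{\beta+\epsilon_i-\epsilon_j}$. $k$-split of $\lambda\in\mathrm{Par}^k$: cut $\lambda$ (without rearranging) into consecutive blocks $\lambda^1,\dots,\lambda^d$, where block $\lambda^i$ has $r_i=k-(\lambda^i)_1+1$ entries, the last block $\lambda^d$ ($(\lambda^d)_1>0$) padded with zeros; the empty partition has $d=0$. The $k$-split polynomial is $G^{(k)}_\lambda=\mathcal B_{\lambda^1}\cdots\mathcal B_{\lambda^{d-1}}s_{\lambda^d}$, $G^{(k)}_\emptyset=1$. It is known that $\{G^{(k)}_\lambda:\lambda\in\mathrm{Par}^k\}$ is a $\mathbb Z[t]$-basis of $\Lambda^k$. Let $\tilde\Omega^{k,a}=\mathrm{span}_{\mathbb Z[t]}\{G^{(k)}_\lambda:\lambda\in\mathrm{Par}^k,\lambda_1=a\}$ for $0\le a\le k$ (with $\tilde\Omega^{k,0}$ spanned by $G^{(k)}_\emptyset=1$), so $\Lambda^k=\bigoplus_a\tilde\Omega^{k,a}$, and let $\pi^{k,d}:\Lambda^k\to\Lambda^k$ be the projection with kernel $\bigoplus_{a>d}\tilde\Omega^{k,a}$ that is the identity on $\bigoplus_{a\le d}\tilde\Omega^{k,a}$. Define recursively $\tilde A^{(k)}_\emptyset=1$ and, for $\ell(\mu)>0$, $\tilde A^{(k)}_\mu=\pi^{k,\mu_1}\big(\mathcal B_{\mu_1}\tilde A^{(k)}_{(\mu_2,\dots,\mu_{\ell(\mu)})}\big)$.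 *)

theory Defs
  imports
    "HOL-Library.Poly_Mapping"
    "Jordan_Normal_Form.Determinant"
begin

section \<open>The ring of symmetric functions over \<open>\<int>[t]\<close>\<close>

text \<open>
  \<open>\<Lambda> = \<int>[t][h\<^sub>1, h\<^sub>2, \<dots>]\<close> as a polynomial ring: exponent vectors are finitely supported
  functions, and the polynomial variable with index \<open>n\<close> stands for \<open>h\<^sub>n\<^sub>+\<^sub>1\<close>.
\<close>

type_synonym sym = "(nat \<Rightarrow>\<^sub>0 nat) \<Rightarrow>\<^sub>0 int poly"

definition tscale :: "int poly \<Rightarrow> sym \<Rightarrow> sym"  (infixr "*\<^sub>t" 75)
  where "c *\<^sub>t f = Poly_Mapping.single 0 c * f"

abbreviation tvar :: "int poly"
  where "tvar \<equiv> [:0, 1:]"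

interpretation Sym: Modules.module tscale
  by unfold_locales
    (simp_all add: tscale_def distrib_left distrib_right single_add mult_single flip: mult.assoc)

definition hsym :: "int \<Rightarrow> sym"
  where "hsym d = (if d < 0 then 0 else if d = 0 then 1
    else Poly_Mapping.single (Poly_Mapping.single (nat d - 1) 1) 1)"

text \<open>
  Elements of \<open>\<int>\<^sup>\<ell>\<close> are integer lists of length \<open>\<ell>\<close>. Positions are counted from 0; the index
  expressions \<open>\<gamma>\<^sub>i + j - i\<close> and \<open>k - \<mu>\<^sub>i + i < j\<close> below are invariant under this shift.
\<close>

definition schur :: "int list \<Rightarrow> sym"
  where "schur \<gamma> = det (mat (length \<gamma>) (length \<gamma>) (\<lambda>(i, j). hsym (\<gamma> ! i + int j - int i)))"

definition esym :: "nat \<Rightarrow> sym"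
  where "esym n = schur (replicate n 1)"

text \<open>Partitions are lists of their nonzero parts, without trailing zeros.\<close>

definition partitions :: "int list set"
  where "partitions = {\<mu>. sorted_wrt (\<ge>) \<mu> \<and> (\<forall>a\<in>set \<mu>. 0 < a)}"

definition Par :: "nat \<Rightarrow> int list set"
  where "Par k = {\<mu> \<in> partitions. \<forall>a\<in>set \<mu>. a \<le> int k}"

definition first_part :: "int list \<Rightarrow> int"
  where "first_part \<mu> = (if \<mu> = [] then 0 else hd \<mu>)"


section \<open>Hall inner product and adjoints\<close>

definition is_hall_form :: "(sym \<Rightarrow> sym \<Rightarrow> int poly) \<Rightarrow> bool"
  where "is_hall_form B \<longleftrightarrow>
    (\<forall>f. module_hom tscale (*) (\<lambda>g. B f g)) \<and>
    (\<forall>g. module_hom tscale (*) (\<lambda>f. B f g)) \<and>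
    (\<forall>\<mu>\<in>partitions. \<forall>\<nu>\<in>partitions. B (schur \<mu>) (schur \<nu>) = (if \<mu> = \<nu> then 1 else 0))"

definition hall :: "sym \<Rightarrow> sym \<Rightarrow> int poly"
  where "hall = (THE B. is_hall_form B)"

text \<open>\<open>perp f\<close> is the Hall adjoint of multiplication by \<open>f\<close>.\<close>

definition perp :: "sym \<Rightarrow> sym \<Rightarrow> sym"
  where "perp f g = (THE u. \<forall>v. hall u v = hall g (f * v))"


section \<open>Catalan functions\<close>

definition all_roots :: "nat \<Rightarrow> (nat \<times> nat) set"
  where "all_roots n = {(i, j). i < j \<and> j < n}"

text \<open>
  \<open>raise \<Psi> m \<gamma> = \<gamma> + \<Sum>\<^bsub>(i,j)\<in>\<Psi>\<^esub> m\<^sub>i\<^sub>j (\<epsilon>\<^sub>i - \<epsilon>\<^sub>j)\<close>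
\<close>

definition raise :: "(nat \<times> nat) set \<Rightarrow> (nat \<times> nat \<Rightarrow> nat) \<Rightarrow> int list \<Rightarrow> int list"
  where "raise \<Psi> m \<gamma> = map (\<lambda>r. \<gamma> ! r
      + (\<Sum>(i, j)\<in>\<Psi>. int (m (i, j)) * (of_bool (r = i) - of_bool (r = j)))) [0..<length \<gamma>]"

text \<open>
  A function \<open>\<Psi> \<rightarrow> \<int>\<^sub>\<ge>\<^sub>0\<close> is encoded as a function on all pairs that vanishes outside \<open>\<Psi>\<close>.
  \<open>Sum_any\<close> adds up the nonzero terms. For \<open>\<Psi> \<subseteq> all_roots (length \<gamma>)\<close> there are only
  finitely many of them, because \<open>schur\<close> vanishes as soon as some entry \<open>\<gamma>\<^sub>i\<close> is less than
  \<open>i - \<ell>\<close> (with \<open>i\<close> counted from 1).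
\<close>

definition catalan :: "(nat \<times> nat) set \<Rightarrow> int list \<Rightarrow> sym"
  where "catalan \<Psi> \<gamma> = Sum_any (\<lambda>m.
    tvar ^ (\<Sum>p\<in>\<Psi>. m p) *\<^sub>t schur (raise \<Psi> m \<gamma>) when (\<forall>p. p \<notin> \<Psi> \<longrightarrow> m p = 0))"

definition kschur_roots :: "nat \<Rightarrow> int list \<Rightarrow> (nat \<times> nat) set"
  where "kschur_roots k \<mu> =
    {(i, j) \<in> all_roots (length \<mu>). int k - \<mu> ! i + int i < int j}"

definition kschur :: "nat \<Rightarrow> int list \<Rightarrow> sym"
  where "kschur k \<mu> = catalan (kschur_roots k \<mu>) \<mu>"

definition Lambda :: "nat \<Rightarrow> sym set"
  where "Lambda k = Sym.span ((\<lambda>\<mu>. catalan (all_roots (length \<mu>)) \<mu>) ` Par k)"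


section \<open>Vertex operators\<close>

text \<open>
  Only finitely many terms are nonzero when the operator is applied to a given \<open>f\<close>, since
  \<open>e\<^sub>i\<^sup>\<bottom>\<close> and \<open>h\<^sub>j\<^sup>\<bottom>\<close> lower the degree by \<open>i\<close> and \<open>j\<close>.
\<close>

definition Bop :: "int \<Rightarrow> sym \<Rightarrow> sym"
  where "Bop m f = Sum_any (\<lambda>(i, j).
    ((-1) ^ i * tvar ^ j) *\<^sub>t (hsym (m + int i + int j) * perp (esym i) (perp (hsym (int j)) f)))"

definition Btilde :: "int list \<Rightarrow> sym \<Rightarrow> sym"
  where "Btilde \<alpha> f = foldr Bop \<alpha> f"

text \<open>
  The raising operators act on the index of a family \<open>F\<close> of operators, as in
  \<open>(1 - t R\<^sub>i\<^sub>j) F\<^sub>\<beta> = F\<^sub>\<beta> - t F\<^bsub>\<beta> + \<epsilon>\<^sub>i - \<epsilon>\<^sub>j\<^esub>\<close>. These commute, so the product over all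
  \<open>i < j\<close> is composition in any order.
\<close>

definition one_minus_tR ::
    "nat \<times> nat \<Rightarrow> (int list \<Rightarrow> sym \<Rightarrow> sym) \<Rightarrow> int list \<Rightarrow> sym \<Rightarrow> sym"
  where "one_minus_tR = (\<lambda>(i, j) F \<beta> f.
    F \<beta> f - tvar *\<^sub>t F (\<beta>[i := \<beta> ! i + 1, j := \<beta> ! j - 1]) f)"

definition Bvec :: "int list \<Rightarrow> sym \<Rightarrow> sym"
  where "Bvec \<alpha> = foldr one_minus_tR
    [(i, j). j \<leftarrow> [0..<length \<alpha>], i \<leftarrow> [0..<j]] Btilde \<alpha>"


section \<open>\<open>k\<close>-split polynomials\<close>

text \<open>
  The block starting with \<open>a \<le> k\<close> has \<open>k - a + 1\<close> entries; only the last block can be short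
  and get padded.
\<close>

function ksplit :: "nat \<Rightarrow> int list \<Rightarrow> int list list"
  where
    "ksplit k [] = []"
  | "ksplit k (a # \<nu>) =
      (let r = nat (int k - a) + 1; \<mu> = a # \<nu> in
        (take r \<mu> @ replicate (r - length \<mu>) 0) # ksplit k (drop r \<mu>))"
  by pat_completeness auto
termination by (relation "measure (\<lambda>(k, \<mu>). length \<mu>)") auto

definition ksplit_poly :: "nat \<Rightarrow> int list \<Rightarrow> sym"
  where "ksplit_poly k \<mu> = (if \<mu> = [] then 1
    else foldr Bvec (butlast (ksplit k \<mu>)) (schur (last (ksplit k \<mu>))))"

definition Omega :: "nat \<Rightarrow> int \<Rightarrow> sym set"
  where "Omega k a = Sym.span (ksplit_poly k ` {\<mu> \<in> Par k. first_part \<mu> = a})"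

text \<open>
  The projection of \<open>\<Lambda>\<^sup>k = \<Oplus>\<^sub>a \<Omega>\<^sup>k\<^sup>,\<^sup>a\<close> (sum over \<open>0 \<le> a \<le> k\<close>) with kernel
  \<open>\<Oplus>\<^bsub>a > d\<^esub> \<Omega>\<^sup>k\<^sup>,\<^sup>a\<close> that is the identity on \<open>\<Oplus>\<^bsub>a \<le> d\<^esub> \<Omega>\<^sup>k\<^sup>,\<^sup>a\<close>: it sends \<open>f\<close> to its unique
  component \<open>g\<close> in the latter. That the sum is direct and equal to \<open>\<Lambda>\<^sup>k\<close> is a theorem about
  the \<open>k\<close>-split polynomials and is not built into the definition. Outside \<open>\<Lambda>\<^sup>k\<close> the
  projection is unspecified.
\<close>

definition omega_proj :: "nat \<Rightarrow> int \<Rightarrow> sym \<Rightarrow> sym"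
  where "omega_proj k d = (\<lambda>f\<in>Lambda k. THE g.
    g \<in> Sym.span (\<Union>a\<in>{a. 0 \<le> a \<and> a \<le> int k \<and> a \<le> d}. Omega k a) \<and>
    f - g \<in> Sym.span (\<Union>a\<in>{a. 0 \<le> a \<and> a \<le> int k \<and> d < a}. Omega k a))"

fun Atilde :: "nat \<Rightarrow> int list \<Rightarrow> sym"
  where
    "Atilde k [] = 1"
  | "Atilde k (a # \<mu>) = omega_proj k a (Bop a (Atilde k \<mu>))"

end

theory Submission imports Defs
begin

text \<open>
  Both sides of the recursion are compared through the expansion of a Catalan function in others
  with more roots: adding the roots of \<open>\<Psi> - \<Psi>'\<close> one at a time gives
  \<open>H(\<Psi>'; \<gamma>) = \<Prod>\<^bsub>\<beta> \<in> \<Psi> - \<Psi>'\<^esub> (1 - t R\<^sub>\<beta>) H(\<Psi>; \<gamma>)\<close>.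

  Adding all roots of the first row turns \<open>kschur k (a # \<nu>)\<close> into \<open>Bop a (kschur k \<nu>)\<close> plus terms
  whose first entry exceeds \<open>a\<close>; by Jing's relation for the operators \<open>Bop\<close> those terms lie in the
  span of the \<open>k\<close>-split polynomials with first part greater than \<open>a\<close>.

  Adding the roots between the first \<open>k - a + 1\<close> rows and the remaining ones writes
  \<open>kschur k (\<eta> @ \<tau>)\<close> as a combination of \<open>Bvec \<nu> H(\<tau>; \<sigma>)\<close> with \<open>\<sigma>\<close> below \<open>\<tau>\<close>. No root is missing
  in row 0, so its entry stays \<open>a\<close>, and row \<open>p\<close> never exceeds \<open>a + p\<close>, so that straightening in the
  block keeps the first part \<open>a\<close>. The weights \<open>\<sigma>\<close> satisfy a staircase bound which reproduces itself from
  block to block, so an induction over the blocks expands \<open>kschur k \<mu>\<close> in \<open>k\<close>-split polynomials with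
  first part \<open>\<mu>\<^sub>1\<close>. Since the \<open>k\<close>-split polynomials are unitriangular in Schur functions,
  the projection is well defined and its value is as claimed.
\<close>

section \<open>Evaluation homomorphisms\<close>

text \<open>\<open>hall\<close>, \<open>perp\<close> and \<open>omega_proj\<close> are definite
  descriptions, so \<open>Bop\<close> and the projection become usable only after existence and
  uniqueness are proved; hence the Schur basis and explicit adjoints precede all Catalan functions.
  Where possible the work is done with Schur functions of arbitrary integer lists, on which removing
  strips, raising and prepending an entry are plain list operations; straightening is postponed.

  The obstacle in the block expansion is that its tails \<open>H(\<tau>; \<sigma>)\<close> carry the
  roots of one list and the weight of another. They are not \<open>k\<close>-Schur functions, so a
  direct induction gets stuck. They must first be rewritten in \<open>k\<close>-Schur functions with
  first part at most that of \<open>\<tau>\<close>, which in turn needs the converse expansion, of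
  \<open>Bvec \<nu> (kschur k \<tau>)\<close> in \<open>k\<close>-Schur functions. The block length
  \<open>r = k - a + 1\<close> makes this work: since \<open>r - 1 = k - a\<close>, filling up row
  \<open>p\<close> of the head leads to at most \<open>a + p\<close>, whatever its entry was, and
  the numbers \<open>\<gamma>\<^sub>p - p\<close> are what sorting preserves.\<close>

lemma pm_sum_singles:
  fixes f :: "'a \<Rightarrow>\<^sub>0 'b::comm_monoid_add"
  shows "f = (\<Sum>m\<in>Poly_Mapping.keys f. Poly_Mapping.single m (Poly_Mapping.lookup f m))"
proof (rule poly_mapping_eqI)
  fix k
  show "Poly_Mapping.lookup f k
    = Poly_Mapping.lookup (\<Sum>m\<in>Poly_Mapping.keys f. Poly_Mapping.single m (Poly_Mapping.lookup f m)) k"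
    by (simp add: lookup_sum lookup_single when_def not_in_keys_iff_lookup_eq_zero)
qed

lemma pm_induct [case_names zero single add]:
  fixes f :: "'a \<Rightarrow>\<^sub>0 'b::comm_monoid_add"
  assumes "P 0" and "\<And>m c. P (Poly_Mapping.single m c)" and "\<And>f g. P f \<Longrightarrow> P g \<Longrightarrow> P (f + g)"
  shows "P f"
proof -
  have "P (\<Sum>m\<in>A. Poly_Mapping.single m (Poly_Mapping.lookup f m))" if "finite A" for A
    using that by induction (auto intro: assms)
  then show ?thesis
    by (subst pm_sum_singles) simp
qed

definition pm_monom :: "('x \<Rightarrow> 'b::comm_ring_1) \<Rightarrow> ('x \<Rightarrow>\<^sub>0 nat) \<Rightarrow> 'b"
  where "pm_monom X m = (\<Prod>n\<in>Poly_Mapping.keys m. X n ^ Poly_Mapping.lookup m n)"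

definition pm_eval :: "('c::comm_ring_1 \<Rightarrow> 'b::comm_ring_1) \<Rightarrow> ('x \<Rightarrow> 'b) \<Rightarrow> (('x \<Rightarrow>\<^sub>0 nat) \<Rightarrow>\<^sub>0 'c) \<Rightarrow> 'b"
  where "pm_eval \<phi> X f =
    (\<Sum>m\<in>Poly_Mapping.keys f. \<phi> (Poly_Mapping.lookup f m) * pm_monom X m)"

lemma pm_monom_superset:
  assumes "finite A" "Poly_Mapping.keys m \<subseteq> A"
  shows "pm_monom X m = (\<Prod>n\<in>A. X n ^ Poly_Mapping.lookup m n)"
  unfolding pm_monom_def
  by (rule prod.mono_neutral_left[OF assms]) (simp add: in_keys_iff)

lemma pm_monom_add: "pm_monom X (m + m') = pm_monom X m * pm_monom X m'"
proof -
  let ?A = "Poly_Mapping.keys m \<union> Poly_Mapping.keys m'"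
  have "Poly_Mapping.keys (m + m') \<subseteq> ?A"
    by (rule keys_add)
  then show ?thesis
    by (simp add: pm_monom_superset[of ?A] lookup_add power_add prod.distrib)
qed

context comm_ring_hom
begin

lemma pm_eval_superset:
  assumes "finite A" "Poly_Mapping.keys f \<subseteq> A"
  shows "pm_eval hom X f = (\<Sum>m\<in>A. hom (Poly_Mapping.lookup f m) * pm_monom X m)"
  unfolding pm_eval_def
  by (rule sum.mono_neutral_left[OF assms]) (simp add: in_keys_iff)

lemma pm_eval_add: "pm_eval hom X (f + g) = pm_eval hom X f + pm_eval hom X g"
proof -
  let ?A = "Poly_Mapping.keys f \<union> Poly_Mapping.keys g"
  have "Poly_Mapping.keys (f + g) \<subseteq> ?A"
    by (rule keys_add)
  then show ?thesis
    by (simp add: pm_eval_superset[of ?A] lookup_add distrib_right hom_distribs sum.distrib)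
qed

lemma pm_eval_zero [simp]: "pm_eval hom X 0 = 0"
  by (simp add: pm_eval_def)

lemma pm_eval_single: "pm_eval hom X (Poly_Mapping.single m c) = hom c * pm_monom X m"
  by (simp add: pm_eval_def)

lemma pm_eval_mult:
  fixes X :: "'x \<Rightarrow> 'b"
  shows "pm_eval hom X (f * g) = pm_eval hom X f * pm_eval hom X g"
proof (induction f rule: pm_induct)
  case (single m c)
  show ?case
  proof (induction g rule: pm_induct)
    case (single m' c')
    then show ?case
      by (simp add: pm_eval_single mult_single pm_monom_add hom_mult mult_ac)
  qed (simp_all add: distrib_left pm_eval_add)
qed (simp_all add: pm_eval_add distrib_right)

end

text \<open>
  The coefficient of \<open>u\<^sup>d\<close> in the homomorphism \<open>h\<^sub>n \<mapsto> h\<^sub>n + u h\<^sub>n\<^sub>-\<^sub>1\<close> is the operator \<open>e\<^sub>d\<^sup>\<bottom>\<close>;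
  adjointness is the lemma \<open>hall_eperp\<close>.
\<close>

definition raise_hom :: "sym \<Rightarrow> sym poly"
  where "raise_hom = pm_eval (\<lambda>c. [:Poly_Mapping.single 0 c:])
    (\<lambda>n. [:hsym (int n + 1), hsym (int n):])"

interpretation sconst: comm_ring_hom "\<lambda>c::int poly. [:Poly_Mapping.single (0 :: nat \<Rightarrow>\<^sub>0 nat) c:]"
  by unfold_locales (simp_all add: single_add mult_single mult.commute)

lemma tscale_one [simp]: "c *\<^sub>t 1 = Poly_Mapping.single 0 c"
  by (simp add: tscale_def)

interpretation raise_hom: comm_ring_hom raise_hom
proof unfold_locales
  show "raise_hom 1 = 1"
    unfolding raise_hom_def single_one[symmetric, where 'a = "nat \<Rightarrow>\<^sub>0 nat"] sconst.pm_eval_single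
    by (simp add: pm_monom_def)
qed (simp_all add: raise_hom_def sconst.pm_eval_add sconst.pm_eval_mult)

text \<open>The conventions \<open>h\<^sub>0 = 1\<close> and \<open>h\<^sub>d = 0\<close> for
  \<open>d < 0\<close> make one formula serve every integer index, so the homomorphism can be
  applied entry by entry to the matrix of \<open>schur \<gamma>\<close> for any list
  \<open>\<gamma>\<close>.\<close>

lemma raise_hom_hsym: "raise_hom (hsym n) = [:hsym n, hsym (n - 1):]"
proof -
  consider "n < 0" | "n = 0" | "n > 0" by linarith
  then show ?thesis
  proof cases
    case 3
    then have "raise_hom (hsym n) = [:hsym (int (nat n - 1) + 1), hsym (int (nat n - 1)):]"
      unfolding raise_hom_def
      by (subst hsym_def) (simp add: sconst.pm_eval_single pm_monom_def)
    moreover have "int (nat n - 1) = n - 1"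
      using 3 by simp
    ultimately show ?thesis
      by simp
  qed (simp_all add: hsym_def one_pCons)
qed

lemma raise_hom_tscale: "raise_hom (c *\<^sub>t f) = smult (Poly_Mapping.single 0 c) (raise_hom f)"
  by (simp add: tscale_def raise_hom.hom_mult)
    (simp add: raise_hom_def sconst.pm_eval_single pm_monom_def)

definition eperp :: "nat \<Rightarrow> sym \<Rightarrow> sym"
  where "eperp d f = coeff (raise_hom f) d"

section \<open>Bernstein's operators\<close>

text \<open>The minor complementary to entry \<open>(0, c)\<close> in the matrix of
  \<open>schur (m # \<gamma>)\<close>, which does not depend on \<open>m\<close>. For a partition it
  is the skew Schur function of \<open>\<gamma>\<close> by a column of height
  \<open>c\<close>.\<close>

definition jt_minor :: "int list \<Rightarrow> nat \<Rightarrow> sym"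
  where "jt_minor \<gamma> c = det (mat (length \<gamma>) (length \<gamma>)
    (\<lambda>(i, j). hsym (\<gamma> ! i - int i - 1 + int (if j < c then j else Suc j))))"

lemma schur_Cons_minor:
  "schur (m # \<gamma>) = (\<Sum>c\<le>length \<gamma>. (- 1) ^ c * hsym (m + int c) * jt_minor \<gamma> c)"
proof -
  let ?l = "length \<gamma>"
  define A where "A = mat (Suc ?l) (Suc ?l) (\<lambda>(i, j). hsym ((m # \<gamma>) ! i + int j - int i))"
  have A: "A \<in> carrier_mat (Suc ?l) (Suc ?l)"
    by (simp add: A_def)
  have del: "mat_delete A 0 c = mat ?l ?l
      (\<lambda>(i, j). hsym (\<gamma> ! i - int i - 1 + int (if j < c then j else Suc j)))" if "c < Suc ?l" for c
    by (rule eq_matI) (auto simp: mat_delete_def A_def algebra_simps)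
  have "schur (m # \<gamma>) = det A"
    by (simp add: schur_def A_def)
  also have "\<dots> = (\<Sum>c<Suc ?l. A $$ (0, c) * cofactor A 0 c)"
    by (rule laplace_expansion_row[OF A]) simp
  also have "\<dots> = (\<Sum>c<Suc ?l. (- 1) ^ c * hsym (m + int c) * jt_minor \<gamma> c)"
    by (rule sum.cong) (simp_all add: cofactor_def del jt_minor_def mult_ac, simp add: A_def)
  finally show ?thesis
    by (simp add: lessThan_Suc_atMost)
qed

text \<open>
  Border the matrix of \<open>schur \<gamma>\<close> by the row \<open>((-u)\<^sup>c)\<^sub>c\<close>. Adding \<open>u\<close> times each column to the next one
  clears the new row except for its first entry and applies \<open>raise_hom\<close> to all other entries, whereas
  the Laplace expansion produces the minors.
\<close>

lemma raise_hom_schur: "raise_hom (schur \<gamma>) = (\<Sum>c\<le>length \<gamma>. monom (jt_minor \<gamma> c) c)"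
proof -
  let ?l = "length \<gamma>"
  define M :: "sym poly mat" where "M = mat (Suc ?l) (Suc ?l)
    (\<lambda>(i, j). if i = 0 then monom ((- 1) ^ j) j else [:hsym (\<gamma> ! (i - 1) - int i + int j):])"
  define U :: "sym poly mat" where "U = mat (Suc ?l) (Suc ?l)
    (\<lambda>(i, j). if i = j then 1 else if Suc i = j then [:0, 1:] else 0)"
  have M: "M \<in> carrier_mat (Suc ?l) (Suc ?l)" and U: "U \<in> carrier_mat (Suc ?l) (Suc ?l)"
    by (simp_all add: M_def U_def)
  have MU: "(M * U) $$ (i, j) = M $$ (i, j) + (if j = 0 then 0 else M $$ (i, j - 1) * [:0, 1:])"
    if "i < Suc ?l" "j < Suc ?l" for i j
  proof -
    have "(M * U) $$ (i, j) = (\<Sum>k<Suc ?l. M $$ (i, k) * U $$ (k, j))"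
      using that M U by (simp add: scalar_prod_def atLeast0LessThan)
    also have "\<dots> = (\<Sum>k<Suc ?l. (if k = j then M $$ (i, k) else 0)
        + (if k = j - 1 then if j = 0 then 0 else M $$ (i, k) * [:0, 1:] else 0))"
      using that by (intro sum.cong) (auto simp: U_def)
    also have "\<dots> = M $$ (i, j) + (if j = 0 then 0 else M $$ (i, j - 1) * [:0, 1:])"
      using that by (cases j) (simp_all add: sum.distrib sum.delta)
    finally show ?thesis .
  qed
  have "det U = prod_list (diag_mat U)"
    by (rule det_upper_triangular[OF _ U]) (auto simp: upper_triangular_def U_def)
  also have "\<dots> = 1"
    by (simp add: prod_list_diag_prod U_def)
  finally have "det (M * U) = det M"
    using det_mult[OF M U] by simp
  moreover have "det M = (\<Sum>c<Suc ?l. M $$ (0, c) * cofactor M 0 c)"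
    by (rule laplace_expansion_row[OF M]) simp
  moreover have "M $$ (0, c) * cofactor M 0 c = monom (jt_minor \<gamma> c) c" if "c < Suc ?l" for c
  proof -
    interpret const: comm_ring_hom "\<lambda>c::sym. [:c:]"
      by unfold_locales (simp_all add: mult.commute)
    have "mat_delete M 0 c = map_mat (\<lambda>c. [:c:]) (mat ?l ?l
      (\<lambda>(i, j). hsym (\<gamma> ! i - int i - 1 + int (if j < c then j else Suc j))))"
      using that by (intro eq_matI) (auto simp: mat_delete_def M_def algebra_simps)
    then have "cofactor M 0 c = (- 1) ^ c * [:jt_minor \<gamma> c:]"
      by (simp add: cofactor_def jt_minor_def const.hom_det)
    also have "\<dots> = [:(- 1) ^ c * jt_minor \<gamma> c:]"
      by (simp add: const.hom_power[symmetric] const.hom_mult[symmetric] const.hom_uminus[symmetric] const.hom_one[symmetric] del: const.hom_power const.hom_mult const.hom_uminus const.hom_one)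
    finally show ?thesis
      using that by (cases "even c") (simp_all add: M_def smult_monom minus_monom mult.commute[of "monom _ _"])
  qed
  moreover have "det (M * U) = raise_hom (schur \<gamma>)"
  proof -
    have c: "M * U \<in> carrier_mat (Suc ?l) (Suc ?l)"
      using M U by simp
    have row: "(M * U) $$ (0, j) = (if j = 0 then 1 else 0)" if "j < Suc ?l" for j
    proof (cases j)
      case (Suc j')
      then show ?thesis
        using that MU[of 0 j] by (simp add: Suc) (simp add: M_def monom_Suc monom_altdef)
    next
      case 0
      then show ?thesis
        using MU[of 0 0] by simp (simp add: M_def)
    qed
    have "mat_delete (M * U) 0 0
        = map_mat raise_hom (mat ?l ?l (\<lambda>(i, j). hsym (\<gamma> ! i + int j - int i)))"
    proof (rule eq_matI)
      fix i j
      assume "i < dim_row (map_mat raise_hom (mat ?l ?l (\<lambda>(i, j). hsym (\<gamma> ! i + int j - int i))))"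
        and "j < dim_col (map_mat raise_hom (mat ?l ?l (\<lambda>(i, j). hsym (\<gamma> ! i + int j - int i))))"
      then have ij: "i < ?l" "j < ?l"
        by simp_all
      then have "mat_delete (M * U) 0 0 $$ (i, j) = (M * U) $$ (Suc i, Suc j)"
        using M U by (simp add: mat_delete_def)
      also have "\<dots> = raise_hom (hsym (\<gamma> ! i + int j - int i))"
        using ij by (simp only: MU Suc_less_eq) (simp add: M_def raise_hom_hsym algebra_simps)
      finally show "mat_delete (M * U) 0 0 $$ (i, j)
        = map_mat raise_hom (mat ?l ?l (\<lambda>(i, j). hsym (\<gamma> ! i + int j - int i))) $$ (i, j)"
        using ij by simp
    qed (use M U in \<open>simp_all add: mat_delete_def\<close>)
    then have del: "det (mat_delete (M * U) 0 0) = raise_hom (schur \<gamma>)"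
      by (simp add: schur_def raise_hom.hom_det)
    have "det (M * U) = (\<Sum>j<Suc ?l. (M * U) $$ (0, j) * cofactor (M * U) 0 j)"
      by (rule laplace_expansion_row[OF c]) simp
    also have "\<dots> = (\<Sum>j<Suc ?l. if j = 0 then cofactor (M * U) 0 0 else 0)"
      by (rule sum.cong) (auto simp: row)
    finally show ?thesis
      by (simp add: cofactor_def del)
  qed
  ultimately show ?thesis
    by (simp add: lessThan_Suc_atMost)
qed

lemma eperp_schur: "eperp c (schur \<gamma>) = (if c \<le> length \<gamma> then jt_minor \<gamma> c else 0)"
  by (simp add: eperp_def raise_hom_schur coeff_sum sum.delta)

lemma eperp_add: "eperp d (f + g) = eperp d f + eperp d g"
  by (simp add: eperp_def raise_hom.hom_add)

lemma eperp_tscale: "eperp d (c *\<^sub>t f) = c *\<^sub>t eperp d f"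
  by (simp add: eperp_def raise_hom_tscale) (simp add: tscale_def)

lemma eperp_zero [simp]: "eperp d 0 = 0"
  by (simp add: eperp_def)

lemma eperp_one: "eperp d 1 = (if d = 0 then 1 else 0)"
  by (simp add: eperp_def coeff_1 )

lemma eperp_mult: "eperp d (f * g) = (\<Sum>i\<le>d. eperp i f * eperp (d - i) g)"
  by (simp add: eperp_def raise_hom.hom_mult coeff_mult)

text \<open>The case \<open>t = 0\<close> of \<open>Bop\<close>. The upper limit cuts nothing off:
  \<open>eperp i f\<close> is a coefficient of \<open>raise_hom f\<close> and vanishes beyond its
  degree.\<close>

definition bernstein :: "int \<Rightarrow> sym \<Rightarrow> sym"
  where "bernstein m f = (\<Sum>i\<le>degree (raise_hom f). (- 1) ^ i * hsym (m + int i) * eperp i f)"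

lemma bernstein_eq_sum:
  assumes "\<And>i. N < i \<Longrightarrow> eperp i f = 0"
  shows "bernstein m f = (\<Sum>i\<le>N. (- 1) ^ i * hsym (m + int i) * eperp i f)"
proof -
  have "degree (raise_hom f) \<le> N"
    using assms by (intro degree_le) (auto simp: eperp_def)
  then show ?thesis
    unfolding bernstein_def by (intro sum.mono_neutral_left) (auto simp: eperp_def coeff_eq_0)
qed

lemma eperp_eventually_zero: "\<exists>N. \<forall>i>N. eperp i f = 0"
  by (auto simp: eperp_def intro!: exI[of _ "degree (raise_hom f)"] coeff_eq_0)

text \<open>The Laplace expansion along the first row and the expansion of
  \<open>raise_hom (schur \<gamma>)\<close> involve the same minors. Integer lists thus become
  products of operators, and a relation that moves past one operator extends to all lists by
  induction.\<close>

lemma schur_Cons: "schur (m # \<gamma>) = bernstein m (schur \<gamma>)"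
  by (simp add: schur_Cons_minor bernstein_eq_sum[of "length \<gamma>"] eperp_schur)

lemma schur_Nil [simp]: "schur [] = 1"
  by (simp add: schur_def)

lemma bernstein_add: "bernstein m (f + g) = bernstein m f + bernstein m g"
proof -
  obtain N1 N2 where N: "\<forall>i>N1. eperp i f = 0" "\<forall>i>N2. eperp i g = 0"
    using eperp_eventually_zero by metis
  show ?thesis
    using N by (simp add: bernstein_eq_sum[of "max N1 N2"] eperp_add distrib_left sum.distrib)
qed

lemma bernstein_tscale: "bernstein m (c *\<^sub>t f) = c *\<^sub>t bernstein m f"
proof -
  obtain N where N: "\<forall>i>N. eperp i f = 0"
    using eperp_eventually_zero by metis
  then have "bernstein m (c *\<^sub>t f) = (\<Sum>i\<le>N. (- 1) ^ i * hsym (m + int i) * eperp i (c *\<^sub>t f))"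
    by (intro bernstein_eq_sum) (simp add: eperp_tscale)
  also have "\<dots> = c *\<^sub>t bernstein m f"
    using N by (simp add: bernstein_eq_sum[of N] eperp_tscale) (simp add: tscale_def sum_distrib_left mult_ac)
  finally show ?thesis .
qed

lemma bernstein_one: "bernstein m 1 = hsym m"
  by (simp add: bernstein_eq_sum[of 0] eperp_one)

section \<open>Vertical strips, antisymmetry and vanishing of the determinant\<close>

definition shift_set :: "int \<Rightarrow> nat set \<Rightarrow> int list \<Rightarrow> int list"
  where "shift_set c S \<gamma> = map (\<lambda>p. \<gamma> ! p + (if p \<in> S then c else 0)) [0..<length \<gamma>]"

lemma length_shift_set [simp]: "length (shift_set c S \<gamma>) = length \<gamma>"
  by (simp add: shift_set_def)

lemma nth_shift_set [simp]:
  "p < length \<gamma> \<Longrightarrow> shift_set c S \<gamma> ! p = \<gamma> ! p + (if p \<in> S then c else 0)"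
  by (simp add: shift_set_def)

lemma schur_leibniz:
  "schur \<gamma> = (\<Sum>p | p permutes {0..<length \<gamma>}.
    signof p * (\<Prod>i = 0..<length \<gamma>. hsym (\<gamma> ! i + int (p i) - int i)))"
  unfolding schur_def
proof (subst det_def'[where n = "length \<gamma>"], simp, intro sum.cong refl arg_cong2[of _ _ _ _ times] prod.cong)
  fix p i assume "p \<in> {p. p permutes {0..<length \<gamma>}}" "i \<in> {0..<length \<gamma>}"
  then have "p i < length \<gamma>" "i < length \<gamma>"
    using permutes_in_image[of p "{0..<length \<gamma>}" i] by auto
  then show "mat (length \<gamma>) (length \<gamma>) (\<lambda>(i, j). hsym (\<gamma> ! i + int j - int i)) $$ (i, p i)
    = hsym (\<gamma> ! i + int (p i) - int i)"
    by simp
qed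

text \<open>Multilinearity in the rows gives a second expansion: each row contributes
  \<open>h\<close> or \<open>u\<close> times the lowered \<open>h\<close>, and \<open>S\<close>
  collects the rows with the latter choice. Comparing coefficients yields the vertical strip rule
  for every integer list, with no straightening.\<close>

lemma raise_hom_schur_sets:
  "raise_hom (schur \<gamma>) = (\<Sum>S\<in>Pow {..<length \<gamma>}. monom (schur (shift_set (- 1) S \<gamma>)) (card S))"
proof -
  let ?l = "length \<gamma>"
  let ?P = "{p. p permutes {0..<?l}}"
  have fin: "finite ?P"
    by (simp add: finite_permutations)
  have sg: "raise_hom (signof p * a) = signof p * raise_hom a" for p :: "nat \<Rightarrow> nat" and a
    by (cases "evenperm p") (simp_all add: sign_def raise_hom.hom_uminus)
  have "raise_hom (schur \<gamma>)
    = (\<Sum>p\<in>?P. signof p * (\<Prod>i = 0..<?l. raise_hom (hsym (\<gamma> ! i + int (p i) - int i))))"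
    by (simp add: schur_leibniz raise_hom.hom_sum raise_hom.hom_prod sg)
  also have "\<dots> = (\<Sum>p\<in>?P. signof p * (\<Sum>S\<in>Pow {..<?l}.
      (\<Prod>i\<in>S. [:0, hsym (\<gamma> ! i - 1 + int (p i) - int i):])
      * (\<Prod>i\<in>{..<?l} - S. [:hsym (\<gamma> ! i + int (p i) - int i):])))"
  proof (intro sum.cong refl arg_cong2[of _ _ _ _ times])
    fix p
    have "(\<Prod>i = 0..<?l. raise_hom (hsym (\<gamma> ! i + int (p i) - int i)))
      = (\<Prod>i<?l. [:0, hsym (\<gamma> ! i - 1 + int (p i) - int i):] + [:hsym (\<gamma> ! i + int (p i) - int i):])"
      unfolding atLeast0LessThan by (intro prod.cong) (auto simp: raise_hom_hsym algebra_simps)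
    also have "\<dots> = (\<Sum>S\<in>Pow {..<?l}.
      (\<Prod>i\<in>S. [:0, hsym (\<gamma> ! i - 1 + int (p i) - int i):])
      * (\<Prod>i\<in>{..<?l} - S. [:hsym (\<gamma> ! i + int (p i) - int i):]))"
      by (rule prod_add) simp
    finally show "(\<Prod>i = 0..<?l. raise_hom (hsym (\<gamma> ! i + int (p i) - int i))) = (\<Sum>S\<in>Pow {..<?l}.
      (\<Prod>i\<in>S. [:0, hsym (\<gamma> ! i - 1 + int (p i) - int i):])
      * (\<Prod>i\<in>{..<?l} - S. [:hsym (\<gamma> ! i + int (p i) - int i):]))" .
  qed
  also have "\<dots> = (\<Sum>p\<in>?P. signof p * (\<Sum>S\<in>Pow {..<?l}.
      monom (\<Prod>i = 0..<?l. hsym (shift_set (- 1) S \<gamma> ! i + int (p i) - int i)) (card S)))"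
  proof (intro sum.cong refl arg_cong2[of _ _ _ _ times])
    fix p S assume "S \<in> Pow {..<?l}"
    then have S: "S \<subseteq> {..<?l}" "finite S"
      by (auto intro: finite_subset)
    have 1: "(\<Prod>i\<in>S. [:0, hsym (\<gamma> ! i - 1 + int (p i) - int i):])
      = monom (\<Prod>i\<in>S. hsym (shift_set (- 1) S \<gamma> ! i + int (p i) - int i)) (card S)"
    proof -
      have "(\<Prod>i\<in>T. [:0, hsym (\<gamma> ! i - 1 + int (p i) - int i):])
        = monom (\<Prod>i\<in>T. hsym (shift_set (- 1) S \<gamma> ! i + int (p i) - int i)) (card T)"
        if "finite T" "T \<subseteq> S" for T
        using that
      proof (induction T)
        case (insert x T)
        have x: "[:0, hsym (\<gamma> ! x - 1 + int (p x) - int x):]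
          = monom (hsym (shift_set (- 1) S \<gamma> ! x + int (p x) - int x)) 1"
          using insert S by (subst nth_shift_set) (auto simp: monom_altdef algebra_simps)
        show ?case
          using insert by (simp add: x mult_monom Suc_eq_plus1_left del: One_nat_def)
      qed (simp add: monom_0)
      then show ?thesis
        using S by simp
    qed
    have 2: "(\<Prod>i\<in>{..<?l} - S. [:hsym (\<gamma> ! i + int (p i) - int i):])
      = [:(\<Prod>i\<in>{..<?l} - S. hsym (shift_set (- 1) S \<gamma> ! i + int (p i) - int i)):]"
    proof -
      have "(\<Prod>i\<in>T. [:hsym (\<gamma> ! i + int (p i) - int i):])
        = [:(\<Prod>i\<in>T. hsym (shift_set (- 1) S \<gamma> ! i + int (p i) - int i)):]"
        if "finite T" "T \<subseteq> {..<?l} - S" for T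
        using that
      proof (induction T)
        case (insert x T)
        then show ?case
          by (subst prod.insert; simp add: subset_eq mult.commute)
      qed (simp add: one_pCons)
      then show ?thesis
        by simp
    qed
    have "(\<Prod>i = 0..<?l. hsym (shift_set (- 1) S \<gamma> ! i + int (p i) - int i))
      = (\<Prod>i\<in>S. hsym (shift_set (- 1) S \<gamma> ! i + int (p i) - int i))
        * (\<Prod>i\<in>{..<?l} - S. hsym (shift_set (- 1) S \<gamma> ! i + int (p i) - int i))"
      unfolding atLeast0LessThan by (subst prod.subset_diff[OF S(1)]) (simp_all only: finite_lessThan mult.commute)
    then show "(\<Prod>i\<in>S. [:0, hsym (\<gamma> ! i - 1 + int (p i) - int i):])
        * (\<Prod>i\<in>{..<?l} - S. [:hsym (\<gamma> ! i + int (p i) - int i):])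
      = monom (\<Prod>i = 0..<?l. hsym (shift_set (- 1) S \<gamma> ! i + int (p i) - int i)) (card S)"
      by (simp only: 1 2) (simp add: mult.commute[of "monom _ _"] smult_monom mult.commute)
  qed
  also have "\<dots> = (\<Sum>S\<in>Pow {..<?l}. \<Sum>p\<in>?P. signof p *
      monom (\<Prod>i = 0..<?l. hsym (shift_set (- 1) S \<gamma> ! i + int (p i) - int i)) (card S))"
    by (simp add: sum_distrib_left) (rule sum.swap)
  also have "\<dots> = (\<Sum>S\<in>Pow {..<?l}. monom (schur (shift_set (- 1) S \<gamma>)) (card S))"
  proof (rule sum.cong[OF refl])
    fix S assume "S \<in> Pow {..<?l}"
    have sg: "signof p * monom a n = monom (signof p * a) n" for p :: "nat \<Rightarrow> nat" and a :: sym and n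
      by (cases "evenperm p") (simp_all add: sign_def minus_monom)
    have "schur (shift_set (- 1) S \<gamma>) = (\<Sum>p\<in>?P. signof p *
      (\<Prod>i = 0..<?l. hsym (shift_set (- 1) S \<gamma> ! i + int (p i) - int i)))"
      by (simp add: schur_leibniz)
    then show "(\<Sum>p\<in>?P. signof p * monom (\<Prod>i = 0..<?l. hsym (shift_set (- 1) S \<gamma> ! i + int (p i) - int i)) (card S))
      = monom (schur (shift_set (- 1) S \<gamma>)) (card S)"
      by (simp add: sg monom_sum)
  qed
  finally show ?thesis .
qed

lemma eperp_schur_sets:
  "eperp d (schur \<gamma>) = (\<Sum>S | S \<subseteq> {..<length \<gamma>} \<and> card S = d. schur (shift_set (- 1) S \<gamma>))"
proof -
  have "eperp d (schur \<gamma>) = (\<Sum>S\<in>Pow {..<length \<gamma>}. if card S = d then schur (shift_set (- 1) S \<gamma>) else 0)"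
    by (simp add: eperp_def raise_hom_schur_sets coeff_sum)
  also have "\<dots> = (\<Sum>S\<in>{S \<in> Pow {..<length \<gamma>}. card S = d}. schur (shift_set (- 1) S \<gamma>))"
    by (subst sum.inter_filter) auto
  finally show ?thesis
    by simp
qed

lemma schur_swap:
  assumes "Suc i < length \<gamma>"
  shows "schur (\<gamma>[i := \<gamma> ! Suc i - 1, Suc i := \<gamma> ! i + 1]) = - schur \<gamma>"
proof -
  let ?l = "length \<gamma>"
  let ?A = "mat ?l ?l (\<lambda>(i, j). hsym (\<gamma> ! i + int j - int i))"
  have "det (swaprows i (Suc i) ?A) = - det ?A"
    by (rule det_swaprows[where n = ?l]) (use assms in auto)
  moreover have "swaprows i (Suc i) ?A = mat ?l ?l (\<lambda>(r, j).
      hsym (\<gamma>[i := \<gamma> ! Suc i - 1, Suc i := \<gamma> ! i + 1] ! r + int j - int r))"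
    using assms by (intro eq_matI) (auto simp: nth_list_update algebra_simps)
  ultimately show ?thesis
    by (simp add: schur_def)
qed

text \<open>In each term of the determinant the indices add up to \<open>sum_list \<gamma>\<close>,
  because a permutation does not change the sum of the positions; so some index is negative.\<close>

lemma schur_zero_sum:
  assumes "sum_list \<gamma> < 0"
  shows "schur \<gamma> = 0"
proof -
  let ?l = "length \<gamma>"
  have "(\<Prod>i = 0..<?l. hsym (\<gamma> ! i + int (p i) - int i)) = 0" if p: "p permutes {0..<?l}" for p
  proof -
    have "(\<Sum>i = 0..<?l. int (p i)) = (\<Sum>i = 0..<?l. int i)"
      by (rule sum.reindex_bij_betw[OF permutes_imp_bij[OF p]])
    then have "(\<Sum>i = 0..<?l. \<gamma> ! i + int (p i) - int i) < 0"
      using assms by (simp add: sum.distrib sum_subtractf sum_list_sum_nth)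
    then obtain i where "i \<in> {0..<?l}" "\<gamma> ! i + int (p i) - int i < 0"
      by (meson linorder_not_le sum_nonneg)
    then show ?thesis
      by (intro prod_zero) (auto simp: hsym_def intro!: bexI[of _ i])
  qed
  moreover have "schur \<gamma> = (\<Sum>p | p permutes {0..<?l}. signof p *
      (\<Prod>i = 0..<?l. hsym (\<gamma> ! i + int (p i) - int i)))"
    by (rule schur_leibniz)
  ultimately show ?thesis
    by (auto simp: intro!: sum.neutral)
qed

lemma sym_eq_minus_self: "(f::sym) = - f \<Longrightarrow> f = 0"
proof (rule poly_mapping_eqI)
  fix m assume "f = - f"
  then have "Poly_Mapping.lookup f m = - Poly_Mapping.lookup f m"
    by (metis lookup_uminus)
  then show "Poly_Mapping.lookup f m = Poly_Mapping.lookup 0 m"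
    by (simp add: eq_neg_iff_add_eq_0 poly_eq_iff)
qed

lemma schur_append: "schur (\<gamma> @ \<delta>) = foldr bernstein \<gamma> (schur \<delta>)"
  by (induction \<gamma>) (simp_all add: schur_Cons)

lemma hsym_zero [simp]: "hsym 0 = 1"
  by (simp add: hsym_def)

lemma schur_replicate_zero [simp]: "schur (replicate n 0) = 1"
  by (induction n) (simp_all add: schur_Cons bernstein_one)

lemma schur_append_zeros: "schur (\<gamma> @ replicate n 0) = schur \<gamma>"
  using schur_append[of \<gamma> "replicate n 0"] schur_append[of \<gamma> "[]"] by simp

lemma bernstein_zero [simp]: "bernstein m 0 = 0"
  by (simp add: bernstein_def)

lemma foldr_bernstein_zero [simp]: "foldr bernstein \<gamma> 0 = 0"
  by (induction \<gamma>) simp_all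

lemma schur_zero_suffix: "sum_list \<delta> < 0 \<Longrightarrow> schur (\<gamma> @ \<delta>) = 0"
  by (simp add: schur_append schur_zero_sum)

lemma schur_singleton: "schur [m] = hsym m"
  by (simp add: schur_Cons bernstein_one)


section \<open>Schur functions span the ring\<close>

lemma eperp_hsym: "eperp i (hsym n) = (if i = 0 then hsym n else if i = 1 then hsym (n - 1) else 0)"
  by (auto simp: eperp_def raise_hom_hsym coeff_pCons split: nat.split)


text \<open>\<open>raise_hom (hsym n)\<close> is linear in \<open>u\<close>, so
  \<open>eperp i (hsym n * f)\<close> has two terms; in the second the summation index moves by one,
  which turns \<open>m\<close> into \<open>m + 1\<close>. As \<open>n\<close> drops in the extra
  term, multiplication by \<open>h\<^sub>n\<close> can be pushed through the operators by induction
  on \<open>n\<close>.\<close>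

lemma hsym_mult_bernstein: "hsym n * bernstein m f = bernstein m (hsym n * f) + hsym (n - 1) * bernstein (m + 1) f"
proof -
  obtain N where N: "\<forall>i>N. eperp i f = 0"
    using eperp_eventually_zero by metis
  have eperp: "eperp i (hsym n * f) = hsym n * eperp i f + (if i = 0 then 0 else hsym (n - 1) * eperp (i - 1) f)" for i
  proof (cases i)
    case (Suc j)
    have "eperp i (hsym n * f) = hsym n * eperp (Suc j) f + (\<Sum>k\<le>j. eperp (Suc k) (hsym n) * eperp (j - k) f)"
      unfolding eperp_mult Suc by (subst sum.atMost_Suc_shift) (simp add: eperp_hsym)
    also have "(\<Sum>k\<le>j. eperp (Suc k) (hsym n) * eperp (j - k) f)
        = (\<Sum>k\<le>j. if k = 0 then hsym (n - 1) * eperp j f else 0)"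
      by (intro sum.cong) (auto simp: eperp_hsym)
    finally show ?thesis
      using Suc by (simp add: sum.delta)
  qed (simp add: eperp_mult eperp_hsym)
  have "bernstein m (hsym n * f) = (\<Sum>i\<le>Suc N. (- 1) ^ i * hsym (m + int i) * eperp i (hsym n * f))"
    using N by (intro bernstein_eq_sum) (auto simp: eperp)
  also have "\<dots> = (\<Sum>i\<le>Suc N. hsym n * ((- 1) ^ i * hsym (m + int i) * eperp i f))
      + (\<Sum>i\<le>Suc N. if i = 0 then 0 else (- 1) ^ i * hsym (m + int i) * (hsym (n - 1) * eperp (i - 1) f))"
    unfolding sum.distrib[symmetric] by (intro sum.cong) (simp_all add: eperp, simp_all add: algebra_simps)
  also have "(\<Sum>i\<le>Suc N. hsym n * ((- 1) ^ i * hsym (m + int i) * eperp i f)) = hsym n * bernstein m f"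
    using N by (subst bernstein_eq_sum[of "Suc N"]) (auto simp: sum_distrib_left)
  also have "(\<Sum>i\<le>Suc N. if i = 0 then 0 else (- 1) ^ i * hsym (m + int i) * (hsym (n - 1) * eperp (i - 1) f))
      = (\<Sum>i\<le>N. (- 1) ^ Suc i * hsym (m + int (Suc i)) * (hsym (n - 1) * eperp i f))"
    by (subst sum.atMost_Suc_shift) simp
  also have "\<dots> = - (hsym (n - 1) * bernstein (m + 1) f)"
    using N by (subst bernstein_eq_sum[of N]) (auto simp: algebra_simps sum_negf sum_distrib_left)
  finally show ?thesis
    by simp
qed

lemma bernstein_span:
  assumes "f \<in> Sym.span (range schur)"
  shows "bernstein m f \<in> Sym.span (range schur)"
  using assms
proof (induction rule: Sym.span_induct_alt)
  case (step c x y)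
  then obtain \<gamma> where "x = schur \<gamma>"
    by auto
  then have "bernstein m x \<in> Sym.span (range schur)"
    by (auto simp: schur_Cons[symmetric] intro: Sym.span_base)
  then show ?case
    using step by (simp add: bernstein_add bernstein_tscale Sym.span_add Sym.span_scale)
qed (simp add: Sym.span_zero)

lemma hsym_mult_schur_span: "hsym n * schur \<gamma> \<in> Sym.span (range schur)"
proof (induction \<gamma> arbitrary: n)
  case Nil
  show ?case
    by (auto simp: schur_singleton[symmetric] intro: Sym.span_base)
next
  case (Cons m \<gamma>)
  have "hsym (int k) * schur (m # \<gamma>) \<in> Sym.span (range schur)" for m k
  proof (induction k arbitrary: m)
    case (Suc k)
    have "hsym (int (Suc k)) * schur (m # \<gamma>)
      = bernstein m (hsym (int (Suc k)) * schur \<gamma>) + hsym (int k) * schur ((m + 1) # \<gamma>)"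
      using hsym_mult_bernstein[of "int (Suc k)" m "schur \<gamma>"] by (simp add: schur_Cons)
    then show ?case
      using Suc bernstein_span[OF Cons] by (simp add: Sym.span_add)
  qed (simp add: Sym.span_base)
  from this[of "nat n" m] show ?case
    by (cases "n < 0") (simp_all add: hsym_def Sym.span_zero)
qed

lemma span_schur_UNIV: "Sym.span (range schur) = UNIV"
proof -
  have h: "hsym n * f \<in> Sym.span (range schur)" if "f \<in> Sym.span (range schur)" for n f
    using that
  proof (induction rule: Sym.span_induct_alt)
    case (step c x y)
    then obtain \<gamma> where "x = schur \<gamma>"
      by auto
    then have "hsym n * x \<in> Sym.span (range schur)"
      by (simp add: hsym_mult_schur_span)
    moreover have "hsym n * (c *\<^sub>t x + y) = c *\<^sub>t (hsym n * x) + hsym n * y"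
      by (simp add: tscale_def algebra_simps)
    ultimately show ?case
      using step by (simp add: Sym.span_add Sym.span_scale)
  qed (simp add: Sym.span_zero)
  have mono: "Poly_Mapping.single m 1 \<in> Sym.span (range schur)" for m :: "nat \<Rightarrow>\<^sub>0 nat"
  proof (induction "\<Sum>n\<in>Poly_Mapping.keys m. Poly_Mapping.lookup m n" arbitrary: m rule: less_induct)
    case less
    show ?case
    proof (cases "m = 0")
      case True
      then have "Poly_Mapping.single m 1 = schur []"
        by simp
      then show ?thesis
        by (metis Sym.span_base rangeI)
    next
      case False
      then obtain n where n: "n \<in> Poly_Mapping.keys m"
        by fastforce
      define m' where "m' = m - Poly_Mapping.single n 1"
      have m: "m = Poly_Mapping.single n 1 + m'"
        using n by (intro poly_mapping_eqI)
          (auto simp: m'_def lookup_add lookup_minus lookup_single when_def in_keys_iff)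
      have sub: "Poly_Mapping.keys m' \<subseteq> Poly_Mapping.keys m"
        by (auto simp: m'_def in_keys_iff lookup_minus)
      have "(\<Sum>n\<in>Poly_Mapping.keys m'. Poly_Mapping.lookup m' n)
          = (\<Sum>n\<in>Poly_Mapping.keys m. Poly_Mapping.lookup m' n)"
        by (rule sum.mono_neutral_left) (use sub in \<open>auto simp: in_keys_iff\<close>)
      also have "\<dots> < (\<Sum>n\<in>Poly_Mapping.keys m. Poly_Mapping.lookup m n)"
        by (rule sum_strict_mono_ex1) (use n in \<open>auto simp: m'_def lookup_minus lookup_single when_def in_keys_iff intro!: bexI[of _ n]\<close>)
      finally have "Poly_Mapping.single m' 1 \<in> Sym.span (range schur)"
        by (rule less)
      moreover have "hsym (int n + 1) = Poly_Mapping.single (Poly_Mapping.single n 1) 1"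
        by (simp add: hsym_def nat_add_distrib)
      ultimately show ?thesis
        using h[of "Poly_Mapping.single m' 1" "int n + 1"] by (simp add: m mult_single)
    qed
  qed
  have "f \<in> Sym.span (range schur)" for f :: sym
  proof (induction f rule: pm_induct)
    case (single m c)
    have "Poly_Mapping.single m c = c *\<^sub>t Poly_Mapping.single m 1"
      by (simp add: tscale_def mult_single)
    then show ?case
      by (simp add: mono Sym.span_scale)
  qed (auto intro: Sym.span_add Sym.span_zero)
  then show ?thesis
    by auto
qed

lemma schur_induct [case_names zero add]:
  assumes "P 0" and "\<And>c \<gamma> f. P f \<Longrightarrow> P (c *\<^sub>t schur \<gamma> + f)"
  shows "P f"
proof -
  have "f \<in> Sym.span (range schur)"
    by (simp add: span_schur_UNIV)
  then show ?thesis
    by (induction rule: Sym.span_induct_alt) (use assms in auto)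
qed

lemma eperp_0 [simp]: "eperp 0 f = f"
proof (induction f rule: schur_induct)
  case (add c \<gamma> f)
  have "{S. S \<subseteq> {..<length \<gamma>} \<and> card S = 0} = {{}}"
    by (auto dest: finite_subset)
  moreover have "shift_set (- 1) {} \<gamma> = \<gamma>"
    by (rule nth_equalityI) simp_all
  ultimately have "eperp 0 (schur \<gamma>) = schur \<gamma>"
    by (simp add: eperp_schur_sets)
  with add show ?case
    by (simp add: eperp_add eperp_tscale)
qed simp

section \<open>Straightening and the Schur basis\<close>

text \<open>For a partition this is the usual statistic \<open>n(\<gamma>)\<close>. As a single
  integer it replaces the dominance order in the triangularity arguments.\<close>

definition moment :: "int list \<Rightarrow> int"
  where "moment \<gamma> = (\<Sum>p<length \<gamma>. int p * \<gamma> ! p)"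

text \<open>
  In terms of \<open>\<gamma>\<^sub>p - p\<close> the dot action of the symmetric group permutes positions. Sorting strictly
  decreases \<open>moment\<close>, as does applying a raising operator.
\<close>

definition beta_list :: "int list \<Rightarrow> int list"
  where "beta_list \<gamma> = map (\<lambda>p. \<gamma> ! p - int p) [0..<length \<gamma>]"

lemma length_beta_list [simp]: "length (beta_list \<gamma>) = length \<gamma>"
  by (simp add: beta_list_def)

lemma nth_beta_list [simp]: "p < length \<gamma> \<Longrightarrow> beta_list \<gamma> ! p = \<gamma> ! p - int p"
  by (simp add: beta_list_def)

lemma moment_update:
  assumes "i < length \<gamma>"
  shows "moment (\<gamma>[i := x]) = moment \<gamma> + int i * (x - \<gamma> ! i)"
  using assms
  by (simp add: moment_def sum.remove[of "{..<length \<gamma>}" i] algebra_simps)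

definition dot_swap :: "nat \<Rightarrow> int list \<Rightarrow> int list"
  where "dot_swap i \<gamma> = \<gamma>[i := \<gamma> ! Suc i - 1, Suc i := \<gamma> ! i + 1]"

lemma length_dot_swap [simp]: "length (dot_swap i \<gamma>) = length \<gamma>"
  by (simp add: dot_swap_def)

lemma beta_list_dot_swap:
  assumes "Suc i < length \<gamma>"
  shows "mset (beta_list (dot_swap i \<gamma>)) = mset (beta_list \<gamma>)"
proof -
  have "beta_list (dot_swap i \<gamma>)
    = (beta_list \<gamma>)[Suc i := beta_list \<gamma> ! i, i := beta_list \<gamma> ! Suc i]"
    using assms by (intro nth_equalityI) (auto simp: dot_swap_def nth_list_update)
  also have "mset \<dots> = mset (beta_list \<gamma>)"
    by (rule mset_swap) (use assms in auto)
  finally show ?thesis .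
qed

lemma not_decreasingE:
  assumes "\<not> sorted_wrt (\<ge>) (\<gamma> :: int list)"
  obtains i where "Suc i < length \<gamma>" "\<gamma> ! i < \<gamma> ! Suc i"
proof -
  have "transp ((\<ge>) :: int \<Rightarrow> int \<Rightarrow> bool)"
    by (auto intro: transpI)
  with assms that show ?thesis
    by (auto simp: sorted_wrt_iff_nth_Suc_transp)
qed

text \<open>Formulated for any family antisymmetric under the dot action because it is applied both
  to \<open>schur\<close> and to the head of \<open>Bvec\<close>. Sorting is by adjacent swaps; an
  ascent by exactly one is fixed by its swap, and then the value equals its own negative.\<close>

lemma antisym_sort:
  fixes X :: "int list \<Rightarrow> sym"
  assumes anti: "\<And>\<gamma> i. length \<gamma> = r \<Longrightarrow> Suc i < r \<Longrightarrow> X (dot_swap i \<gamma>) = - X \<gamma>"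
    and "length \<gamma> = r"
  obtains "X \<gamma> = 0"
  | \<kappa> where "length \<kappa> = r" "sorted_wrt (\<ge>) \<kappa>" "mset (beta_list \<kappa>) = mset (beta_list \<gamma>)"
    "X \<gamma> = X \<kappa> \<or> X \<gamma> = - X \<kappa>" "\<kappa> = \<gamma> \<or> moment \<kappa> < moment \<gamma>"
proof -
  \<comment> \<open>The entries of \<open>beta_list\<close> are only permuted, so a lower bound
    \<open>c\<close> for them gives \<open>p + c \<le> \<gamma>\<^sub>p\<close> all along and bounds
    the moment from below; this makes its decrease well-founded.\<close>
  obtain c where c: "\<forall>n\<in>set (beta_list \<gamma>). c \<le> n"
    using that[of "Min (set (beta_list \<gamma>))"] by simp
  have "X \<gamma> = 0 \<or> (\<exists>\<kappa>. length \<kappa> = r \<and> sorted_wrt (\<ge>) \<kappa> \<and> mset (beta_list \<kappa>) = mset (beta_list \<gamma>)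
    \<and> (X \<gamma> = X \<kappa> \<or> X \<gamma> = - X \<kappa>) \<and> (\<kappa> = \<gamma> \<or> moment \<kappa> < moment \<gamma>))"
    using \<open>length \<gamma> = r\<close> c
  proof (induction "nat (moment \<gamma> - (\<Sum>p<r. int p * (int p + c)))" arbitrary: \<gamma> rule: less_induct)
    case (less \<gamma>)
    show ?case
    proof (cases "sorted_wrt (\<ge>) \<gamma>")
      case True
      then show ?thesis
        using less.prems by auto
    next
      case False
      then obtain i where i: "Suc i < length \<gamma>" "\<gamma> ! i < \<gamma> ! Suc i"
        by (rule not_decreasingE)
      have X: "X (dot_swap i \<gamma>) = - X \<gamma>"
        using anti i less.prems by simp
      show ?thesis
      proof (cases "\<gamma> ! Suc i = \<gamma> ! i + 1")
        case True
        then have "dot_swap i \<gamma> = \<gamma>"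
          using i by (intro nth_equalityI) (auto simp: dot_swap_def nth_list_update)
        then show ?thesis
          using X sym_eq_minus_self by metis
      next
        case False
        have ms: "mset (beta_list (dot_swap i \<gamma>)) = mset (beta_list \<gamma>)"
          by (rule beta_list_dot_swap[OF i(1)])
        then have st: "set (beta_list (dot_swap i \<gamma>)) = set (beta_list \<gamma>)"
          by (rule mset_eq_setD)
        have "moment (dot_swap i \<gamma>) = moment \<gamma> + (\<gamma> ! i + 1 - \<gamma> ! Suc i)"
          using i by (simp add: dot_swap_def moment_update algebra_simps)
        then have lt: "moment (dot_swap i \<gamma>) < moment \<gamma>"
          using i False by simp
        have "(\<Sum>p<r. int p * (int p + c)) \<le> moment \<delta>"
          if "length \<delta> = r" "\<forall>n\<in>set (beta_list \<delta>). c \<le> n" for \<delta>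
        proof -
          have "int p + c \<le> \<delta> ! p" if "p < r" for p
          proof -
            have "beta_list \<delta> ! p \<in> set (beta_list \<delta>)"
              using that \<open>length \<delta> = r\<close> by (intro nth_mem) simp
            then show ?thesis
              using that \<open>length \<delta> = r\<close> \<open>\<forall>n\<in>set (beta_list \<delta>). c \<le> n\<close> by force
          qed
          then show ?thesis
            unfolding moment_def that(1) by (intro sum_mono mult_left_mono) auto
        qed
        then have "(\<Sum>p<r. int p * (int p + c)) \<le> moment (dot_swap i \<gamma>)"
          using less.prems st by simp
        then have "nat (moment (dot_swap i \<gamma>) - (\<Sum>p<r. int p * (int p + c)))
          < nat (moment \<gamma> - (\<Sum>p<r. int p * (int p + c)))"
          using lt by linarith
        from less.hyps[OF this] less.prems st
        consider "X (dot_swap i \<gamma>) = 0"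
          | \<kappa> where "length \<kappa> = r" "sorted_wrt (\<ge>) \<kappa>"
            "mset (beta_list \<kappa>) = mset (beta_list (dot_swap i \<gamma>))"
            "X (dot_swap i \<gamma>) = X \<kappa> \<or> X (dot_swap i \<gamma>) = - X \<kappa>"
            "\<kappa> = dot_swap i \<gamma> \<or> moment \<kappa> < moment (dot_swap i \<gamma>)"
          by auto
        then show ?thesis
        proof cases
          case 1
          then show ?thesis
            using X by simp
        next
          case 2
          then have "moment \<kappa> < moment \<gamma>"
            using lt by auto
          moreover have "X \<gamma> = X \<kappa> \<or> X \<gamma> = - X \<kappa>"
            using 2(4) X by (metis minus_minus)
          ultimately show ?thesis
            using 2 ms by auto
        qed
      qed
    qed
  qed
  then show ?thesis
    using that by blast
qed

lemma schur_eq_strip: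
  fixes \<kappa> :: "int list"
  assumes "sorted_wrt (\<ge>) \<kappa>" "\<forall>a\<in>set \<kappa>. 0 \<le> a"
  shows "\<kappa> = filter (\<lambda>a. a \<noteq> 0) \<kappa> @ replicate (length \<kappa> - length (filter (\<lambda>a. a \<noteq> 0) \<kappa>)) 0"
  using assms
proof (induction \<kappa>)
  case (Cons a \<kappa>)
  show ?case
  proof (cases "a = 0")
    case True
    have "\<forall>b\<in>set \<kappa>. b = 0"
    proof
      fix b assume b: "b \<in> set \<kappa>"
      with Cons.prems True have "b \<le> 0" by simp
      moreover have "0 \<le> b" using Cons.prems b by simp
      ultimately show "b = 0" by simp
    qed
    then have "filter (\<lambda>a. a \<noteq> 0) \<kappa> = []" "\<kappa> = replicate (length \<kappa>) 0"
      by (auto simp: replicate_length_same)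
    then show ?thesis
      using True by simp
  qed (use Cons in simp)
qed simp

lemma filter_partition:
  assumes "sorted_wrt (\<ge>) \<kappa>" "\<forall>a\<in>set \<kappa>. 0 \<le> a"
  shows "filter (\<lambda>a. a \<noteq> 0) \<kappa> \<in> partitions"
  using assms by (auto simp: partitions_def sorted_wrt_filter less_le)

lemma schur_filter:
  assumes "sorted_wrt (\<ge>) \<kappa>" "\<forall>a\<in>set \<kappa>. 0 \<le> a"
  shows "schur (filter (\<lambda>a. a \<noteq> 0) \<kappa>) = schur \<kappa>"
  using schur_eq_strip[OF assms] schur_append_zeros by metis

lemma schur_decreasing_negative:
  assumes "sorted_wrt (\<ge>) \<kappa>" "\<not> (\<forall>a\<in>set \<kappa>. 0 \<le> a)"
  shows "schur \<kappa> = 0"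
proof -
  have "\<kappa> \<noteq> []"
    using assms by auto
  then obtain \<gamma> b where \<kappa>: "\<kappa> = \<gamma> @ [b]"
    by (metis rev_exhaust)
  then have "b < 0"
    using assms by (auto simp: sorted_wrt_append)
  then show ?thesis
    using schur_zero_suffix[of "[b]" \<gamma>] \<kappa> by simp
qed

lemma schur_dot_swap: "Suc i < length \<gamma> \<Longrightarrow> schur (dot_swap i \<gamma>) = - schur \<gamma>"
  by (simp add: dot_swap_def schur_swap)

lemma schur_zero_adjacent:
  assumes "Suc i < length \<gamma>" "\<gamma> ! Suc i = \<gamma> ! i + 1"
  shows "schur \<gamma> = 0"
proof -
  have "dot_swap i \<gamma> = \<gamma>"
    using assms by (intro nth_equalityI) (auto simp: dot_swap_def nth_list_update)
  then show ?thesis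
    using schur_dot_swap[OF assms(1)] sym_eq_minus_self by metis
qed

lemma schur_straighten:
  obtains "schur \<gamma> = 0"
  | \<kappa> where "length \<kappa> = length \<gamma>" "sorted_wrt (\<ge>) \<kappa>" "\<forall>a\<in>set \<kappa>. 0 \<le> a"
    "mset (beta_list \<kappa>) = mset (beta_list \<gamma>)" "schur \<gamma> = schur \<kappa> \<or> schur \<gamma> = - schur \<kappa>"
    "\<kappa> = \<gamma> \<or> moment \<kappa> < moment \<gamma>"
proof (rule antisym_sort[of "length \<gamma>" schur \<gamma>])
  fix \<kappa>
  assume \<kappa>: "length \<kappa> = length \<gamma>" "sorted_wrt (\<ge>) \<kappa>" "mset (beta_list \<kappa>) = mset (beta_list \<gamma>)"
    "schur \<gamma> = schur \<kappa> \<or> schur \<gamma> = - schur \<kappa>" "\<kappa> = \<gamma> \<or> moment \<kappa> < moment \<gamma>"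
  show thesis
  proof (cases "\<forall>a\<in>set \<kappa>. 0 \<le> a")
    case True
    show ?thesis
      by (rule that(2)) (use \<kappa> True in auto)
  next
    case False
    then have "schur \<kappa> = 0"
      by (intro schur_decreasing_negative \<kappa>)
    then show ?thesis
      using \<kappa> that(1) by auto
  qed
qed (use schur_dot_swap that(1) in auto)

lemma span_schur_partitions: "Sym.span (schur ` partitions) = UNIV"
proof -
  have "schur \<gamma> \<in> Sym.span (schur ` partitions)" for \<gamma>
  proof (rule schur_straighten[of \<gamma>])
    fix \<kappa>
    assume \<kappa>: "sorted_wrt (\<ge>) \<kappa>" "\<forall>a\<in>set \<kappa>. 0 \<le> a" "schur \<gamma> = schur \<kappa> \<or> schur \<gamma> = - schur \<kappa>"
    have "schur \<kappa> \<in> Sym.span (schur ` partitions)"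
      using schur_filter[OF \<kappa>(1,2)] filter_partition[OF \<kappa>(1,2)] by (metis Sym.span_base imageI)
    then show ?thesis
      using \<kappa>(3) by (auto intro: Sym.span_neg)
  qed (simp add: Sym.span_zero)
  then have "Sym.span (range schur) \<subseteq> Sym.span (schur ` partitions)"
    by (intro Sym.span_minimal) auto
  then show ?thesis
    using span_schur_UNIV by blast
qed

lemma schur_partition_induct [case_names zero add]:
  assumes "P 0" and "\<And>c \<rho> f. \<rho> \<in> partitions \<Longrightarrow> P f \<Longrightarrow> P (c *\<^sub>t schur \<rho> + f)"
  shows "P f"
proof -
  have "f \<in> Sym.span (schur ` partitions)"
    by (simp add: span_schur_partitions)
  then show ?thesis
    by (induction rule: Sym.span_induct_alt) (use assms in auto)
qed

lemma eperp_sum: "eperp d (\<Sum>i\<in>A. f i) = (\<Sum>i\<in>A. eperp d (f i))"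
  by (induction A rule: infinite_finite_induct) (simp_all add: eperp_add)

text \<open>
  Applying \<open>e\<^sub>l\<^sup>\<bottom>\<close>, where \<open>l\<close> is the maximal length occurring in a relation, kills the shorter
  partitions and removes a column from each of the others.
\<close>

lemma schur_partitions_independent:
  assumes "finite A" "A \<subseteq> partitions" "(\<Sum>\<rho>\<in>A. c \<rho> *\<^sub>t schur \<rho>) = 0" "\<rho> \<in> A"
  shows "c \<rho> = 0"
  using assms
proof (induction "\<Sum>\<rho>\<in>A. Suc (nat (sum_list \<rho>))" arbitrary: A c \<rho> rule: less_induct)
  case less
  define l where "l = Max (length ` A)"
  have le: "length \<mu> \<le> l" if "\<mu> \<in> A" for \<mu>
    using that less.prems by (simp add: l_def)
  have pos: "\<forall>a\<in>set \<mu>. 0 < a" and srt: "sorted_wrt (\<ge>) \<mu>" if "\<mu> \<in> A" for \<mu>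
    using that less.prems by (auto simp: partitions_def)
  define B where "B = {\<mu> \<in> A. length \<mu> = l}"
  have BA: "B \<subseteq> A" "finite B"
    using less.prems by (auto simp: B_def)
  have "l \<in> length ` A"
    unfolding l_def using less.prems by (intro Max_in) auto
  then obtain \<mu>0 where \<mu>0: "\<mu>0 \<in> B"
    by (auto simp: B_def)
  show ?case
  proof (cases "l = 0")
    case True
    then have A: "A = {[]}"
      using le less.prems(4) by force
    then have "c [] *\<^sub>t 1 = 0"
      using less.prems(3) by simp
    then have "c [] = 0"
      by (metis lookup_single_eq lookup_zero tscale_one)
    then show ?thesis
      using A less.prems(4) by simp
  next
    case False
    define dec where "dec \<mu> = map (\<lambda>a. a - 1) \<mu>" for \<mu> :: "int list"
    define str where "str \<mu> = filter (\<lambda>a. a \<noteq> 0) (dec \<mu>)" for \<mu>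
    have dec: "sorted_wrt (\<ge>) (dec \<mu>)" "\<forall>a\<in>set (dec \<mu>). 0 \<le> a" if "\<mu> \<in> A" for \<mu>
      using pos[OF that] srt[OF that]
      by (auto simp: dec_def sorted_wrt_map elim!: sorted_wrt_mono_rel[rotated])
    have eperp: "eperp l (schur \<mu>) = (if \<mu> \<in> B then schur (str \<mu>) else 0)" if "\<mu> \<in> A" for \<mu>
    proof (cases "\<mu> \<in> B")
      case True
      then have len: "length \<mu> = l"
        by (simp add: B_def)
      have "{S. S \<subseteq> {..<l} \<and> card S = l} = {{..<l}}"
        by (auto dest: card_subset_eq[rotated])
      moreover have "shift_set (- 1) {..<l} \<mu> = dec \<mu>"
        using len by (intro nth_equalityI) (auto simp: dec_def)
      ultimately show ?thesis
        using True schur_filter[OF dec[OF that]] len by (simp add: eperp_schur_sets str_def)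
    next
      case False
      then show ?thesis
        using le[OF that] that by (auto simp: eperp_schur B_def)
    qed
    \<comment> \<open>All lists in \<open>B\<close> have the same length, so the zeros stripped by
      \<open>str\<close> can be restored.\<close>
    have inj: "inj_on str B"
    proof (rule inj_onI)
      fix \<mu> \<nu> assume "\<mu> \<in> B" "\<nu> \<in> B" "str \<mu> = str \<nu>"
      then have "dec \<mu> = dec \<nu>"
        using schur_eq_strip[OF dec, of \<mu>] schur_eq_strip[OF dec, of \<nu>] BA
        by (auto simp: str_def B_def dec_def)
      then have "map (\<lambda>a. a + 1) (dec \<mu>) = map (\<lambda>a. a + 1) (dec \<nu>)"
        by simp
      then show "\<mu> = \<nu>"
        by (simp add: dec_def o_def)
    qed
    have sl: "sum_list (str \<mu>) = sum_list \<mu> - int l" "0 \<le> sum_list (str \<mu>)" if "\<mu> \<in> B" for \<mu>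
    proof -
      have "sum_list (str \<mu>) = sum_list (dec \<mu>)"
      proof -
        have "sum_list (filter (\<lambda>a. a \<noteq> 0) xs) = sum_list xs" for xs :: "int list"
          by (induction xs) simp_all
        then show ?thesis
          by (simp add: str_def)
      qed
      also have "\<dots> = sum_list \<mu> - int (length \<mu>)"
        unfolding dec_def by (induction \<mu>) simp_all
      finally show "sum_list (str \<mu>) = sum_list \<mu> - int l"
        using that by (simp add: B_def)
      show "0 \<le> sum_list (str \<mu>)"
        using dec[of \<mu>] that BA by (intro sum_list_nonneg) (auto simp: str_def)
    qed
    have 0: "(\<Sum>\<nu>\<in>str ` B. c (the_inv_into B str \<nu>) *\<^sub>t schur \<nu>) = 0"
    proof -
      have "0 = eperp l (\<Sum>\<mu>\<in>A. c \<mu> *\<^sub>t schur \<mu>)"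
        by (simp add: less.prems)
      also have "\<dots> = (\<Sum>\<mu>\<in>A. if \<mu> \<in> B then c \<mu> *\<^sub>t schur (str \<mu>) else 0)"
        unfolding eperp_sum by (intro sum.cong) (auto simp: eperp_tscale eperp)
      also have "\<dots> = (\<Sum>\<mu>\<in>A \<inter> B. c \<mu> *\<^sub>t schur (str \<mu>))"
        using less.prems by (subst sum.inter_restrict) auto
      also have "A \<inter> B = B"
        using BA by auto
      also have "(\<Sum>\<mu>\<in>B. c \<mu> *\<^sub>t schur (str \<mu>)) = (\<Sum>\<nu>\<in>str ` B. c (the_inv_into B str \<nu>) *\<^sub>t schur \<nu>)"
        by (subst sum.reindex[OF inj]) (auto simp: the_inv_into_f_f[OF inj] intro!: sum.cong)
      finally show ?thesis
        by simp
    qed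
    have "(\<Sum>\<nu>\<in>str ` B. Suc (nat (sum_list \<nu>))) = (\<Sum>\<mu>\<in>B. Suc (nat (sum_list (str \<mu>))))"
      by (subst sum.reindex[OF inj]) simp
    also have "\<dots> < (\<Sum>\<mu>\<in>B. Suc (nat (sum_list \<mu>)))"
    proof (rule sum_strict_mono)
      fix \<mu> assume "\<mu> \<in> B"
      then show "Suc (nat (sum_list (str \<mu>))) < Suc (nat (sum_list \<mu>))"
        using sl[of \<mu>] False by linarith
    qed (use \<mu>0 BA in auto)
    also have "\<dots> \<le> (\<Sum>\<mu>\<in>A. Suc (nat (sum_list \<mu>)))"
      using BA less.prems by (intro sum_mono2) auto
    finally have lt: "(\<Sum>\<nu>\<in>str ` B. Suc (nat (sum_list \<nu>))) < (\<Sum>\<mu>\<in>A. Suc (nat (sum_list \<mu>)))" .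
    have part: "str ` B \<subseteq> partitions"
      using filter_partition[OF dec] BA by (auto simp: str_def)
    have zB: "c \<mu> = 0" if "\<mu> \<in> B" for \<mu>
      using less.hyps[OF lt _ part 0, of "str \<mu>"] that BA(2) by (simp add: the_inv_into_f_f[OF inj])
    show ?thesis
    proof (cases "\<rho> \<in> B")
      case False
      have "(\<Sum>\<mu>\<in>A - B. c \<mu> *\<^sub>t schur \<mu>) = 0"
        using less.prems(3) sum.subset_diff[OF BA(1) less.prems(1), of "\<lambda>\<mu>. c \<mu> *\<^sub>t schur \<mu>"] zB
        by simp
      moreover have "(\<Sum>\<mu>\<in>A - B. Suc (nat (sum_list \<mu>))) < (\<Sum>\<mu>\<in>A. Suc (nat (sum_list \<mu>)))"
        using less.prems \<mu>0 BA by (intro sum_strict_mono2[of _ _ \<mu>0]) auto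
      ultimately show ?thesis
        using less.hyps[of "A - B" c \<rho>] less.prems False by auto
    qed (rule zB)
  qed
qed

definition schur_comb :: "(int list \<Rightarrow>\<^sub>0 int poly) \<Rightarrow> sym"
  where "schur_comb p = (\<Sum>\<rho>\<in>Poly_Mapping.keys p. Poly_Mapping.lookup p \<rho> *\<^sub>t schur \<rho>)"

lemma schur_comb_superset:
  assumes "finite A" "Poly_Mapping.keys p \<subseteq> A"
  shows "schur_comb p = (\<Sum>\<rho>\<in>A. Poly_Mapping.lookup p \<rho> *\<^sub>t schur \<rho>)"
  unfolding schur_comb_def
  by (rule sum.mono_neutral_left[OF assms]) (simp add: in_keys_iff)

lemma schur_comb_add: "schur_comb (p + q) = schur_comb p + schur_comb q"
proof -
  let ?A = "Poly_Mapping.keys p \<union> Poly_Mapping.keys q"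
  have "Poly_Mapping.keys (p + q) \<subseteq> ?A"
    by (rule keys_add)
  then show ?thesis
    by (simp add: schur_comb_superset[of ?A] lookup_add Sym.scale_left_distrib sum.distrib)
qed

lemma schur_comb_single: "schur_comb (Poly_Mapping.single \<rho> c) = c *\<^sub>t schur \<rho>"
  by (simp add: schur_comb_def)

lemma schur_comb_inj:
  assumes "Poly_Mapping.keys p \<subseteq> partitions" "Poly_Mapping.keys q \<subseteq> partitions"
    "schur_comb p = schur_comb q"
  shows "p = q"
proof (rule poly_mapping_eqI)
  fix \<rho>
  let ?A = "Poly_Mapping.keys p \<union> Poly_Mapping.keys q"
  have 0: "(\<Sum>\<rho>\<in>?A. (Poly_Mapping.lookup p \<rho> - Poly_Mapping.lookup q \<rho>) *\<^sub>t schur \<rho>) = 0"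
    using assms(3) by (simp add: schur_comb_superset[of ?A] Sym.scale_left_diff_distrib sum_subtractf)
  show "Poly_Mapping.lookup p \<rho> = Poly_Mapping.lookup q \<rho>"
  proof (cases "\<rho> \<in> ?A")
    case True
    then show ?thesis
      using schur_partitions_independent[OF _ _ 0 True] assms by simp
  qed (simp add: in_keys_iff)
qed

lemma ex_schur_comb: "\<exists>p. Poly_Mapping.keys p \<subseteq> partitions \<and> schur_comb p = f"
proof (induction f rule: schur_partition_induct)
  case zero
  show ?case
    by (rule exI[of _ 0]) (simp add: schur_comb_def)
next
  case (add c \<rho> f)
  then obtain p where "Poly_Mapping.keys p \<subseteq> partitions" "schur_comb p = f"
    by auto
  then show ?case
    using add(1) keys_add[of "Poly_Mapping.single \<rho> c" p]
    by (intro exI[of _ "Poly_Mapping.single \<rho> c + p"])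
      (auto simp: schur_comb_add schur_comb_single split: if_splits)
qed

definition schur_coeffs :: "sym \<Rightarrow> (int list \<Rightarrow>\<^sub>0 int poly)"
  where "schur_coeffs f = (THE p. Poly_Mapping.keys p \<subseteq> partitions \<and> schur_comb p = f)"

lemma schur_coeffs:
  "Poly_Mapping.keys (schur_coeffs f) \<subseteq> partitions \<and> schur_comb (schur_coeffs f) = f"
proof -
  have "\<exists>!p. Poly_Mapping.keys p \<subseteq> partitions \<and> schur_comb p = f"
    using ex_schur_comb schur_comb_inj by metis
  then show ?thesis
    unfolding schur_coeffs_def by (rule theI')
qed

lemma schur_coeffs_eqI:
  "Poly_Mapping.keys p \<subseteq> partitions \<Longrightarrow> schur_comb p = f \<Longrightarrow> schur_coeffs f = p"
  using schur_coeffs schur_comb_inj by metis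

lemma schur_coeffs_add: "schur_coeffs (f + g) = schur_coeffs f + schur_coeffs g"
  using schur_coeffs[of f] schur_coeffs[of g] keys_add[of "schur_coeffs f" "schur_coeffs g"]
  by (intro schur_coeffs_eqI) (auto simp: schur_comb_add)

lemma schur_coeffs_schur: "\<rho> \<in> partitions \<Longrightarrow> schur_coeffs (schur \<rho>) = Poly_Mapping.single \<rho> 1"
  by (intro schur_coeffs_eqI) (auto simp: schur_comb_single)

lemma lookup_schur_coeffs_tscale:
  "Poly_Mapping.lookup (schur_coeffs (c *\<^sub>t f)) \<rho> = c * Poly_Mapping.lookup (schur_coeffs f) \<rho>"
proof -
  have "schur_coeffs (c *\<^sub>t f) = Poly_Mapping.map ((*) c) (schur_coeffs f)"
  proof (rule schur_coeffs_eqI)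
    show "Poly_Mapping.keys (Poly_Mapping.map ((*) c) (schur_coeffs f)) \<subseteq> partitions"
      using schur_coeffs[of f] by (auto simp: in_keys_iff map.rep_eq)
    have "schur_comb (Poly_Mapping.map ((*) c) (schur_coeffs f))
      = (\<Sum>\<rho>\<in>Poly_Mapping.keys (schur_coeffs f).
          Poly_Mapping.lookup (Poly_Mapping.map ((*) c) (schur_coeffs f)) \<rho> *\<^sub>t schur \<rho>)"
      by (rule schur_comb_superset) (auto simp: in_keys_iff map.rep_eq)
    also have "\<dots> = c *\<^sub>t schur_comb (schur_coeffs f)"
      by (auto simp: schur_comb_def map.rep_eq Sym.scale_sum_right in_keys_iff intro!: sum.cong)
    finally show "schur_comb (Poly_Mapping.map ((*) c) (schur_coeffs f)) = c *\<^sub>t f"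
      using schur_coeffs by simp
  qed
  then show ?thesis
    by (simp add: map.rep_eq when_def)
qed

section \<open>The Hall form and adjoint operators\<close>

definition schur_form :: "sym \<Rightarrow> sym \<Rightarrow> int poly"
  where "schur_form f g = (\<Sum>\<rho>\<in>Poly_Mapping.keys (schur_coeffs f).
    Poly_Mapping.lookup (schur_coeffs f) \<rho> * Poly_Mapping.lookup (schur_coeffs g) \<rho>)"

lemma schur_form_superset:
  assumes "finite A" "Poly_Mapping.keys (schur_coeffs f) \<subseteq> A"
  shows "schur_form f g = (\<Sum>\<rho>\<in>A.
    Poly_Mapping.lookup (schur_coeffs f) \<rho> * Poly_Mapping.lookup (schur_coeffs g) \<rho>)"
  unfolding schur_form_def
  by (rule sum.mono_neutral_left[OF assms]) (simp add: in_keys_iff)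

lemma module_hom_iff_tscale:
  "module_hom tscale (*) F \<longleftrightarrow> (\<forall>f g. F (f + g) = F f + F g) \<and> (\<forall>c f. F (c *\<^sub>t f) = c * F f)"
proof -
  have "Modules.module ((*) :: int poly \<Rightarrow> _)"
    by unfold_locales (simp_all add: algebra_simps)
  then show ?thesis
    by (auto simp: module_hom_iff Sym.module_axioms)
qed

text \<open>Existence for the definite description behind \<open>hall\<close>.\<close>

lemma is_hall_form_schur_form: "is_hall_form schur_form"
  unfolding is_hall_form_def module_hom_iff_tscale
proof (intro conjI allI ballI)
  fix f g h :: sym and c :: "int poly"
  show "schur_form f (g + h) = schur_form f g + schur_form f h"
    by (simp add: schur_form_def schur_coeffs_add lookup_add distrib_left sum.distrib)
  show "schur_form f (c *\<^sub>t g) = c * schur_form f g"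
    by (simp add: schur_form_def lookup_schur_coeffs_tscale sum_distrib_left mult_ac)
  let ?A = "Poly_Mapping.keys (schur_coeffs f) \<union> Poly_Mapping.keys (schur_coeffs g)"
  have "Poly_Mapping.keys (schur_coeffs (f + g)) \<subseteq> ?A"
    unfolding schur_coeffs_add by (rule keys_add)
  then show "schur_form (f + g) h = schur_form f h + schur_form g h"
    by (simp add: schur_form_superset[of ?A] schur_coeffs_add lookup_add distrib_right sum.distrib)
  have "Poly_Mapping.keys (schur_coeffs (c *\<^sub>t f)) \<subseteq> Poly_Mapping.keys (schur_coeffs f)"
    by (auto simp: in_keys_iff lookup_schur_coeffs_tscale)
  then show "schur_form (c *\<^sub>t f) h = c * schur_form f h"
    by (simp add: schur_form_superset[of "Poly_Mapping.keys (schur_coeffs f)"]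
      lookup_schur_coeffs_tscale sum_distrib_left mult_ac)
next
  fix \<mu> \<nu> assume "\<mu> \<in> partitions" "\<nu> \<in> partitions"
  then show "schur_form (schur \<mu>) (schur \<nu>) = (if \<mu> = \<nu> then 1 else 0)"
    by (simp add: schur_form_def schur_coeffs_schur lookup_single when_def)
qed

lemma is_hall_form_unique:
  assumes "is_hall_form B" "is_hall_form C"
  shows "B = C"
proof (intro ext)
  fix f g
  have B: "B f 0 = 0" "B 0 f = 0" if "is_hall_form B" for B f
  proof -
    have "B f (0 + 0) = B f 0 + B f 0" "B (0 + 0) f = B 0 f + B 0 f"
      using that unfolding is_hall_form_def module_hom_iff_tscale by blast+
    then show "B f 0 = 0" "B 0 f = 0"
      by simp_all
  qed
  show "B f g = C f g"
  proof (induction f rule: schur_partition_induct)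
    case (add c \<rho> f)
    have "B (schur \<rho>) g = C (schur \<rho>) g"
    proof (induction g rule: schur_partition_induct)
      case zero
      show ?case
        using B(1)[OF assms(1)] B(1)[OF assms(2)] by simp
    next
      case (add c \<mu> g)
      then show ?case
        using assms \<open>\<rho> \<in> partitions\<close> by (simp add: is_hall_form_def module_hom_iff_tscale)
    qed
    then show ?case
      using assms add by (simp add: is_hall_form_def module_hom_iff_tscale)
  qed (use B(2)[OF assms(1)] B(2)[OF assms(2)] in simp)
qed

lemma is_hall_form_hall: "is_hall_form hall"
  unfolding hall_def
  by (rule theI[of _ schur_form]) (auto intro: is_hall_form_schur_form is_hall_form_unique)

lemma hall_add_left: "hall (f + g) h = hall f h + hall g h"
  and hall_add_right: "hall f (g + h) = hall f g + hall f h"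
  and hall_tscale_left: "hall (c *\<^sub>t f) h = c * hall f h"
  and hall_tscale_right: "hall f (c *\<^sub>t h) = c * hall f h"
  and hall_schur: "\<mu> \<in> partitions \<Longrightarrow> \<nu> \<in> partitions \<Longrightarrow> hall (schur \<mu>) (schur \<nu>) = (if \<mu> = \<nu> then 1 else 0)"
  using is_hall_form_hall by (simp_all add: is_hall_form_def module_hom_iff_tscale)

lemma hall_zero_left [simp]: "hall 0 f = 0"
  using hall_tscale_left[of 0 0 f] by simp

lemma hall_zero_right [simp]: "hall f 0 = 0"
  using hall_tscale_right[of f 0 0] by simp

lemma hall_uminus_left: "hall (- f) g = - hall f g"
  using hall_add_left[of "- f" f g] by (simp add: eq_neg_iff_add_eq_0)

lemma hall_sum_left: "hall (\<Sum>i\<in>A. F i) g = (\<Sum>i\<in>A. hall (F i) g)"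
  by (induction A rule: infinite_finite_induct) (simp_all add: hall_add_left)

lemma hall_sum_right: "hall g (\<Sum>i\<in>A. F i) = (\<Sum>i\<in>A. hall g (F i))"
  by (induction A rule: infinite_finite_induct) (simp_all add: hall_add_right)

text \<open>The pairing with \<open>schur \<rho>\<close> reads off the coefficient of
  \<open>schur \<rho>\<close>. This provides the uniqueness required by the description in
  \<open>perp\<close>.\<close>

lemma hall_nondegenerate:
  assumes "\<And>\<rho>. \<rho> \<in> partitions \<Longrightarrow> hall u (schur \<rho>) = hall v (schur \<rho>)"
  shows "u = v"
proof -
  have "Poly_Mapping.lookup (schur_coeffs u) \<rho> = hall u (schur \<rho>)" if "\<rho> \<in> partitions" for u \<rho>
  proof -
    have "hall u (schur \<rho>) = schur_form u (schur \<rho>)"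
      using is_hall_form_unique[OF is_hall_form_hall is_hall_form_schur_form] by simp
    also have "\<dots> = Poly_Mapping.lookup (schur_coeffs u) \<rho>"
      using that by (simp add: schur_form_def schur_coeffs_schur lookup_single when_def in_keys_iff
        if_distrib[of "(*) _"] cong: if_cong)
    finally show ?thesis
      by simp
  qed
  moreover have "Poly_Mapping.lookup (schur_coeffs u) \<rho> = 0" if "\<rho> \<notin> partitions" for u \<rho>
    using schur_coeffs[of u] that by (auto simp: in_keys_iff)
  ultimately have "schur_coeffs u = schur_coeffs v"
    using assms by (intro poly_mapping_eqI) metis
  then show ?thesis
    using schur_coeffs by metis
qed

section \<open>The vertical strip Pieri rule and its adjoint\<close>

lemma sum_subsets_Suc:
  fixes g :: "nat set \<Rightarrow> 'a::comm_monoid_add"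
  shows "(\<Sum>S | S \<subseteq> {..<Suc l} \<and> card S = j. g S)
    = (\<Sum>S | S \<subseteq> {..<l} \<and> card S = j. g (Suc ` S))
      + (if j = 0 then 0 else \<Sum>S | S \<subseteq> {..<l} \<and> card S = j - 1. g (insert 0 (Suc ` S)))"
proof -
  have fin: "finite {S. S \<subseteq> {..<n} \<and> card S = j}" for n j :: nat
    by (rule finite_subset[of _ "Pow {..<n}"]) auto
  have inj: "inj_on ((`) Suc) X" for X
    by (rule inj_onI) (simp add: inj_image_eq_iff)
  have inj': "inj_on (\<lambda>S. insert 0 (Suc ` S)) X" for X
  proof (rule inj_onI)
    fix S T :: "nat set" assume "insert 0 (Suc ` S) = insert 0 (Suc ` T)"
    then have "Suc ` S = Suc ` T"
      by (metis Diff_insert_absorb Zero_not_Suc imageE)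
    then show "S = T"
      by (simp add: inj_image_eq_iff)
  qed
  have card0: "card (insert 0 (Suc ` S)) = Suc (card S)" if "finite S" for S
    using that by (subst card_insert_disjoint) (auto simp: card_image)
  have split: "\<exists>T. S = (if 0 \<in> S then insert 0 (Suc ` T) else Suc ` T) \<and> T \<subseteq> {..<l}"
    if "S \<subseteq> {..<Suc l}" for S
  proof (intro exI conjI)
    show "S = (if 0 \<in> S then insert 0 (Suc ` {n. Suc n \<in> S}) else Suc ` {n. Suc n \<in> S})"
      by (auto simp: image_iff) (metis not0_implies_Suc)+
  qed (use that in auto)
  have A: "{S. S \<subseteq> {..<Suc l} \<and> card S = j \<and> 0 \<notin> S} = (`) Suc ` {S. S \<subseteq> {..<l} \<and> card S = j}"
  proof (rule equalityI; rule subsetI)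
    fix S assume S: "S \<in> {S. S \<subseteq> {..<Suc l} \<and> card S = j \<and> 0 \<notin> S}"
    with split obtain T where "S = Suc ` T" "T \<subseteq> {..<l}"
      by (metis (lifting) mem_Collect_eq)
    with S show "S \<in> (`) Suc ` {S. S \<subseteq> {..<l} \<and> card S = j}"
      by (auto simp: card_image)
  qed (auto simp: card_image)
  have B: "{S. S \<subseteq> {..<Suc l} \<and> card S = j \<and> 0 \<in> S}
    = (if j = 0 then {} else (\<lambda>S. insert 0 (Suc ` S)) ` {S. S \<subseteq> {..<l} \<and> card S = j - 1})"
  proof (rule equalityI; rule subsetI)
    fix S assume S: "S \<in> {S. S \<subseteq> {..<Suc l} \<and> card S = j \<and> 0 \<in> S}"
    with split obtain T where T: "S = insert 0 (Suc ` T)" "T \<subseteq> {..<l}"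
      by (metis (lifting) mem_Collect_eq)
    then have "j = Suc (card T)"
      using S card0[of T] by (auto intro: finite_subset)
    with T show "S \<in> (if j = 0 then {} else (\<lambda>S. insert 0 (Suc ` S)) ` {S. S \<subseteq> {..<l} \<and> card S = j - 1})"
      by auto
  next
    fix S assume "S \<in> (if j = 0 then {} else (\<lambda>S. insert 0 (Suc ` S)) ` {S. S \<subseteq> {..<l} \<and> card S = j - 1})"
    then obtain T where T: "j \<noteq> 0" "S = insert 0 (Suc ` T)" "T \<subseteq> {..<l}" "card T = j - 1"
      by (auto split: if_splits)
    then show "S \<in> {S. S \<subseteq> {..<Suc l} \<and> card S = j \<and> 0 \<in> S}"
      using card0[of T] finite_subset[of T] by auto
  qed
  have "{S. S \<subseteq> {..<Suc l} \<and> card S = j}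
    = {S. S \<subseteq> {..<Suc l} \<and> card S = j \<and> 0 \<notin> S} \<union> {S. S \<subseteq> {..<Suc l} \<and> card S = j \<and> 0 \<in> S}"
    by auto
  then have "(\<Sum>S | S \<subseteq> {..<Suc l} \<and> card S = j. g S)
    = (\<Sum>S | S \<subseteq> {..<Suc l} \<and> card S = j \<and> 0 \<notin> S. g S) + (\<Sum>S | S \<subseteq> {..<Suc l} \<and> card S = j \<and> 0 \<in> S. g S)"
    by (simp only:) (rule sum.union_disjoint, auto intro: finite_subset[OF _ fin[of "Suc l" j]])
  also have "(\<Sum>S | S \<subseteq> {..<Suc l} \<and> card S = j \<and> 0 \<notin> S. g S) = (\<Sum>S | S \<subseteq> {..<l} \<and> card S = j. g (Suc ` S))"
    unfolding A by (subst sum.reindex[OF inj]) simp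
  also have "(\<Sum>S | S \<subseteq> {..<Suc l} \<and> card S = j \<and> 0 \<in> S. g S)
    = (if j = 0 then 0 else \<Sum>S | S \<subseteq> {..<l} \<and> card S = j - 1. g (insert 0 (Suc ` S)))"
    unfolding B by (simp add: sum.reindex[OF inj'])
  finally show ?thesis .
qed

text \<open>A set of positions that is not an initial segment has a gap right before one of its
  elements; there the list rises from 0 to 1, and the dot action fixes it.\<close>

lemma schur_indicator:
  assumes "S \<subseteq> {..<n}"
  shows "schur (map (\<lambda>p. of_bool (p \<in> S)) [0..<n]) = (if S = {..<card S} then esym (card S) else 0)"
proof (cases "S = {..<card S}")
  case True
  then have le: "card S \<le> n"
    using assms by (metis card_lessThan card_mono finite_lessThan)
  have "map (\<lambda>p. of_bool (p \<in> S)) [0..<n] = replicate (card S) (1::int) @ replicate (n - card S) 0"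
    by (rule nth_equalityI) (use le True in \<open>auto simp: nth_append of_bool_def\<close>)
  then show ?thesis
    using True by (simp add: schur_append_zeros esym_def)
next
  case False
  have "\<exists>i. i \<notin> S \<and> Suc i \<in> S"
  proof (rule ccontr)
    assume "\<nexists>i. i \<notin> S \<and> Suc i \<in> S"
    then have step: "Suc i \<in> S \<Longrightarrow> i \<in> S" for i
      by auto
    have down: "j \<in> S" if "i \<in> S" "j \<le> i" for i j
      using that(2,1) by (induction rule: inc_induct) (auto dest: step)
    have fin: "finite S"
      using assms finite_subset by blast
    have "S = {..<card S}"
    proof (cases "S = {}")
      case False
      have "S \<subseteq> {..Max S}" "{..Max S} \<subseteq> S"
        using fin down[OF Max_in[OF fin False]] by auto
      then have "S = {..Max S}"
        by (rule equalityI)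
      then obtain m where "S = {..m}"
        by blast
      then show ?thesis
        by (simp add: lessThan_Suc_atMost)
    qed simp
    with False show False ..
  qed
  then obtain i where "i \<notin> S" "Suc i \<in> S"
    by auto
  moreover from this assms have "Suc i < n"
    by auto
  ultimately have "schur (map (\<lambda>p. of_bool (p \<in> S)) [0..<n]) = 0"
    by (intro schur_zero_adjacent[of i]) auto
  then show ?thesis
    using False by simp
qed

lemma finite_subsets_card [simp]: "finite {S. S \<subseteq> {..<n::nat} \<and> card S = j}"
  by (rule finite_subset[of _ "Pow {..<n}"]) auto

lemma esym_0 [simp]: "esym 0 = 1"
  by (simp add: esym_def)

text \<open>Of the strips of \<open>j\<close> boxes, only the one at the bottom of the column leaves
  an initial segment of ones; the remaining terms vanish by \<open>schur_indicator\<close>.\<close>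

lemma eperp_esym: "eperp j (esym n) = (if j \<le> n then esym (n - j) else 0)"
proof (cases "j \<le> n")
  case True
  have 0: "schur (shift_set (- 1) S (replicate n 1)) = (if S = {n - j..<n} then esym (n - j) else 0)"
    if S: "S \<subseteq> {..<n}" "card S = j" for S
  proof -
    have "shift_set (- 1) S (replicate n 1) = map (\<lambda>p. of_bool (p \<in> {..<n} - S)) [0..<n]"
      by (rule nth_equalityI) auto
    moreover have "card ({..<n} - S) = n - j"
      using S by (simp add: card_Diff_subset finite_subset)
    moreover have "{..<n} - S = {..<n - j} \<longleftrightarrow> S = {n - j..<n}"
    proof -
      have "S = {..<n} - ({..<n} - S)" "{..<n} - {..<n - j} = {n - j..<n}"
        "{..<n} - {n - j..<n} = {..<n - j}"
        using S by auto
      then show ?thesis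
        by metis
    qed
    ultimately show ?thesis
      using schur_indicator[of "{..<n} - S" n] by (simp only: Diff_subset if_True simp_thms)
  qed
  have "eperp j (esym n) = (\<Sum>S | S \<subseteq> {..<n} \<and> card S = j. if S = {n - j..<n} then esym (n - j) else 0)"
    by (simp add: esym_def eperp_schur_sets 0[unfolded esym_def])
  also have "\<dots> = esym (n - j)"
    using True by (subst sum.delta) auto
  finally show ?thesis
    using True by simp
next
  case False
  then show ?thesis
    by (simp add: esym_def eperp_schur)
qed

lemma eperp_esym_mult:
  "eperp i (esym (Suc n) * f) = esym (Suc n) * eperp i f + (if i = 0 then 0 else eperp (i - 1) (esym n * f))"
proof (cases i)
  case (Suc j)
  show ?thesis
    unfolding Suc eperp_mult by (subst sum.atMost_Suc_shift) (simp add: eperp_esym cong: if_cong)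
qed simp

text \<open>The Pieri rule for a single row: it gains no box, or it gains one and leaves
  \<open>e\<^sub>n\<close> for the rows below. The source is the recursion
  \<open>eperp_esym_mult\<close>, which exists because skewing shortens a column by as many boxes as
  are removed.\<close>

lemma esym_mult_bernstein:
  "esym (Suc n) * bernstein m f = bernstein m (esym (Suc n) * f) + bernstein (m + 1) (esym n * f)"
proof -
  obtain N1 N2 where N12: "\<forall>i>N1. eperp i f = 0" "\<forall>i>N2. eperp i (esym n * f) = 0"
    using eperp_eventually_zero by metis
  define N where "N = max N1 N2"
  have N: "\<forall>i>N. eperp i f = 0" "\<forall>i>N. eperp i (esym n * f) = 0"
    using N12 by (auto simp: N_def)
  have "bernstein m (esym (Suc n) * f) = (\<Sum>i\<le>Suc N. (- 1) ^ i * hsym (m + int i) * eperp i (esym (Suc n) * f))"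
    using N by (intro bernstein_eq_sum) (auto simp: eperp_esym_mult)
  also have "\<dots> = (\<Sum>i\<le>Suc N. esym (Suc n) * ((- 1) ^ i * hsym (m + int i) * eperp i f))
      + (\<Sum>i\<le>Suc N. if i = 0 then 0 else (- 1) ^ i * hsym (m + int i) * eperp (i - 1) (esym n * f))"
    unfolding sum.distrib[symmetric]
    by (intro sum.cong) (simp_all add: eperp_esym_mult, simp_all add: algebra_simps)
  also have "(\<Sum>i\<le>Suc N. esym (Suc n) * ((- 1) ^ i * hsym (m + int i) * eperp i f)) = esym (Suc n) * bernstein m f"
    using N by (subst bernstein_eq_sum[of "Suc N"]) (auto simp: sum_distrib_left)
  also have "(\<Sum>i\<le>Suc N. if i = 0 then 0 else (- 1) ^ i * hsym (m + int i) * eperp (i - 1) (esym n * f))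
      = (\<Sum>i\<le>N. (- 1) ^ Suc i * hsym (m + int (Suc i)) * eperp i (esym n * f))"
    by (subst sum.atMost_Suc_shift) simp
  also have "\<dots> = - bernstein (m + 1) (esym n * f)"
    using N by (subst bernstein_eq_sum[of N]) (auto simp: algebra_simps sum_negf)
  finally show ?thesis
    by simp
qed

lemma bernstein_sum: "bernstein m (\<Sum>i\<in>A. f i) = (\<Sum>i\<in>A. bernstein m (f i))"
  by (induction A rule: infinite_finite_induct) (simp_all add: bernstein_add)

lemma shift_set_Cons:
  "shift_set c (Suc ` S) (m # \<gamma>) = m # shift_set c S \<gamma>"
  "shift_set c (insert 0 (Suc ` S)) (m # \<gamma>) = (m + c) # shift_set c S \<gamma>"
  by (rule nth_equalityI; auto simp: nth_Cons split: nat.split)+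

text \<open>The \<open>d\<close> zeros provide the rows that a strip of \<open>j \<le> d\<close>
  boxes may open below \<open>\<gamma>\<close>; in the base case only the strip at the top of these
  rows survives.\<close>

lemma esym_mult_schur:
  assumes "j \<le> d"
  shows "esym j * schur (\<gamma> @ replicate d 0)
    = (\<Sum>S | S \<subseteq> {..<length \<gamma> + d} \<and> card S = j. schur (shift_set 1 S (\<gamma> @ replicate d 0)))"
  using assms
proof (induction \<gamma> arbitrary: j)
  case Nil
  have "schur (shift_set 1 S (replicate d 0)) = (if S = {..<j} then esym j else 0)"
    if "S \<subseteq> {..<d}" "card S = j" for S
  proof -
    have "shift_set 1 S (replicate d 0) = map (\<lambda>p. of_bool (p \<in> S)) [0..<d]"
      by (rule nth_equalityI) auto
    then show ?thesis
      using that by (simp add: schur_indicator)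
  qed
  then have "(\<Sum>S | S \<subseteq> {..<d} \<and> card S = j. schur (shift_set 1 S (replicate d 0)))
    = (\<Sum>S | S \<subseteq> {..<d} \<and> card S = j. if S = {..<j} then esym j else 0)"
    by (intro sum.cong) auto
  also have "\<dots> = esym j"
    using Nil by (subst sum.delta) auto
  finally show ?case
    by simp
next
  case (Cons m \<gamma>)
  let ?\<kappa> = "\<gamma> @ replicate d 0"
  let ?g = "\<lambda>S. schur (shift_set 1 S (m # ?\<kappa>))"
  have "(\<Sum>S | S \<subseteq> {..<Suc (length \<gamma> + d)} \<and> card S = j. ?g S)
    = bernstein m (esym j * schur ?\<kappa>) + (if j = 0 then 0 else bernstein (m + 1) (esym (j - 1) * schur ?\<kappa>))"
    using Cons by (subst sum_subsets_Suc) (simp add: shift_set_Cons schur_Cons bernstein_sum)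
  also have "\<dots> = esym j * bernstein m (schur ?\<kappa>)"
    by (cases j) (simp_all add: esym_mult_bernstein)
  finally show ?case
    by (simp add: schur_Cons)
qed

lemma sorted_wrt_ge_replicate: "sorted_wrt (\<ge>) (replicate n (x::int))"
  by (induction n) auto

lemma hall_schur_list:
  assumes srt: "\<And>i. Suc i < length \<gamma> \<Longrightarrow> \<gamma> ! Suc i \<le> \<gamma> ! i + 1"
    and last: "\<And>i. i < length \<gamma> \<Longrightarrow> - 1 \<le> \<gamma> ! i"
    and \<rho>: "\<rho> \<in> partitions" "length \<rho> \<le> length \<gamma>"
  shows "hall (schur \<gamma>) (schur \<rho>) = (if \<gamma> = \<rho> @ replicate (length \<gamma> - length \<rho>) 0 then 1 else 0)"
proof -
  let ?\<rho> = "\<rho> @ replicate (length \<gamma> - length \<rho>) 0"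
  have \<rho>': "sorted_wrt (\<ge>) ?\<rho>" "\<forall>a\<in>set ?\<rho>. 0 \<le> a" "filter (\<lambda>a. a \<noteq> 0) ?\<rho> = \<rho>"
    using \<rho> by (auto simp: partitions_def sorted_wrt_append sorted_wrt_ge_replicate less_imp_le
      filter_id_conv)
  show ?thesis
  proof (cases "sorted_wrt (\<ge>) \<gamma>")
    case True
    show ?thesis
    proof (cases "\<forall>a\<in>set \<gamma>. 0 \<le> a")
      case nonneg: True
      let ?\<gamma> = "filter (\<lambda>a. a \<noteq> 0) \<gamma>"
      have "hall (schur \<gamma>) (schur \<rho>) = (if ?\<gamma> = \<rho> then 1 else 0)"
        using schur_filter[OF True nonneg] hall_schur[OF filter_partition[OF True nonneg] \<rho>(1)] by simp
      moreover have "?\<gamma> = \<rho> \<longleftrightarrow> \<gamma> = ?\<rho>"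
        using schur_eq_strip[OF True nonneg] \<rho>'(3) by metis
      ultimately show ?thesis
        by simp
    next
      case False
      then show ?thesis
      proof -
        have "\<gamma> \<noteq> ?\<rho>"
          using False \<rho>'(2) by metis
        then show ?thesis
          using schur_decreasing_negative[OF True False] by simp
      qed
    qed
  next
    case False
    then obtain i where i: "Suc i < length \<gamma>" "\<gamma> ! i < \<gamma> ! Suc i"
      by (rule not_decreasingE)
    then have "schur \<gamma> = 0"
      using srt[OF i(1)] by (intro schur_zero_adjacent[of i]) auto
    moreover have "\<gamma> \<noteq> ?\<rho>"
      using False \<rho>'(1) by metis
    ultimately show ?thesis
      by simp
  qed
qed

lemma hall_commute: "hall f g = hall g f"
proof (induction f rule: schur_partition_induct)
  case (add c \<rho> f)
  have "hall (schur \<rho>) g = hall g (schur \<rho>)"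
    by (induction g rule: schur_partition_induct)
      (use add in \<open>simp_all add: hall_add_left hall_add_right hall_tscale_left hall_tscale_right hall_schur\<close>)
  then show ?case
    using add by (simp add: hall_add_left hall_add_right hall_tscale_left hall_tscale_right)
qed simp

text \<open>
  After padding with zeros, subtracting or adding a vertical strip produces either a partition or a
  list with an ascent by one, whose Schur function vanishes; so both sides count the same strips.
\<close>

lemma hall_eperp: "hall (eperp d f) g = hall f (esym d * g)"
proof -
  have "hall (eperp d (schur \<rho>)) (schur \<sigma>) = hall (schur \<rho>) (esym d * schur \<sigma>)"
    if \<rho>: "\<rho> \<in> partitions" and \<sigma>: "\<sigma> \<in> partitions" for \<rho> \<sigma>
  proof -
    define n where "n = length \<rho> + length \<sigma> + d"
    let ?\<rho> = "\<rho> @ replicate (n - length \<rho>) 0"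
    let ?\<sigma> = "\<sigma> @ replicate (n - length \<sigma>) 0"
    have len: "length ?\<rho> = n" "length ?\<sigma> = n"
      by (simp_all add: n_def)
    have srt: "sorted_wrt (\<ge>) (\<rho> @ replicate m 0)" and pos: "\<forall>a\<in>set (\<rho> @ replicate m 0). 0 \<le> a"
      if "\<rho> \<in> partitions" for \<rho> m
      using that by (auto simp: partitions_def sorted_wrt_append sorted_wrt_ge_replicate less_imp_le)
    have dec: "(\<rho> @ replicate m 0) ! Suc i \<le> (\<rho> @ replicate m 0) ! i"
      if "\<rho> \<in> partitions" "Suc i < length (\<rho> @ replicate m 0)" for \<rho> m i
      using sorted_wrt_nth_less[OF srt[OF that(1)], of i "Suc i" m] that(2) by simp
    have nn: "0 \<le> (\<rho> @ replicate m 0) ! i" if "\<rho> \<in> partitions" "i < length (\<rho> @ replicate m 0)" for \<rho> m i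
      using pos[OF that(1)] that(2) nth_mem by blast
    have "hall (eperp d (schur \<rho>)) (schur \<sigma>) = hall (eperp d (schur ?\<rho>)) (schur \<sigma>)"
      by (simp add: schur_append_zeros)
    also have "\<dots> = (\<Sum>S | S \<subseteq> {..<n} \<and> card S = d. hall (schur (shift_set (- 1) S ?\<rho>)) (schur \<sigma>))"
      unfolding eperp_schur_sets len by (rule hall_sum_left)
    also have "\<dots> = (\<Sum>S | S \<subseteq> {..<n} \<and> card S = d. if shift_set (- 1) S ?\<rho> = ?\<sigma> then 1 else 0)"
    proof (rule sum.cong[OF refl])
      fix S
      have "hall (schur (shift_set (- 1) S ?\<rho>)) (schur \<sigma>) = (if shift_set (- 1) S ?\<rho>
        = \<sigma> @ replicate (length (shift_set (- 1) S ?\<rho>) - length \<sigma>) 0 then 1 else 0)"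
      proof (rule hall_schur_list)
        fix i assume i: "Suc i < length (shift_set (- 1) S ?\<rho>)"
        then show "shift_set (- 1) S ?\<rho> ! Suc i \<le> shift_set (- 1) S ?\<rho> ! i + 1"
          using dec[OF \<rho>, where m = "n - length \<rho>" and i = i] by simp
      next
        fix i assume i: "i < length (shift_set (- 1) S ?\<rho>)"
        then show "- 1 \<le> shift_set (- 1) S ?\<rho> ! i"
          using nn[OF \<rho>, where m = "n - length \<rho>" and i = i] by simp
      qed (use \<sigma> in \<open>auto simp: n_def\<close>)
      then show "hall (schur (shift_set (- 1) S ?\<rho>)) (schur \<sigma>) = (if shift_set (- 1) S ?\<rho> = ?\<sigma> then 1 else 0)"
        by (simp only: length_shift_set len)
    qed
    also have "\<dots> = (\<Sum>S | S \<subseteq> {..<n} \<and> card S = d. if shift_set 1 S ?\<sigma> = ?\<rho> then 1 else 0)"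
    proof (intro sum.cong refl if_cong)
      fix S
      have "shift_set c S (shift_set (- c) S \<gamma>) = \<gamma>" for c \<gamma>
        by (rule nth_equalityI) auto
      from this[of 1] this[of "- 1"]
      show "shift_set (- 1) S ?\<rho> = ?\<sigma> \<longleftrightarrow> shift_set 1 S ?\<sigma> = ?\<rho>"
        by (metis minus_minus)
    qed
    also have "\<dots> = (\<Sum>S | S \<subseteq> {..<n} \<and> card S = d. hall (schur \<rho>) (schur (shift_set 1 S ?\<sigma>)))"
    proof (rule sum.cong[OF refl])
      fix S
      have "hall (schur (shift_set 1 S ?\<sigma>)) (schur \<rho>) = (if shift_set 1 S ?\<sigma>
        = \<rho> @ replicate (length (shift_set 1 S ?\<sigma>) - length \<rho>) 0 then 1 else 0)"
      proof (rule hall_schur_list)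
        fix i assume i: "Suc i < length (shift_set 1 S ?\<sigma>)"
        then show "shift_set 1 S ?\<sigma> ! Suc i \<le> shift_set 1 S ?\<sigma> ! i + 1"
          using dec[OF \<sigma>, where m = "n - length \<sigma>" and i = i] by simp
      next
        fix i assume i: "i < length (shift_set 1 S ?\<sigma>)"
        then show "- 1 \<le> shift_set 1 S ?\<sigma> ! i"
          using nn[OF \<sigma>, where m = "n - length \<sigma>" and i = i] by simp
      qed (use \<rho> in \<open>auto simp: n_def\<close>)
      then show "(if shift_set 1 S ?\<sigma> = ?\<rho> then 1 else 0) = hall (schur \<rho>) (schur (shift_set 1 S ?\<sigma>))"
        by (simp only: length_shift_set len hall_commute[of "schur \<rho>"])
    qed
    also have "\<dots> = hall (schur \<rho>) (\<Sum>S | S \<subseteq> {..<n} \<and> card S = d. schur (shift_set 1 S ?\<sigma>))"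
      by (rule hall_sum_right[symmetric])
    also have "(\<Sum>S | S \<subseteq> {..<n} \<and> card S = d. schur (shift_set 1 S ?\<sigma>)) = esym d * schur ?\<sigma>"
      using esym_mult_schur[of d "n - length \<sigma>" \<sigma>] by (simp add: n_def add_ac)
    finally show ?thesis
      by (simp add: schur_append_zeros)
  qed
  note base = this
  have "hall (eperp d (schur \<rho>)) g = hall (schur \<rho>) (esym d * g)" if \<rho>: "\<rho> \<in> partitions" for \<rho>
  proof (induction g rule: schur_partition_induct)
    case (add c \<sigma> g)
    have "esym d * (c *\<^sub>t schur \<sigma> + g) = c *\<^sub>t (esym d * schur \<sigma>) + esym d * g"
      by (simp add: tscale_def algebra_simps)
    then show ?case
      using add base[OF \<rho>] by (simp add: hall_add_right hall_tscale_right)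
  qed simp
  note base2 = this
  show ?thesis
  proof (induction f rule: schur_partition_induct)
    case (add c \<sigma> f)
    then show ?case
      using base2 by (simp add: eperp_add eperp_tscale hall_add_left hall_tscale_left)
  qed simp
qed

section \<open>The adjoints as explicit operators\<close>

lemma perp_eqI:
  assumes "\<And>v. hall u v = hall g (f * v)"
  shows "perp f g = u"
  unfolding perp_def
proof (rule the_equality)
  fix w assume w: "\<forall>v. hall w v = hall g (f * v)"
  show "w = u"
    by (rule hall_nondegenerate) (use w assms in simp)
qed (use assms in simp)

lemma perp_esym: "perp (esym d) f = eperp d f"
  by (rule perp_eqI) (rule hall_eperp)

text \<open>
  The recursion solves \<open>\<Sum>\<^sub>d (-1)\<^sup>d h\<^sub>n\<^sub>-\<^sub>d\<^sup>\<bottom> e\<^sub>d\<^sup>\<bottom> = 0\<close>, the adjoint of the relation between \<open>h\<^sub>n\<close> and \<open>e\<^sub>n\<close>.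
\<close>

function hperp :: "nat \<Rightarrow> sym \<Rightarrow> sym" where
  "hperp 0 f = f"
| "hperp (Suc n) f = (\<Sum>d\<le>n. (- 1) ^ d * hperp (n - d) (eperp (Suc d) f))"
  by pat_completeness auto
termination by (relation "measure fst") auto

lemma hsym_esym_recursion:
  "hsym (int (Suc n)) = (\<Sum>d\<le>n. (- 1) ^ d * (esym (Suc d) * hsym (int (n - d))))"
proof -
  \<comment> \<open>The first-row expansion of the determinant of a column of ones. After reindexing
    it is the relation \<open>\<Sum>\<^sub>d (-1)\<^sup>d e\<^sub>d
    h\<^sub>n\<^sub>+\<^sub>1\<^sub>-\<^sub>d = 0\<close>.\<close>
  have "esym (Suc n) = (\<Sum>c\<le>n. (- 1) ^ c * hsym (1 + int c) * esym (n - c))" for n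
  proof -
    have "esym (Suc n) = bernstein 1 (esym n)"
      by (simp add: esym_def schur_Cons)
    then show ?thesis
      by (simp add: bernstein_eq_sum[of n] eperp_esym)
  qed
  note e = this
  have "(\<Sum>d\<le>Suc n. (- 1) ^ d * (esym d * hsym (int (Suc n - d)))) = 0" for n
  proof -
    have "(\<Sum>d\<le>Suc n. (- 1) ^ d * (esym d * hsym (int (Suc n - d))))
      = (\<Sum>d\<le>Suc n. (- 1) ^ (Suc n - d) * (esym (Suc n - d) * hsym (int d)))"
      by (rule sum.reindex_bij_witness[of _ "\<lambda>d. Suc n - d" "\<lambda>d. Suc n - d"]) auto
    also have "\<dots> = (- 1) ^ Suc n * esym (Suc n)
        + (\<Sum>d\<le>n. (- 1) ^ (n - d) * (esym (n - d) * hsym (int (Suc d))))"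
      by (subst sum.atMost_Suc_shift) simp
    also have "(\<Sum>d\<le>n. (- 1) ^ (n - d) * (esym (n - d) * hsym (int (Suc d))))
        = (- 1) ^ n * (\<Sum>d\<le>n. (- 1) ^ d * hsym (1 + int d) * esym (n - d))"
      unfolding sum_distrib_left
    proof (rule sum.cong[OF refl])
      fix d assume "d \<in> {..n}"
      then have "(- 1) ^ (n - d) = (- 1) ^ n * ((- 1) ^ d :: sym)"
        by (simp add: minus_one_power_iff)
      then show "(- 1) ^ (n - d) * (esym (n - d) * hsym (int (Suc d)))
        = (- 1) ^ n * ((- 1) ^ d * hsym (1 + int d) * esym (n - d))"
        by (simp add: mult_ac)
    qed
    finally show ?thesis
      by (simp add: e[of n])
  qed
  from this[of n] show ?thesis
    by (subst (asm) sum.atMost_Suc_shift) (simp add: sum_negf add_eq_0_iff2)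
qed

lemma hall_hperp: "hall (hperp n f) g = hall f (hsym (int n) * g)"
proof (induction n arbitrary: f g rule: less_induct)
  case (less n)
  have sg: "hall ((- 1) ^ d * f) g = (- 1) ^ d * hall f g" "hall f ((- 1) ^ d * g) = (- 1) ^ d * hall f g" for d f g
    by (cases "even d"; simp add: hall_uminus_left hall_commute[of f])+
  show ?case
  proof (cases n)
    case (Suc m)
    have "hall (hperp n f) g = (\<Sum>d\<le>m. (- 1) ^ d * hall f (esym (Suc d) * (hsym (int (m - d)) * g)))"
      using less Suc by (simp add: hall_sum_left sg hall_eperp)
    also have "\<dots> = hall f (hsym (int n) * g)"
      unfolding Suc hsym_esym_recursion sum_distrib_right hall_sum_right
      by (simp add: sg mult.assoc)
    finally show ?thesis .
  qed simp
qed

lemma perp_hsym: "perp (hsym (int n)) f = hperp n f"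
  by (rule perp_eqI) (rule hall_hperp)

lemma sum_list_shift_set:
  assumes "S \<subseteq> {..<length \<gamma>}"
  shows "sum_list (shift_set c S \<gamma>) = sum_list \<gamma> + c * int (card S)"
proof -
  have "sum_list (shift_set c S \<gamma>) = (\<Sum>p = 0..<length \<gamma>. \<gamma> ! p) + (\<Sum>p = 0..<length \<gamma>. if p \<in> S then c else 0)"
    by (simp add: sum_list_sum_nth sum.distrib)
  also have "(\<Sum>p = 0..<length \<gamma>. if p \<in> S then c else 0) = (\<Sum>p\<in>S. c)"
    using assms by (subst sum.inter_restrict[symmetric]) (auto simp: atLeast0LessThan Int_absorb1)
  finally show ?thesis
    by (simp add: sum_list_sum_nth mult.commute)
qed

text \<open>A degree filtration generated by all integer lists, so that vertical strips act on the
  generators directly. Since \<open>schur\<close> vanishes for negative sums,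
  \<open>e\<^sub>i\<^sup>\<bottom> h\<^sub>j\<^sup>\<bottom> f = 0\<close> once \<open>i + j\<close>
  exceeds the degree, and the \<open>Sum_any\<close> in \<open>Bop\<close> becomes a finite
  sum.\<close>

definition deg_le :: "int \<Rightarrow> sym set"
  where "deg_le N = Sym.span (schur ` {\<gamma>. sum_list \<gamma> \<le> N})"

lemma deg_le_induct [consumes 1, case_names zero add]:
  assumes "f \<in> deg_le N" "P 0" "\<And>c \<gamma> f. sum_list \<gamma> \<le> N \<Longrightarrow> P f \<Longrightarrow> P (c *\<^sub>t schur \<gamma> + f)"
  shows "P f"
  using assms(1) unfolding deg_le_def
  by (induction rule: Sym.span_induct_alt) (use assms in auto)

lemma deg_le_zero [simp]: "0 \<in> deg_le N"
  by (simp add: deg_le_def Sym.span_zero)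

lemma deg_le_add: "f \<in> deg_le N \<Longrightarrow> g \<in> deg_le N \<Longrightarrow> f + g \<in> deg_le N"
  by (simp add: deg_le_def Sym.span_add)

lemma deg_le_tscale: "f \<in> deg_le N \<Longrightarrow> c *\<^sub>t f \<in> deg_le N"
  by (simp add: deg_le_def Sym.span_scale)

lemma deg_le_sum: "(\<And>i. i \<in> A \<Longrightarrow> f i \<in> deg_le N) \<Longrightarrow> (\<Sum>i\<in>A. f i) \<in> deg_le N"
  by (simp add: deg_le_def Sym.span_sum)

lemma deg_le_schur: "sum_list \<gamma> \<le> N \<Longrightarrow> schur \<gamma> \<in> deg_le N"
  by (auto simp: deg_le_def intro: Sym.span_base)

lemma deg_le_mono: "M \<le> N \<Longrightarrow> deg_le M \<subseteq> deg_le N"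
  by (auto simp: deg_le_def intro!: Sym.span_mono)

lemma deg_le_negative: "f \<in> deg_le N \<Longrightarrow> N < 0 \<Longrightarrow> f = 0"
  by (induction rule: deg_le_induct) (auto simp: schur_zero_sum)

lemma ex_deg_le: "\<exists>N::nat. f \<in> deg_le (int N)"
proof (induction f rule: schur_induct)
  case (add c \<gamma> f)
  then obtain N where N: "f \<in> deg_le (int N)"
    by blast
  have "f \<in> deg_le (int (max N (nat (sum_list \<gamma>))))" "schur \<gamma> \<in> deg_le (int (max N (nat (sum_list \<gamma>))))"
    using N deg_le_mono[of "int N" "int (max N (nat (sum_list \<gamma>)))"] by (auto intro: deg_le_schur)
  then show ?case
    by (blast intro: deg_le_add deg_le_tscale)
qed auto

lemma eperp_deg_le: "f \<in> deg_le N \<Longrightarrow> eperp d f \<in> deg_le (N - int d)"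
proof (induction rule: deg_le_induct)
  case (add c \<gamma> f)
  have "eperp d (schur \<gamma>) \<in> deg_le (N - int d)"
    unfolding eperp_schur_sets
    by (rule deg_le_sum) (use add in \<open>auto intro!: deg_le_schur simp: sum_list_shift_set\<close>)
  with add show ?case
    by (simp add: eperp_add eperp_tscale deg_le_add deg_le_tscale)
qed simp

lemma tscale_sign: "((- 1) ^ d) *\<^sub>t f = (- 1) ^ d * f"
  by (cases "even d") simp_all

lemma hperp_deg_le: "f \<in> deg_le N \<Longrightarrow> hperp n f \<in> deg_le (N - int n)"
proof (induction n arbitrary: f N rule: less_induct)
  case (less n)
  show ?case
  proof (cases n)
    case (Suc m)
    have "hperp (m - d) (eperp (Suc d) f) \<in> deg_le (N - int n)" if "d \<le> m" for d
      using less.IH[OF _ eperp_deg_le[OF less.prems], of "m - d" "Suc d"] that Suc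
      by (simp add: of_nat_diff algebra_simps)
    then show ?thesis
      unfolding Suc hperp.simps by (intro deg_le_sum) (simp add: tscale_sign[symmetric] deg_le_tscale)
  qed (use less in simp)
qed

lemma tscale_mult_right: "f * (c *\<^sub>t g) = c *\<^sub>t (f * g)"
  by (simp add: tscale_def mult_ac)

lemma hperp_add: "hperp n (f + g) = hperp n f + hperp n g"
proof (induction n arbitrary: f g rule: less_induct)
  case (less n)
  show ?case
    by (cases n) (simp_all add: eperp_add less distrib_left sum.distrib)
qed

lemma hperp_tscale: "hperp n (c *\<^sub>t f) = c *\<^sub>t hperp n f"
proof (induction n arbitrary: f rule: less_induct)
  case (less n)
  show ?case
  proof (cases n)
    case (Suc m)
    have "hperp n (c *\<^sub>t f) = (\<Sum>d\<le>m. (- 1) ^ d * (c *\<^sub>t hperp (m - d) (eperp (Suc d) f)))"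
      unfolding Suc hperp.simps
      by (intro sum.cong refl) (simp add: eperp_tscale less Suc)
    then show ?thesis
      unfolding Suc hperp.simps by (simp add: tscale_def sum_distrib_left mult_ac)
  qed simp
qed

lemma hperp_eperp_cancel: "(\<Sum>d\<le>n. (- 1) ^ d * hperp (n - d) (eperp d f)) = (if n = 0 then f else 0)"
proof (cases n)
  case (Suc m)
  then show ?thesis
    by (simp only: Suc sum.atMost_Suc_shift) (simp add: sum_negf)
qed simp

lemma Bop_eq_sum:
  assumes "f \<in> deg_le (int N)"
  shows "Bop m f = (\<Sum>i\<le>N. \<Sum>j\<le>N.
    ((- 1) ^ i * tvar ^ j) *\<^sub>t (hsym (m + int i + int j) * eperp i (hperp j f)))"
proof -
  let ?g = "\<lambda>i j. ((- 1) ^ i * tvar ^ j) *\<^sub>t (hsym (m + int i + int j) * eperp i (hperp j f))"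
  have zero: "eperp i (hperp j f) = 0" if "int N < int i + int j" for i j
    using deg_le_negative[OF eperp_deg_le[OF hperp_deg_le[OF assms]]] that by simp
  have "Bop m f = Sum_any (\<lambda>(i, j). ?g i j)"
    by (simp add: Bop_def perp_esym perp_hsym)
  also have "\<dots> = (\<Sum>(i, j)\<in>{..N} \<times> {..N}. ?g i j)"
  proof (rule Sum_any.expand_superset)
    show "{a. (case a of (i, j) \<Rightarrow> ?g i j) \<noteq> 0} \<subseteq> {..N} \<times> {..N}"
    proof (clarsimp, rule ccontr)
      fix i j assume nz: "?g i j \<noteq> 0" and "\<not> (i \<le> N \<and> j \<le> N)"
      then have "int N < int i + int j"
        by linarith
      from zero[OF this] nz show False
        by simp
    qed
  qed simp
  also have "\<dots> = (\<Sum>i\<le>N. \<Sum>j\<le>N. ?g i j)"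
    by (simp add: sum.cartesian_product)
  finally show ?thesis .
qed

lemma Bop_add: "Bop m (f + g) = Bop m f + Bop m g"
proof -
  obtain M N where MN: "f \<in> deg_le (int M)" "g \<in> deg_le (int N)"
    using ex_deg_le by metis
  then have "f \<in> deg_le (int (max M N))" "g \<in> deg_le (int (max M N))"
    using deg_le_mono[of "int M" "int (max M N)"] deg_le_mono[of "int N" "int (max M N)"] by auto
  then show ?thesis
    by (simp add: Bop_eq_sum[of _ "max M N"] deg_le_add eperp_add hperp_add distrib_left sum.distrib
      Sym.scale_right_distrib)
qed

lemma Bop_tscale: "Bop m (c *\<^sub>t f) = c *\<^sub>t Bop m f"
proof -
  obtain N where N: "f \<in> deg_le (int N)"
    using ex_deg_le by metis
  show ?thesis
    by (simp add: Bop_eq_sum[OF N] Bop_eq_sum[OF deg_le_tscale[OF N]] eperp_tscale hperp_tscale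
      Sym.scale_sum_right tscale_mult_right mult.commute[of _ c])
qed

text \<open>In terms of Bernstein's operators, \<open>Bop m\<close> is \<open>\<Sum>\<^sub>j
  t\<^sup>j bernstein (m + j) \<circ> h\<^sub>j\<^sup>\<bottom>\<close>, and the series of the
  \<open>(-t)\<^sup>d e\<^sub>d\<^sup>\<bottom>\<close> is inverse to that of the
  \<open>t\<^sup>j h\<^sub>j\<^sup>\<bottom>\<close>. Summing over \<open>n = d + j\<close> leaves
  only \<open>n = 0\<close>. This direction suits the action of
  \<open>e\<^sub>d\<^sup>\<bottom>\<close> on Catalan functions by vertical strips.\<close>

lemma Bop_eperp_alternating:
  assumes "f \<in> deg_le (int N)"
  shows "(\<Sum>d\<le>N. ((- tvar) ^ d) *\<^sub>t Bop (m + int d) (eperp d f)) = bernstein m f"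
proof -
  define F where "F i d j = ((- tvar) ^ d * ((- 1) ^ i * tvar ^ j))
    *\<^sub>t (hsym (m + int d + int i + int j) * eperp i (hperp j (eperp d f)))" for i d j
  have deg_le: "eperp d f \<in> deg_le (int N)" for d
    using eperp_deg_le[OF assms, of d] deg_le_mono[of "int N - int d" "int N"] by auto
  have F0: "F i d j = 0" if "N < d + j" for i d j
    using deg_le_negative[OF hperp_deg_le[OF eperp_deg_le[OF assms]], of d j] that by (simp add: F_def)
  have tri: "(\<Sum>d\<le>N. \<Sum>j\<le>N. F i d j) = (\<Sum>n\<le>N. \<Sum>d\<le>n. F i d (n - d))" for i
  proof -
    have "(\<Sum>d\<le>N. \<Sum>j\<le>N. F i d j) = (\<Sum>(d, j)\<in>{..N} \<times> {..N}. F i d j)"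
      by (simp add: sum.cartesian_product)
    also have "\<dots> = (\<Sum>(d, j)\<in>{(d, j). d + j \<le> N}. F i d j)"
      by (rule sum.mono_neutral_right) (auto intro!: F0)
    also have "\<dots> = (\<Sum>n\<le>N. \<Sum>d\<le>n. F i d (n - d))"
      by (rule sum.triangle_reindex_eq)
    finally show ?thesis .
  qed
  have inner: "(\<Sum>d\<le>n. F i d (n - d)) = (if n = 0 then (- 1) ^ i * hsym (m + int i) * eperp i f else 0)" for i n
  proof -
    have "(\<Sum>d\<le>n. F i d (n - d)) = ((- 1) ^ i * tvar ^ n) *\<^sub>t
      (hsym (m + int n + int i) * eperp i (\<Sum>d\<le>n. (- 1) ^ d * hperp (n - d) (eperp d f)))"
      unfolding eperp_sum sum_distrib_left Sym.scale_sum_right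
    proof (rule sum.cong[OF refl])
      fix d assume "d \<in> {..n}"
      then have d: "d \<le> n"
        by simp
      have 1: "(- tvar) ^ d * ((- 1) ^ i * tvar ^ (n - d)) = ((- 1) ^ i * tvar ^ n) * (- 1) ^ d"
      proof -
        have "(- tvar) ^ d = (- 1) ^ d * tvar ^ d"
          by (rule power_minus)
        moreover have "tvar ^ d * tvar ^ (n - d) = tvar ^ n"
          using d by (simp flip: power_add)
        ultimately show ?thesis
          by (simp only: mult_ac)
      qed
      have 2: "eperp i ((- 1) ^ d * x) = (- 1) ^ d * eperp i x" for x
        by (simp add: eperp_tscale flip: tscale_sign)
      have 3: "hsym (m + int d + int i + int (n - d)) = hsym (m + int n + int i)"
        using d by (simp add: of_nat_diff algebra_simps)
      show "F i d (n - d) = ((- 1) ^ i * tvar ^ n) *\<^sub>t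
        (hsym (m + int n + int i) * eperp i ((- 1) ^ d * hperp (n - d) (eperp d f)))"
        unfolding F_def 1 2 3 Sym.scale_scale[symmetric] tscale_sign
        by (simp add: mult.left_commute)
    qed
    also have "\<dots> = (if n = 0 then (- 1) ^ i * hsym (m + int i) * eperp i f else 0)"
      unfolding hperp_eperp_cancel by (simp add: tscale_sign mult.assoc)
    finally show ?thesis .
  qed
  have "(\<Sum>d\<le>N. ((- tvar) ^ d) *\<^sub>t Bop (m + int d) (eperp d f)) = (\<Sum>d\<le>N. \<Sum>i\<le>N. \<Sum>j\<le>N. F i d j)"
    by (simp add: Bop_eq_sum[OF deg_le] Sym.scale_sum_right F_def)
  also have "\<dots> = (\<Sum>i\<le>N. \<Sum>d\<le>N. \<Sum>j\<le>N. F i d j)"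
    by (rule sum.swap)
  also have "\<dots> = (\<Sum>i\<le>N. (- 1) ^ i * hsym (m + int i) * eperp i f)"
    unfolding tri inner by (simp add: sum.delta)
  also have "\<dots> = bernstein m f"
  proof (rule bernstein_eq_sum[symmetric])
    fix i assume "N < i"
    then show "eperp i f = 0"
      using deg_le_negative[OF eperp_deg_le[OF assms], of i] by simp
  qed
  finally show ?thesis .
qed

section \<open>Catalan functions and vertex operators\<close>

lemma length_raise [simp]: "length (raise \<Psi> m \<gamma>) = length \<gamma>"
  by (simp add: raise_def)

lemma nth_raise:
  "r < length \<gamma> \<Longrightarrow> raise \<Psi> m \<gamma> ! r = \<gamma> ! r
    + (\<Sum>(i, j)\<in>\<Psi>. int (m (i, j)) * (of_bool (r = i) - of_bool (r = j)))"
  by (simp add: raise_def)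

lemma finite_all_roots [simp]: "finite (all_roots n)"
  by (rule finite_subset[of _ "{..<n} \<times> {..<n}"]) (auto simp: all_roots_def)

lemma finite_roots: "\<Psi> \<subseteq> all_roots n \<Longrightarrow> finite \<Psi>"
  by (rule finite_subset) auto

lemma sum_list_drop: "sum_list (drop b xs) = (\<Sum>r = b..<length xs. xs ! r)"
proof -
  have "sum_list (drop b xs) = (\<Sum>r = 0..<length xs - b. xs ! (b + r))"
    by (simp add: sum_list_sum_nth)
  also have "\<dots> = (\<Sum>r = b..<length xs. xs ! r)"
    by (rule sum.reindex_bij_witness[of _ "\<lambda>r. r - b" "\<lambda>r. b + r"]) auto
  finally show ?thesis .
qed

lemma sum_list_drop_raise:
  assumes "\<Psi> \<subseteq> all_roots (length \<gamma>)" "b \<le> length \<gamma>"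
  shows "sum_list (drop b (raise \<Psi> m \<gamma>)) = sum_list (drop b \<gamma>)
    - (\<Sum>(i, j)\<in>\<Psi>. if i < b \<and> b \<le> j then int (m (i, j)) else 0)"
proof -
  have "sum_list (drop b (raise \<Psi> m \<gamma>)) = sum_list (drop b \<gamma>)
    + (\<Sum>r = b..<length \<gamma>. \<Sum>(i, j)\<in>\<Psi>. int (m (i, j)) * (of_bool (r = i) - of_bool (r = j)))"
    by (simp add: sum_list_drop nth_raise sum.distrib)
  also have "(\<Sum>r = b..<length \<gamma>. \<Sum>(i, j)\<in>\<Psi>. int (m (i, j)) * (of_bool (r = i) - of_bool (r = j)))
    = (\<Sum>p\<in>\<Psi>. \<Sum>r = b..<length \<gamma>. case p of (i, j) \<Rightarrow> int (m (i, j)) * (of_bool (r = i) - of_bool (r = j)))"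
    by (rule sum.swap)
  also have "\<dots> = (\<Sum>p\<in>\<Psi>. case p of (i, j) \<Rightarrow> - (if i < b \<and> b \<le> j then int (m (i, j)) else 0))"
  proof (rule sum.cong[OF refl])
    fix p assume "p \<in> \<Psi>"
    then obtain i j where p: "p = (i, j)" "i < j" "j < length \<gamma>"
      using assms by (auto simp: all_roots_def)
    have ob: "(\<Sum>r = b..<length \<gamma>. of_bool (r = x) :: int) = of_bool (b \<le> x)" if "x < length \<gamma>" for x
      using that by (simp add: of_bool_def sum.delta)
    have "(\<Sum>r = b..<length \<gamma>. int (m (i, j)) * (of_bool (r = i) - of_bool (r = j)))
      = int (m (i, j)) * (of_bool (b \<le> i) - of_bool (b \<le> j))"
      unfolding sum_distrib_left[symmetric] sum_subtractf using p by (simp add: ob)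
    then show "(\<Sum>r = b..<length \<gamma>. case p of (i, j) \<Rightarrow> int (m (i, j)) * (of_bool (r = i) - of_bool (r = j)))
      = (case p of (i, j) \<Rightarrow> - (if i < b \<and> b \<le> j then int (m (i, j)) else 0))"
      using p by auto
  qed
  finally show ?thesis
    by (simp add: case_prod_unfold sum_negf)
qed

lemma sum_list_raise:
  assumes "\<Psi> \<subseteq> all_roots (length \<gamma>)"
  shows "sum_list (raise \<Psi> m \<gamma>) = sum_list \<gamma>"
  using sum_list_drop_raise[OF assms, of 0 m] by (simp add: case_prod_unfold)

lemma schur_zero_drop: "sum_list (drop b \<gamma>) < 0 \<Longrightarrow> schur \<gamma> = 0"
  using schur_zero_suffix[of "drop b \<gamma>" "take b \<gamma>"] by simp

text \<open>Every root crossing position \<open>b\<close> lowers the sum of the entries from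
  \<open>b\<close> on, and none raises it; but a nonzero Schur function has only nonnegative tail
  sums. This is the finiteness behind \<open>Sum_any\<close> in \<open>catalan\<close>.\<close>

lemma raise_bound:
  assumes "\<Psi> \<subseteq> all_roots (length \<gamma>)" "(a, b) \<in> \<Psi>" "schur (raise \<Psi> m \<gamma>) \<noteq> 0"
  shows "int (m (a, b)) \<le> sum_list (drop b \<gamma>)"
proof -
  have ab: "a < b" "b < length \<gamma>"
    using assms by (auto simp: all_roots_def)
  have "int (m (a, b)) \<le> (\<Sum>p\<in>\<Psi>. case p of (i, j) \<Rightarrow> if i < b \<and> b \<le> j then int (m (i, j)) else 0)"
    using member_le_sum[OF assms(2), of "\<lambda>p. case p of (i, j) \<Rightarrow> if i < b \<and> b \<le> j then int (m (i, j)) else 0"]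
      finite_roots[OF assms(1)] ab by (auto simp: case_prod_unfold)
  moreover have "0 \<le> sum_list (drop b (raise \<Psi> m \<gamma>))"
    using schur_zero_drop[of b "raise \<Psi> m \<gamma>"] assms(3) by (meson not_le)
  ultimately show ?thesis
    using sum_list_drop_raise[OF assms(1), of b m] ab by linarith
qed

text \<open>A finite range for the exponents. The bound \<open>B\<close> is a parameter so that the
  sums for different weights can be taken over one box and compared term by term.\<close>

definition exponent_box :: "(nat \<times> nat) set \<Rightarrow> nat \<Rightarrow> (nat \<times> nat \<Rightarrow> nat) set"
  where "exponent_box \<Psi> B = {m. \<forall>p. (p \<in> \<Psi> \<longrightarrow> m p \<in> {..B}) \<and> (p \<notin> \<Psi> \<longrightarrow> m p = 0)}"

lemma boxI: "(\<And>p. p \<in> \<Psi> \<Longrightarrow> m p \<le> B) \<Longrightarrow> (\<And>p. p \<notin> \<Psi> \<Longrightarrow> m p = 0) \<Longrightarrow> m \<in> exponent_box \<Psi> B"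
  by (simp add: exponent_box_def del: split_paired_All)

lemma exponent_box_le: "m \<in> exponent_box \<Psi> B \<Longrightarrow> p \<in> \<Psi> \<Longrightarrow> m p \<le> B"
  and exponent_box_zero: "m \<in> exponent_box \<Psi> B \<Longrightarrow> p \<notin> \<Psi> \<Longrightarrow> m p = 0"
  by (simp_all add: exponent_box_def del: split_paired_All)

lemma finite_exponent_box: "finite \<Psi> \<Longrightarrow> finite (exponent_box \<Psi> B)"
  unfolding exponent_box_def by (rule finite_set_of_finite_funs) auto

definition abs_sum :: "int list \<Rightarrow> nat"
  where "abs_sum \<gamma> = (\<Sum>r<length \<gamma>. nat \<bar>\<gamma> ! r\<bar>)"

lemma sum_list_drop_le_abs_sum: "sum_list (drop b \<gamma>) \<le> int (abs_sum \<gamma>)"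
proof -
  have "(\<Sum>r = b..<length \<gamma>. \<gamma> ! r) \<le> (\<Sum>r = b..<length \<gamma>. \<bar>\<gamma> ! r\<bar>)"
    by (rule sum_mono) simp
  also have "\<dots> \<le> (\<Sum>r<length \<gamma>. \<bar>\<gamma> ! r\<bar>)"
    by (rule sum_mono2) auto
  finally show ?thesis
    by (simp add: sum_list_drop abs_sum_def)
qed

definition catalan_term :: "(nat \<times> nat) set \<Rightarrow> int list \<Rightarrow> (nat \<times> nat \<Rightarrow> nat) \<Rightarrow> sym"
  where "catalan_term \<Psi> \<gamma> m = (tvar ^ (\<Sum>p\<in>\<Psi>. m p)) *\<^sub>t schur (raise \<Psi> m \<gamma>)"

lemma catalan_eq_sum:
  assumes "\<Psi> \<subseteq> all_roots (length \<gamma>)" "abs_sum \<gamma> \<le> B"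
  shows "catalan \<Psi> \<gamma> = (\<Sum>m\<in>exponent_box \<Psi> B. catalan_term \<Psi> \<gamma> m)"
proof -
  have "catalan \<Psi> \<gamma> = (\<Sum>m\<in>exponent_box \<Psi> B. catalan_term \<Psi> \<gamma> m when (\<forall>p. p \<notin> \<Psi> \<longrightarrow> m p = 0))"
    unfolding catalan_def catalan_term_def[symmetric]
  proof (rule Sum_any.expand_superset)
    show "{m. (catalan_term \<Psi> \<gamma> m when (\<forall>p. p \<notin> \<Psi> \<longrightarrow> m p = 0)) \<noteq> 0} \<subseteq> exponent_box \<Psi> B"
    proof
      fix m assume "m \<in> {m. (catalan_term \<Psi> \<gamma> m when (\<forall>p. p \<notin> \<Psi> \<longrightarrow> m p = 0)) \<noteq> 0}"
      then have m: "\<forall>p. p \<notin> \<Psi> \<longrightarrow> m p = 0" "schur (raise \<Psi> m \<gamma>) \<noteq> 0"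
        by (auto simp: catalan_term_def when_def split: if_splits)
      have "m (a, b) \<le> B" if "(a, b) \<in> \<Psi>" for a b
        using raise_bound[OF assms(1) that m(2)] sum_list_drop_le_abs_sum[of b \<gamma>] assms(2) by linarith
      then show "m \<in> exponent_box \<Psi> B"
        using m(1) by (auto simp: exponent_box_def)
    qed
  qed (use finite_exponent_box finite_roots[OF assms(1)] in blast)
  also have "\<dots> = (\<Sum>m\<in>exponent_box \<Psi> B. catalan_term \<Psi> \<gamma> m)"
    by (rule sum.cong) (auto simp: exponent_box_def)
  finally show ?thesis .
qed

lemma catalan_zero_drop:
  assumes "\<Psi> \<subseteq> all_roots (length \<gamma>)" "sum_list (drop b \<gamma>) < 0"
  shows "catalan \<Psi> \<gamma> = 0"
proof -
  have b: "b \<le> length \<gamma>"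
    using assms(2) by (cases "b \<le> length \<gamma>") auto
  have "catalan_term \<Psi> \<gamma> m = 0" for m
  proof -
    have "0 \<le> (\<Sum>p\<in>\<Psi>. case p of (i, j) \<Rightarrow> if i < b \<and> b \<le> j then int (m (i, j)) else 0)"
      by (rule sum_nonneg) auto
    then have "sum_list (drop b (raise \<Psi> m \<gamma>)) < 0"
      using sum_list_drop_raise[OF assms(1) b, of m] assms(2) by simp
    then show ?thesis
      by (simp add: catalan_term_def schur_zero_drop)
  qed
  then show ?thesis
    using catalan_eq_sum[OF assms(1) order_refl] by simp
qed

definition add_root :: "nat \<times> nat \<Rightarrow> int list \<Rightarrow> int list"
  where "add_root \<beta> \<gamma> = \<gamma>[fst \<beta> := \<gamma> ! fst \<beta> + 1, snd \<beta> := \<gamma> ! snd \<beta> - 1]"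

lemma length_add_root [simp]: "length (add_root \<beta> \<gamma>) = length \<gamma>"
  by (simp add: add_root_def)

lemma nth_add_root:
  assumes "\<beta> \<in> all_roots (length \<gamma>)" "r < length \<gamma>"
  shows "add_root \<beta> \<gamma> ! r = \<gamma> ! r + of_bool (r = fst \<beta>) - of_bool (r = snd \<beta>)"
  using assms by (auto simp: add_root_def all_roots_def nth_list_update)

text \<open>The factor of \<open>\<beta>\<close> in a Catalan function is the geometric series
  \<open>1 / (1 - t R\<^sub>\<beta>)\<close>: the exponents with \<open>m \<beta> = 0\<close> give
  the function without \<open>\<beta>\<close>, and lowering a positive \<open>m \<beta>\<close> by
  one factors out \<open>t R\<^sub>\<beta>\<close>.\<close>

lemma catalan_remove_root:
  assumes \<Psi>: "\<Psi> \<subseteq> all_roots (length \<gamma>)" and \<beta>: "\<beta> \<in> \<Psi>"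
  shows "catalan (\<Psi> - {\<beta>}) \<gamma> = catalan \<Psi> \<gamma> - tvar *\<^sub>t catalan \<Psi> (add_root \<beta> \<gamma>)"
proof -
  let ?\<gamma>' = "add_root \<beta> \<gamma>"
  \<comment> \<open>The extra one makes the layer \<open>m \<beta> = B\<close> vanish for the raised
    weight, so that the shifted sum over \<open>m \<beta> < B\<close> equals the sum over the whole
    box.\<close>
  define B where "B = Suc (abs_sum \<gamma> + abs_sum ?\<gamma>')"
  obtain a b where ab: "\<beta> = (a, b)"
    by (cases \<beta>)
  have fin: "finite \<Psi>"
    by (rule finite_roots[OF \<Psi>])
  have \<Psi>': "\<Psi> \<subseteq> all_roots (length ?\<gamma>')" and \<Psi>'': "\<Psi> - {\<beta>} \<subseteq> all_roots (length \<gamma>)"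
    using \<Psi> by auto
  let ?M = "exponent_box \<Psi> B"
  let ?inc = "\<lambda>m. m(\<beta> := Suc (m \<beta>))"
  have finM: "finite ?M"
    by (rule finite_exponent_box[OF fin])
  have M0: "{m \<in> ?M. m \<beta> = 0} = exponent_box (\<Psi> - {\<beta>}) B"
    by (auto simp: exponent_box_def simp del: split_paired_All)
  have t0: "catalan_term \<Psi> \<gamma> m = catalan_term (\<Psi> - {\<beta>}) \<gamma> m" if "m \<beta> = 0" for m
  proof -
    have "raise \<Psi> m \<gamma> = raise (\<Psi> - {\<beta>}) m \<gamma>"
      using that ab by (intro nth_equalityI) (auto simp: nth_raise sum.remove[OF fin \<beta>])
    moreover have "(\<Sum>p\<in>\<Psi>. m p) = (\<Sum>p\<in>\<Psi> - {\<beta>}. m p)"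
      using that by (simp add: sum.remove[OF fin \<beta>])
    ultimately show ?thesis
      by (simp add: catalan_term_def)
  qed
  have t1: "catalan_term \<Psi> \<gamma> (?inc m) = tvar *\<^sub>t catalan_term \<Psi> ?\<gamma>' m" for m
  proof -
    have "raise \<Psi> (?inc m) \<gamma> = raise \<Psi> m ?\<gamma>'"
    proof (rule nth_equalityI)
      fix r assume "r < length (raise \<Psi> (?inc m) \<gamma>)"
      then have r: "r < length \<gamma>"
        by simp
      have "(\<Sum>(i, j)\<in>\<Psi> - {\<beta>}. int (?inc m (i, j)) * (of_bool (r = i) - of_bool (r = j)))
        = (\<Sum>(i, j)\<in>\<Psi> - {\<beta>}. int (m (i, j)) * (of_bool (r = i) - of_bool (r = j)))"
        by (rule sum.cong) auto
      then show "raise \<Psi> (?inc m) \<gamma> ! r = raise \<Psi> m ?\<gamma>' ! r"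
        using r \<beta> \<Psi> nth_add_root[of \<beta> \<gamma> r]
        by (auto simp: nth_raise sum.remove[OF fin \<beta>] ab algebra_simps)
    qed simp
    moreover have "(\<Sum>p\<in>\<Psi>. ?inc m p) = Suc (\<Sum>p\<in>\<Psi>. m p)"
      by (simp add: sum.remove[OF fin \<beta>])
    ultimately show ?thesis
      by (simp add: catalan_term_def)
  qed
  have M1: "{m \<in> ?M. m \<beta> \<noteq> 0} = ?inc ` {m \<in> ?M. m \<beta> < B}"
  proof (rule equalityI; rule subsetI)
    fix m assume m: "m \<in> {m \<in> ?M. m \<beta> \<noteq> 0}"
    have "m = ?inc (m(\<beta> := m \<beta> - 1))"
      using m by auto
    moreover have "m(\<beta> := m \<beta> - 1) \<in> {m \<in> ?M. m \<beta> < B}"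
    proof -
      have "m \<beta> \<le> B"
        using m \<beta> exponent_box_le by blast
      then show ?thesis
        using m \<beta> by (auto simp: exponent_box_def)
    qed
    ultimately show "m \<in> ?inc ` {m \<in> ?M. m \<beta> < B}"
      by (rule image_eqI)
  qed (use \<beta> in \<open>auto simp: exponent_box_def\<close>)
  have inj: "inj_on ?inc X" for X
  proof (rule inj_onI, rule ext)
    fix m m' p assume eq: "?inc m = ?inc m'"
    then have "?inc m p = ?inc m' p" "?inc m \<beta> = ?inc m' \<beta>"
      by simp_all
    then show "m p = m' p"
      by (cases "p = \<beta>") auto
  qed
  have tB: "catalan_term \<Psi> ?\<gamma>' m = 0" if "m \<beta> = B" for m
  proof (rule ccontr)
    assume "catalan_term \<Psi> ?\<gamma>' m \<noteq> 0"
    then have "schur (raise \<Psi> m ?\<gamma>') \<noteq> 0"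
      by (auto simp: catalan_term_def)
    from raise_bound[OF \<Psi>' _ this, of a b] show False
      using \<beta> that sum_list_drop_le_abs_sum[of b ?\<gamma>'] by (simp add: ab B_def)
  qed
  have "catalan \<Psi> \<gamma> = (\<Sum>m\<in>?M. catalan_term \<Psi> \<gamma> m)"
    by (rule catalan_eq_sum[OF \<Psi>]) (simp add: B_def)
  also have "\<dots> = (\<Sum>m\<in>{m \<in> ?M. m \<beta> = 0}. catalan_term \<Psi> \<gamma> m) + (\<Sum>m\<in>{m \<in> ?M. m \<beta> \<noteq> 0}. catalan_term \<Psi> \<gamma> m)"
    by (subst sum.union_disjoint[symmetric]) (use finM in \<open>auto intro: sum.cong\<close>)
  also have "(\<Sum>m\<in>{m \<in> ?M. m \<beta> = 0}. catalan_term \<Psi> \<gamma> m) = (\<Sum>m\<in>{m \<in> ?M. m \<beta> = 0}. catalan_term (\<Psi> - {\<beta>}) \<gamma> m)"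
    by (rule sum.cong) (auto simp: t0)
  also have "\<dots> = catalan (\<Psi> - {\<beta>}) \<gamma>"
    unfolding M0 by (rule catalan_eq_sum[OF \<Psi>'', symmetric]) (simp add: B_def)
  also have "(\<Sum>m\<in>{m \<in> ?M. m \<beta> \<noteq> 0}. catalan_term \<Psi> \<gamma> m) = (\<Sum>m\<in>{m \<in> ?M. m \<beta> < B}. tvar *\<^sub>t catalan_term \<Psi> ?\<gamma>' m)"
    unfolding M1 by (subst sum.reindex[OF inj]) (simp add: t1)
  also have "\<dots> = (\<Sum>m\<in>?M. tvar *\<^sub>t catalan_term \<Psi> ?\<gamma>' m)"
  proof (rule sum.mono_neutral_left[OF finM])
    show "\<forall>m\<in>?M - {m \<in> ?M. m \<beta> < B}. tvar *\<^sub>t catalan_term \<Psi> ?\<gamma>' m = 0"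
    proof
      fix m assume "m \<in> ?M - {m \<in> ?M. m \<beta> < B}"
      then have "m \<beta> = B"
        using \<beta> exponent_box_le[of m \<Psi> B \<beta>] by auto
      then show "tvar *\<^sub>t catalan_term \<Psi> ?\<gamma>' m = 0"
        by (simp add: tB)
    qed
  qed auto
  also have "\<dots> = tvar *\<^sub>t catalan \<Psi> ?\<gamma>'"
    by (simp add: catalan_eq_sum[OF \<Psi>', of B] B_def Sym.scale_sum_right)
  finally show ?thesis
    by (simp add: algebra_simps)
qed

lemma catalan_empty: "catalan {} \<gamma> = schur \<gamma>"
proof -
  have "exponent_box {} 0 = {\<lambda>_. 0}" for B
    by (auto simp: exponent_box_def)
  moreover have "raise {} m \<gamma> = \<gamma>" for m
    by (rule nth_equalityI) (simp_all add: nth_raise)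
  ultimately show ?thesis
    using catalan_eq_sum[of "{}" \<gamma> "abs_sum \<gamma>"] by (simp add: exponent_box_def catalan_term_def)
qed

text \<open>The transposition permutes \<open>\<Psi>\<close>, so exponents can be transported along
  it, and raising then commutes with the dot action. It is applied to the block roots, whose head
  rows are interchangeable, and to \<open>all_roots\<close> without one simple root.\<close>

lemma catalan_dot_swap:
  assumes \<Psi>: "\<Psi> \<subseteq> all_roots (length \<gamma>)" and i: "Suc i < length \<gamma>"
    and stable: "\<And>a b. (a, b) \<in> \<Psi> \<Longrightarrow> (transpose i (Suc i) a, transpose i (Suc i) b) \<in> \<Psi>"
  shows "catalan \<Psi> (dot_swap i \<gamma>) = - catalan \<Psi> \<gamma>"
proof -
  define s where "s = transpose i (Suc i)"
  define ss where "ss = map_prod s s"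
  have s: "s (s x) = x" for x
    by (simp add: s_def)
  have ss: "ss (ss p) = p" for p
    by (cases p) (simp add: ss_def s)
  have stab: "p \<in> \<Psi> \<longleftrightarrow> ss p \<in> \<Psi>" for p
    using stable ss by (metis map_prod_simp s_def ss_def surj_pair)
  define B where "B = max (abs_sum \<gamma>) (abs_sum (dot_swap i \<gamma>))"
  have re: "(\<Sum>p\<in>\<Psi>. f (ss p)) = (\<Sum>p\<in>\<Psi>. f p)" for f :: "nat \<times> nat \<Rightarrow> 'z::comm_monoid_add"
    by (rule sum.reindex_bij_witness[of _ ss ss]) (auto simp: ss stab[symmetric])
  have t: "catalan_term \<Psi> (dot_swap i \<gamma>) (m \<circ> ss) = - catalan_term \<Psi> \<gamma> m" for m
  proof -
    define \<Delta> where "\<Delta> r = (\<Sum>(i, j)\<in>\<Psi>. int (m (i, j)) * (of_bool (r = i) - of_bool (r = j)))" for r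
    have seq: "s x = s y \<longleftrightarrow> x = y" for x y
      using s by metis
    have "(\<Sum>(i, j)\<in>\<Psi>. int ((m \<circ> ss) (i, j)) * (of_bool (r = i) - of_bool (r = j))) = \<Delta> (s r)" for r
    proof -
      have "(\<Sum>(i, j)\<in>\<Psi>. int ((m \<circ> ss) (i, j)) * (of_bool (r = i) - of_bool (r = j)))
        = (\<Sum>p\<in>\<Psi>. (\<lambda>(i, j). int (m (i, j)) * (of_bool (s r = i) - of_bool (s r = j))) (ss p))"
        by (rule sum.cong) (auto simp: ss_def seq)
      then show ?thesis
        unfolding re by (simp add: \<Delta>_def)
    qed
    then have "raise \<Psi> (m \<circ> ss) (dot_swap i \<gamma>) = dot_swap i (raise \<Psi> m \<gamma>)"
      using i by (intro nth_equalityI)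
        (auto simp: nth_raise dot_swap_def nth_list_update \<Delta>_def[symmetric] s_def transpose_def)
    moreover have "(\<Sum>p\<in>\<Psi>. (m \<circ> ss) p) = (\<Sum>p\<in>\<Psi>. m p)"
      using re[of m] by simp
    ultimately show ?thesis
      using i by (simp add: catalan_term_def schur_dot_swap)
  qed
  have "catalan \<Psi> (dot_swap i \<gamma>) = (\<Sum>m\<in>exponent_box \<Psi> B. catalan_term \<Psi> (dot_swap i \<gamma>) m)"
    by (rule catalan_eq_sum) (use \<Psi> in \<open>auto simp: B_def\<close>)
  also have "\<dots> = (\<Sum>m\<in>exponent_box \<Psi> B. catalan_term \<Psi> (dot_swap i \<gamma>) (m \<circ> ss))"
  proof -
    have "m \<circ> ss \<in> exponent_box \<Psi> B" if "m \<in> exponent_box \<Psi> B" for m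
      using that by (intro boxI) (use stab in \<open>auto intro: exponent_box_le exponent_box_zero\<close>)
    then show ?thesis
      by (intro sum.reindex_bij_witness[of _ "\<lambda>m. m \<circ> ss" "\<lambda>m. m \<circ> ss"]) (auto simp: o_def ss)
  qed
  also have "\<dots> = - catalan \<Psi> \<gamma>"
    using catalan_eq_sum[OF \<Psi>, of B] by (simp add: t B_def sum_negf)
  finally show ?thesis .
qed

section \<open>Vertex operators acting on Catalan functions\<close>

definition shift_roots :: "nat \<Rightarrow> (nat \<times> nat) set \<Rightarrow> (nat \<times> nat) set"
  where "shift_roots n \<Psi> = map_prod ((+) n) ((+) n) ` \<Psi>"

lemma shift_roots_subset:
  "\<Psi> \<subseteq> all_roots l \<Longrightarrow> shift_roots n \<Psi> \<subseteq> all_roots (n + l)"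
  by (auto simp: shift_roots_def all_roots_def)

lemma sum_shift_roots: "sum f (shift_roots n \<Psi>) = (\<Sum>(i, j)\<in>\<Psi>. f (n + i, n + j))"
  unfolding shift_roots_def
  by (subst sum.reindex) (auto simp: inj_on_def case_prod_unfold intro!: sum.cong)

lemma bernstein_catalan:
  assumes \<Psi>: "\<Psi> \<subseteq> all_roots (length \<tau>)"
  shows "catalan (shift_roots 1 \<Psi>) (a # \<tau>) = bernstein a (catalan \<Psi> \<tau>)"
proof -
  let ?S = "shift_roots 1 \<Psi>"
  define B where "B = max (abs_sum \<tau>) (abs_sum (a # \<tau>))"
  define down where "down m = m \<circ> map_prod Suc Suc" for m :: "nat \<times> nat \<Rightarrow> nat"
  define up where "up m = (\<lambda>(i, j). if i = 0 \<or> j = 0 then 0 else m (i - 1, j - 1))" for m :: "nat \<times> nat \<Rightarrow> nat"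
  have memS: "(i, j) \<in> ?S \<longleftrightarrow> i \<noteq> 0 \<and> j \<noteq> 0 \<and> (i - 1, j - 1) \<in> \<Psi>" for i j
    by (auto simp: shift_roots_def image_iff intro!: bexI[of _ "(i - 1, j - 1)"])
  have t: "catalan_term ?S (a # \<tau>) m = bernstein a (catalan_term \<Psi> \<tau> (down m))" for m
  proof -
    have "raise ?S m (a # \<tau>) = a # raise \<Psi> (down m) \<tau>"
    proof (rule nth_equalityI)
      fix r assume "r < length (raise ?S m (a # \<tau>))"
      then show "raise ?S m (a # \<tau>) ! r = (a # raise \<Psi> (down m) \<tau>) ! r"
        by (cases r) (auto simp: nth_raise sum_shift_roots down_def)
    qed simp
    then show ?thesis
      by (simp add: catalan_term_def schur_Cons bernstein_tscale sum_shift_roots down_def case_prod_unfold map_prod_def)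
  qed
  have "catalan ?S (a # \<tau>) = (\<Sum>m\<in>exponent_box ?S B. catalan_term ?S (a # \<tau>) m)"
    by (rule catalan_eq_sum) (use shift_roots_subset[OF \<Psi>, of 1] in \<open>auto simp: B_def\<close>)
  also have "\<dots> = (\<Sum>m\<in>exponent_box \<Psi> B. bernstein a (catalan_term \<Psi> \<tau> m))"
  proof (rule sum.reindex_bij_witness[of _ up down])
    fix m assume m: "m \<in> exponent_box ?S B"
    show "up (down m) = m"
    proof
      fix p
      show "up (down m) p = m p"
        using m memS[of "fst p" "snd p"] by (cases p) (auto simp: up_def down_def exponent_box_def)
    qed
    show "down m \<in> exponent_box \<Psi> B"
      using m memS by (auto simp: exponent_box_def down_def)
    show "bernstein a (catalan_term \<Psi> \<tau> (down m)) = catalan_term ?S (a # \<tau>) m"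
      by (rule t[symmetric])
  next
    fix m assume m: "m \<in> exponent_box \<Psi> B"
    show "down (up m) = m"
      by (auto simp: up_def down_def)
    show "up m \<in> exponent_box ?S B"
      using m memS by (auto simp: exponent_box_def up_def)
  qed
  also have "\<dots> = bernstein a (catalan \<Psi> \<tau>)"
    unfolding bernstein_sum[symmetric] by (simp add: catalan_eq_sum[OF \<Psi>, of B] B_def)
  finally show ?thesis .
qed

text \<open>Raising and removing a strip both add a fixed vector to the list, so they
  commute.\<close>

lemma eperp_catalan:
  assumes \<Psi>: "\<Psi> \<subseteq> all_roots (length \<tau>)"
  shows "eperp d (catalan \<Psi> \<tau>) = (\<Sum>S | S \<subseteq> {..<length \<tau>} \<and> card S = d. catalan \<Psi> (shift_set (- 1) S \<tau>))"
proof -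
  \<comment> \<open>Removing a strip changes each entry by at most one, so this bound serves all
    strips at once.\<close>
  define B where "B = abs_sum \<tau> + length \<tau>"
  have le: "abs_sum (shift_set (- 1) S \<tau>) \<le> B" for S
  proof -
    have "abs_sum (shift_set (- 1) S \<tau>) \<le> (\<Sum>r<length \<tau>. nat \<bar>\<tau> ! r\<bar> + 1)"
      unfolding abs_sum_def length_shift_set by (rule sum_mono) auto
    then show ?thesis
      unfolding sum.distrib by (simp add: B_def abs_sum_def)
  qed
  have sh: "shift_set (- 1) S (raise \<Psi> m \<tau>) = raise \<Psi> m (shift_set (- 1) S \<tau>)" for S m
    by (rule nth_equalityI) (auto simp: nth_raise)
  have "eperp d (catalan \<Psi> \<tau>) = (\<Sum>m\<in>exponent_box \<Psi> B. eperp d (catalan_term \<Psi> \<tau> m))"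
    unfolding eperp_sum[symmetric] by (subst catalan_eq_sum[OF \<Psi>, of B]) (simp_all add: B_def)
  also have "\<dots> = (\<Sum>m\<in>exponent_box \<Psi> B. \<Sum>S | S \<subseteq> {..<length \<tau>} \<and> card S = d. catalan_term \<Psi> (shift_set (- 1) S \<tau>) m)"
    by (simp add: catalan_term_def eperp_tscale eperp_schur_sets sh Sym.scale_sum_right)
  also have "\<dots> = (\<Sum>S | S \<subseteq> {..<length \<tau>} \<and> card S = d. \<Sum>m\<in>exponent_box \<Psi> B. catalan_term \<Psi> (shift_set (- 1) S \<tau>) m)"
    by (rule sum.swap)
  also have "\<dots> = (\<Sum>S | S \<subseteq> {..<length \<tau>} \<and> card S = d. catalan \<Psi> (shift_set (- 1) S \<tau>))"
    by (intro sum.cong refl catalan_eq_sum[symmetric]) (use \<Psi> le in auto)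
  finally show ?thesis .
qed

lemma catalan_deg_le: "\<Psi> \<subseteq> all_roots (length \<gamma>) \<Longrightarrow> catalan \<Psi> \<gamma> \<in> deg_le (sum_list \<gamma>)"
  by (subst catalan_eq_sum[OF _ order_refl])
    (auto simp: catalan_term_def sum_list_raise intro!: deg_le_sum deg_le_tscale deg_le_schur)

lemma Bop_zero [simp]: "Bop m 0 = 0"
  using Bop_tscale[of m 0 0] by simp

lemma Bop_sum: "Bop m (\<Sum>i\<in>A. f i) = (\<Sum>i\<in>A. Bop m (f i))"
  by (induction A rule: infinite_finite_induct) (simp_all add: Bop_add)

text \<open>
  For a set \<open>J\<close> of columns let \<open>X J\<close> be the left side with the factors \<open>1 - t R\<^sub>0\<^sub>j\<close> for \<open>j \<notin> J\<close> applied,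
  and \<open>Y J\<close> the right side with only the roots of \<open>J\<close> in row 0. Both satisfy the same recursion in \<open>J\<close>,
  and \<open>1 - t R\<^sub>0\<^sub>j\<close> is injective on families that vanish when the entries after the first have
  negative sum.
\<close>

lemma Bop_catalan:
  assumes \<Psi>: "\<Psi> \<subseteq> all_roots (length \<tau>)"
  shows "Bop a (catalan \<Psi> \<tau>) = catalan ({0} \<times> {1..length \<tau>} \<union> shift_roots 1 \<Psi>) (a # \<tau>)"
proof -
  define l where "l = length \<tau>"
  have \<Psi>l: "\<Psi> \<subseteq> all_roots (length \<sigma>)" if "length \<sigma> = l" for \<sigma> :: "int list"
    using \<Psi> that by (simp add: l_def)
  define \<Phi> where "\<Phi> J = {0} \<times> Suc ` J \<union> shift_roots 1 \<Psi>" for J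
  define X where "X J a \<sigma> = (\<Sum>S\<in>Pow ({..<l} - J).
    ((- tvar) ^ card S) *\<^sub>t Bop (a + int (card S)) (catalan \<Psi> (shift_set (- 1) S \<sigma>)))" for J a \<sigma>
  define Y where "Y J a \<sigma> = catalan (\<Phi> J) (a # \<sigma>)" for J a \<sigma>
  have \<Phi>: "\<Phi> J \<subseteq> all_roots (length (a # \<sigma>))" if "length \<sigma> = l" "J \<subseteq> {..<l}" for J a and \<sigma> :: "int list"
    using that shift_roots_subset[OF \<Psi>l[OF that(1)], of 1] by (auto simp: \<Phi>_def all_roots_def)
  have neg: "X J a \<sigma> = 0" "Y J a \<sigma> = 0" if "length \<sigma> = l" "J \<subseteq> {..<l}" "sum_list \<sigma> < 0" for J a \<sigma>
  proof -
    have "catalan \<Psi> (shift_set (- 1) S \<sigma>) = 0" if "S \<in> Pow ({..<l} - J)" for S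
    proof -
      have "sum_list (shift_set (- 1) S \<sigma>) < 0"
        using that \<open>length \<sigma> = l\<close> \<open>sum_list \<sigma> < 0\<close> by (subst sum_list_shift_set) auto
      then show ?thesis
        using catalan_zero_drop[of \<Psi> "shift_set (- 1) S \<sigma>" 0] \<Psi>l \<open>length \<sigma> = l\<close> by simp
    qed
    then show "X J a \<sigma> = 0"
      by (simp add: X_def)
    show "Y J a \<sigma> = 0"
      unfolding Y_def using \<Phi>[OF that(1,2)] that(3) by (intro catalan_zero_drop[of _ _ 1]) auto
  qed
  have X: "X J a \<sigma> = X (insert j J) a \<sigma> - tvar *\<^sub>t X (insert j J) (a + 1) (shift_set (- 1) {j} \<sigma>)"
    if "length \<sigma> = l" "j < l" "j \<notin> J" for J a \<sigma> j
  proof -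
    define K where "K = {..<l} - insert j J"
    have K: "{..<l} - J = insert j K" "j \<notin> K" "finite K"
      using that by (auto simp: K_def)
    let ?g = "\<lambda>S. ((- tvar) ^ card S) *\<^sub>t Bop (a + int (card S)) (catalan \<Psi> (shift_set (- 1) S \<sigma>))"
    have "X J a \<sigma> = (\<Sum>S\<in>Pow K. ?g S) + (\<Sum>S\<in>insert j ` Pow K. ?g S)"
      unfolding X_def K(1) Pow_insert using K by (intro sum.union_disjoint) auto
    also have "(\<Sum>S\<in>Pow K. ?g S) = X (insert j J) a \<sigma>"
      by (simp add: X_def K_def)
    also have "(\<Sum>S\<in>insert j ` Pow K. ?g S) = (\<Sum>S\<in>Pow K. ?g (insert j S))"
      using K(2) by (subst sum.reindex) (auto intro!: inj_onI)
    also have "\<dots> = (\<Sum>S\<in>Pow K. - (tvar *\<^sub>t (((- tvar) ^ card S) *\<^sub>t Bop (a + 1 + int (card S))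
        (catalan \<Psi> (shift_set (- 1) S (shift_set (- 1) {j} \<sigma>))))))"
    proof (rule sum.cong[OF refl])
      fix S assume "S \<in> Pow K"
      then have S: "finite S" "j \<notin> S"
        using K finite_subset by auto
      have "shift_set (- 1) (insert j S) \<sigma> = shift_set (- 1) S (shift_set (- 1) {j} \<sigma>)"
        using S by (intro nth_equalityI) auto
      moreover have "a + int (card (insert j S)) = a + 1 + int (card S)"
        using S by simp
      moreover have "(- tvar) ^ card (insert j S) *\<^sub>t x = - (tvar *\<^sub>t (((- tvar) ^ card S) *\<^sub>t x))" for x
      proof -
        have "(- tvar) ^ card (insert j S) = - (tvar * (- tvar) ^ card S)"
          using S by simp
        then show ?thesis
          by (simp only: Sym.scale_minus_left Sym.scale_scale)
      qed
      ultimately show "?g (insert j S) = - (tvar *\<^sub>t (((- tvar) ^ card S) *\<^sub>t Bop (a + 1 + int (card S))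
        (catalan \<Psi> (shift_set (- 1) S (shift_set (- 1) {j} \<sigma>)))))"
        by (simp only:)
    qed
    also have "\<dots> = - (tvar *\<^sub>t X (insert j J) (a + 1) (shift_set (- 1) {j} \<sigma>))"
      unfolding sum_negf Sym.scale_sum_right[symmetric] X_def K_def ..
    finally show ?thesis
      by simp
  qed
  have Y: "Y J a \<sigma> = Y (insert j J) a \<sigma> - tvar *\<^sub>t Y (insert j J) (a + 1) (shift_set (- 1) {j} \<sigma>)"
    if "length \<sigma> = l" "J \<subseteq> {..<l}" "j < l" "j \<notin> J" for J a \<sigma> j
  proof -
    have "\<Phi> J = \<Phi> (insert j J) - {(0, Suc j)}"
      using that by (auto simp: \<Phi>_def shift_roots_def)
    moreover have "(0, Suc j) \<in> \<Phi> (insert j J)"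
      by (auto simp: \<Phi>_def)
    moreover have "\<Phi> (insert j J) \<subseteq> all_roots (length (a # \<sigma>))"
      using that by (intro \<Phi>) auto
    moreover have "add_root (0, Suc j) (a # \<sigma>) = (a + 1) # shift_set (- 1) {j} \<sigma>"
      using that by (intro nth_equalityI) (auto simp: add_root_def nth_Cons nth_list_update split: nat.splits)
    ultimately show ?thesis
      unfolding Y_def by (simp add: catalan_remove_root)
  qed
  have XY: "X J a \<sigma> = Y J a \<sigma>" if "finite J" "J \<subseteq> {..<l}" "length \<sigma> = l" for J a \<sigma>
    using that
  proof (induction J arbitrary: a \<sigma>)
    case empty
    define N where "N = nat (sum_list \<sigma>) + l"
    have N: "catalan \<Psi> \<sigma> \<in> deg_le (int N)"
      using catalan_deg_le[OF \<Psi>l[OF empty(2)]] deg_le_mono[of "sum_list \<sigma>" "int N"] by (auto simp: N_def)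
    \<comment> \<open>With all the factors applied, grouping by \<open>card S\<close> produces the
      alternating sum that collapses to \<open>bernstein\<close>; on the other side row 0 has no
      roots.\<close>
    have "X {} a \<sigma> = (\<Sum>d\<le>N. \<Sum>S\<in>{S \<in> Pow {..<l}. card S = d}.
      ((- tvar) ^ card S) *\<^sub>t Bop (a + int (card S)) (catalan \<Psi> (shift_set (- 1) S \<sigma>)))"
      unfolding X_def
    proof (subst sum.group)
      have "card S \<le> l" if "S \<subseteq> {..<l}" for S
        using card_mono[OF _ that] by simp
      then show "card ` Pow {..<l} \<subseteq> {..N}"
        by (intro image_subsetI) (simp add: N_def trans_le_add2)
    qed simp_all
    also have "\<dots> = (\<Sum>d\<le>N. ((- tvar) ^ d) *\<^sub>t Bop (a + int d) (eperp d (catalan \<Psi> \<sigma>)))"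
      using empty by (intro sum.cong refl) (simp add: eperp_catalan[OF \<Psi>l] Bop_sum Sym.scale_sum_right)
    also have "\<dots> = bernstein a (catalan \<Psi> \<sigma>)"
      by (rule Bop_eperp_alternating[OF N])
    also have "\<dots> = Y {} a \<sigma>"
      using bernstein_catalan[OF \<Psi>l[OF empty(2)]] by (simp add: Y_def \<Phi>_def)
    finally show ?case .
  next
    case (insert j J)
    have jJ: "insert j J \<subseteq> {..<l}" "J \<subseteq> {..<l}" "j < l" "j \<notin> J"
      using insert by auto
    show ?case
      using insert.prems(2)
    proof (induction "nat (sum_list \<sigma> + 1)" arbitrary: a \<sigma> rule: less_induct)
      case (less \<sigma>)
      show ?case
      proof (cases "sum_list \<sigma> < 0")
        case True
        then show ?thesis
          using neg[OF less.prems jJ(1)] by simp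
      next
        case False
        have "sum_list (shift_set (- 1) {j} \<sigma>) = sum_list \<sigma> - 1"
          using jJ less.prems by (subst sum_list_shift_set) auto
        then have "X (insert j J) (a + 1) (shift_set (- 1) {j} \<sigma>) = Y (insert j J) (a + 1) (shift_set (- 1) {j} \<sigma>)"
          using False less.prems by (intro less.hyps) auto
        moreover have "X J a \<sigma> = Y J a \<sigma>"
          by (rule insert.IH[OF jJ(2) less.prems])
        ultimately show ?thesis
          using X[OF less.prems jJ(3,4), of a] Y[OF less.prems jJ(2,3,4), of a] by simp
      qed
    qed
  qed
  have "X {..<l} a \<tau> = Bop a (catalan \<Psi> \<tau>)"
  proof -
    have "shift_set (- 1) {} \<tau> = \<tau>"
      by (rule nth_equalityI) simp_all
    then show ?thesis
      by (simp add: X_def)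
  qed
  moreover have "Y {..<l} a \<tau> = catalan ({0} \<times> {1..length \<tau>} \<union> shift_roots 1 \<Psi>) (a # \<tau>)"
    by (simp only: Y_def \<Phi>_def image_Suc_lessThan l_def)
  moreover have "X {..<l} a \<tau> = Y {..<l} a \<tau>"
    by (rule XY) (simp_all add: l_def)
  ultimately show ?thesis
    by (simp only:)
qed

definition row_roots :: "nat \<Rightarrow> nat \<Rightarrow> (nat \<times> nat) set"
  where "row_roots n l = {(i, j). i < n \<and> i < j \<and> j < n + l}"

definition block_roots :: "nat \<Rightarrow> nat \<Rightarrow> (nat \<times> nat) set"
  where "block_roots n l = {..<n} \<times> {n..<n + l}"

lemma shift_roots_0 [simp]: "shift_roots 0 \<Psi> = \<Psi>"
  by (simp add: shift_roots_def map_prod_def case_prod_unfold)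

lemma Btilde_catalan:
  assumes \<Psi>: "\<Psi> \<subseteq> all_roots (length \<tau>)"
  shows "Btilde \<nu> (catalan \<Psi> \<tau>)
    = catalan (row_roots (length \<nu>) (length \<tau>) \<union> shift_roots (length \<nu>) \<Psi>) (\<nu> @ \<tau>)"
proof (induction \<nu>)
  case Nil
  have "row_roots 0 (length \<tau>) = {}"
    by (auto simp: row_roots_def)
  then show ?case
    by (simp add: Btilde_def)
next
  case (Cons a \<nu>)
  let ?n = "length \<nu>" and ?l = "length \<tau>"
  let ?\<Phi> = "row_roots ?n ?l \<union> shift_roots ?n \<Psi>"
  have "?\<Phi> \<subseteq> all_roots (length (\<nu> @ \<tau>))"
    using shift_roots_subset[OF \<Psi>, of ?n] by (auto simp: row_roots_def all_roots_def)
  then have "Btilde (a # \<nu>) (catalan \<Psi> \<tau>)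
    = catalan ({0} \<times> {1..length (\<nu> @ \<tau>)} \<union> shift_roots 1 ?\<Phi>) (a # \<nu> @ \<tau>)"
    using Cons Bop_catalan by (simp add: Btilde_def)
  moreover have "{0} \<times> {1..length (\<nu> @ \<tau>)} \<union> shift_roots 1 ?\<Phi>
    = row_roots (Suc ?n) ?l \<union> shift_roots (Suc ?n) \<Psi>"
  proof -
    have "shift_roots 1 (row_roots ?n ?l) = {(i, j). 0 < i \<and> i < Suc ?n \<and> i < j \<and> j < Suc ?n + ?l}"
    proof (rule equalityI; rule subsetI)
      fix p assume "p \<in> {(i, j). 0 < i \<and> i < Suc ?n \<and> i < j \<and> j < Suc ?n + ?l}"
      then show "p \<in> shift_roots 1 (row_roots ?n ?l)"
        unfolding shift_roots_def by (intro image_eqI[of _ _ "(fst p - 1, snd p - 1)"]) (auto simp: row_roots_def)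
    qed (auto simp: shift_roots_def row_roots_def)
    moreover have "shift_roots 1 (shift_roots ?n \<Psi>) = shift_roots (Suc ?n) \<Psi>"
      by (auto simp: shift_roots_def image_image map_prod_def case_prod_unfold)
    moreover have "shift_roots 1 ?\<Phi> = shift_roots 1 (row_roots ?n ?l) \<union> shift_roots 1 (shift_roots ?n \<Psi>)"
      by (simp add: shift_roots_def image_Un)
    moreover have "{0} \<times> {1..length (\<nu> @ \<tau>)} \<union> {(i, j). 0 < i \<and> i < Suc ?n \<and> i < j \<and> j < Suc ?n + ?l}
      = row_roots (Suc ?n) ?l"
      by (auto simp: row_roots_def)
    ultimately show ?thesis
      by (simp only: Un_assoc[symmetric])
  qed
  ultimately show ?case
    by simp
qed

text \<open>\<open>Btilde\<close> puts every root into the head rows, and each factor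
  \<open>1 - t R\<^sub>i\<^sub>j\<close> of \<open>Bvec\<close> takes out one root with both ends in
  the head. What remains are the roots from head rows to tail columns.\<close>

lemma Bvec_catalan:
  assumes \<Psi>: "\<Psi> \<subseteq> all_roots (length \<tau>)"
  shows "Bvec \<nu> (catalan \<Psi> \<tau>)
    = catalan (block_roots (length \<nu>) (length \<tau>) \<union> shift_roots (length \<nu>) \<Psi>) (\<nu> @ \<tau>)"
proof -
  define n where "n = length \<nu>"
  define \<Phi> where "\<Phi> = row_roots n (length \<tau>) \<union> shift_roots n \<Psi>"
  have \<Phi>: "\<Phi> \<subseteq> all_roots (n + length \<tau>)"
    using shift_roots_subset[OF \<Psi>, of n] by (auto simp: \<Phi>_def row_roots_def all_roots_def)
  have main: "foldr one_minus_tR rs Btilde \<beta> (catalan \<Psi> \<tau>) = catalan (\<Phi> - set rs) (\<beta> @ \<tau>)"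
    if "distinct rs" "set rs \<subseteq> {(i, j). i < j \<and> j < n}" "length \<beta> = n" for rs \<beta>
    using that
  proof (induction rs arbitrary: \<beta>)
    case Nil
    then show ?case
      using Btilde_catalan[OF \<Psi>, of \<beta>] by (simp add: \<Phi>_def)
  next
    case (Cons p rs)
    obtain i j where p: "p = (i, j)"
      by (cases p)
    have ij: "i < j" "j < n"
      using Cons.prems p by auto
    have "(i, j) \<in> \<Phi> - set rs"
      using ij Cons.prems p by (auto simp: \<Phi>_def row_roots_def)
    moreover have "\<Phi> - set rs \<subseteq> all_roots (length (\<beta> @ \<tau>))"
      using \<Phi> Cons.prems by auto
    moreover have "add_root (i, j) (\<beta> @ \<tau>) = \<beta>[i := \<beta> ! i + 1, j := \<beta> ! j - 1] @ \<tau>"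
      using ij Cons.prems by (simp add: add_root_def list_update_append nth_append)
    ultimately have "catalan (\<Phi> - set rs - {(i, j)}) (\<beta> @ \<tau>) = catalan (\<Phi> - set rs) (\<beta> @ \<tau>)
      - tvar *\<^sub>t catalan (\<Phi> - set rs) (\<beta>[i := \<beta> ! i + 1, j := \<beta> ! j - 1] @ \<tau>)"
      using catalan_remove_root by metis
    moreover have "\<Phi> - set rs - {(i, j)} = \<Phi> - set (p # rs)"
      using p by auto
    ultimately show ?case
      using Cons p by (simp add: one_minus_tR_def)
  qed
  let ?rs = "[(i, j). j \<leftarrow> [0..<n], i \<leftarrow> [0..<j]]"
  have set: "set ?rs = {(i, j). i < j \<and> j < n}"
    by auto
  have dist: "distinct ?rs"
    by (induction n) (auto simp: distinct_map inj_on_def)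
  have "Bvec \<nu> (catalan \<Psi> \<tau>) = catalan (\<Phi> - set ?rs) (\<nu> @ \<tau>)"
    unfolding Bvec_def n_def[symmetric] by (rule main) (use dist set in \<open>simp_all add: n_def\<close>)
  moreover have "\<Phi> - set ?rs = block_roots n (length \<tau>) \<union> shift_roots n \<Psi>"
    unfolding set by (auto simp: \<Phi>_def row_roots_def block_roots_def shift_roots_def)
  ultimately show ?thesis
    by (simp add: n_def)
qed

lemma Btilde_add: "Btilde \<nu> (f + g) = Btilde \<nu> f + Btilde \<nu> g"
  by (induction \<nu>) (simp_all add: Btilde_def Bop_add)

lemma Btilde_tscale: "Btilde \<nu> (c *\<^sub>t f) = c *\<^sub>t Btilde \<nu> f"
  by (induction \<nu>) (simp_all add: Btilde_def Bop_tscale)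

lemma Bvec_add: "Bvec \<nu> (f + g) = Bvec \<nu> f + Bvec \<nu> g"
proof -
  have "foldr one_minus_tR rs Btilde \<beta> (f + g)
    = foldr one_minus_tR rs Btilde \<beta> f + foldr one_minus_tR rs Btilde \<beta> g" for rs \<beta>
    by (induction rs arbitrary: \<beta>)
      (auto simp: Btilde_add one_minus_tR_def Sym.scale_right_distrib)
  then show ?thesis
    by (simp add: Bvec_def)
qed

lemma Bvec_tscale: "Bvec \<nu> (c *\<^sub>t f) = c *\<^sub>t Bvec \<nu> f"
proof -
  have "foldr one_minus_tR rs Btilde \<beta> (c *\<^sub>t f) = c *\<^sub>t foldr one_minus_tR rs Btilde \<beta> f" for rs \<beta>
    by (induction rs arbitrary: \<beta>)
      (auto simp: Btilde_tscale one_minus_tR_def Sym.scale_right_diff_distrib mult.commute)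
  then show ?thesis
    by (simp add: Bvec_def)
qed

lemma Bvec_zero [simp]: "Bvec \<nu> 0 = 0"
  using Bvec_tscale[of \<nu> 0 0] by simp

text \<open>All head rows enter \<open>block_roots\<close> alike, so \<open>catalan_dot_swap\<close>
  applies inside the head.\<close>

lemma Bvec_dot_swap:
  assumes "Suc i < length \<nu>"
  shows "Bvec (dot_swap i \<nu>) f = - Bvec \<nu> f"
proof (induction f rule: schur_induct)
  case (add c \<tau> f)
  let ?\<Phi> = "block_roots (length \<nu>) (length \<tau>)"
  have Bs: "Bvec \<nu>' (schur \<tau>) = catalan ?\<Phi> (\<nu>' @ \<tau>)" if "length \<nu>' = length \<nu>" for \<nu>'
    using Bvec_catalan[of "{}" \<tau> \<nu>'] that by (simp add: catalan_empty shift_roots_def)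
  have "catalan ?\<Phi> (dot_swap i (\<nu> @ \<tau>)) = - catalan ?\<Phi> (\<nu> @ \<tau>)"
  proof (rule catalan_dot_swap)
    show "?\<Phi> \<subseteq> all_roots (length (\<nu> @ \<tau>))"
      by (auto simp: block_roots_def all_roots_def)
  qed (use assms in \<open>auto simp: block_roots_def transpose_def split: if_splits\<close>)
  moreover have "dot_swap i (\<nu> @ \<tau>) = dot_swap i \<nu> @ \<tau>"
    using assms by (simp add: dot_swap_def list_update_append nth_append)
  ultimately have "Bvec (dot_swap i \<nu>) (schur \<tau>) = - Bvec \<nu> (schur \<tau>)"
    by (simp add: Bs)
  then show ?case
    using add by (simp add: Bvec_add Bvec_tscale)
qed simp

section \<open>Expansions of \<open>k\<close>-Schur functions\<close>

text \<open>Each factor \<open>1 - t R\<^sub>\<beta>\<close> contributes its root at most once, so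
  the terms of the expanded product are indexed by subsets, with all exponents equal to 1.\<close>

abbreviation add_roots :: "(nat \<times> nat) set \<Rightarrow> int list \<Rightarrow> int list"
  where "add_roots S \<equiv> raise S (\<lambda>_. 1)"

lemma nth_add_roots:
  assumes "finite S" "r < length \<gamma>"
  shows "add_roots S \<gamma> ! r = \<gamma> ! r + int (card {j. (r, j) \<in> S}) - int (card {i. (i, r) \<in> S})"
proof -
  have 1: "(\<Sum>(i, j)\<in>S. of_bool (r = i) :: int) = int (card {j. (r, j) \<in> S})"
  proof -
    have "(\<Sum>(i, j)\<in>S. of_bool (r = i) :: int) = int (card {p \<in> S. fst p = r})"
      using assms(1) by (simp add: case_prod_unfold of_bool_def eq_commute[of r] flip: sum.inter_filter)
    also have "{p \<in> S. fst p = r} = Pair r ` {j. (r, j) \<in> S}"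
      by auto
    finally show ?thesis
      by (simp add: card_image inj_on_def)
  qed
  have 2: "(\<Sum>(i, j)\<in>S. of_bool (r = j) :: int) = int (card {i. (i, r) \<in> S})"
  proof -
    have "(\<Sum>(i, j)\<in>S. of_bool (r = j) :: int) = int (card {p \<in> S. snd p = r})"
      using assms(1) by (simp add: case_prod_unfold of_bool_def eq_commute[of r] flip: sum.inter_filter)
    also have "{p \<in> S. snd p = r} = (\<lambda>i. (i, r)) ` {i. (i, r) \<in> S}"
      by auto
    finally show ?thesis
      by (simp add: card_image inj_on_def)
  qed
  have "add_roots S \<gamma> ! r = \<gamma> ! r + ((\<Sum>(i, j)\<in>S. of_bool (r = i)) - (\<Sum>(i, j)\<in>S. of_bool (r = j)))"
    using assms(2) by (simp add: nth_raise case_prod_unfold sum_subtractf)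
  then show ?thesis
    unfolding 1 2 by simp
qed

lemma moment_raise:
  assumes "\<Psi> \<subseteq> all_roots (length \<gamma>)"
  shows "moment (raise \<Psi> m \<gamma>) = moment \<gamma> - (\<Sum>(i, j)\<in>\<Psi>. int (m (i, j)) * (int j - int i))"
proof -
  have "moment (raise \<Psi> m \<gamma>) = moment \<gamma>
    + (\<Sum>r<length \<gamma>. \<Sum>(i, j)\<in>\<Psi>. int r * (int (m (i, j)) * (of_bool (r = i) - of_bool (r = j))))"
    by (simp add: moment_def nth_raise distrib_left sum.distrib sum_distrib_left case_prod_unfold)
  also have "(\<Sum>r<length \<gamma>. \<Sum>(i, j)\<in>\<Psi>. int r * (int (m (i, j)) * (of_bool (r = i) - of_bool (r = j))))
    = (\<Sum>p\<in>\<Psi>. \<Sum>r<length \<gamma>. case p of (i, j) \<Rightarrow> int r * (int (m (i, j)) * (of_bool (r = i) - of_bool (r = j))))"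
    by (rule sum.swap)
  also have "\<dots> = (\<Sum>p\<in>\<Psi>. case p of (i, j) \<Rightarrow> - (int (m (i, j)) * (int j - int i)))"
  proof (rule sum.cong[OF refl])
    fix p assume "p \<in> \<Psi>"
    then obtain i j where p: "p = (i, j)" "i < j" "j < length \<gamma>"
      using assms by (auto simp: all_roots_def)
    have "(\<Sum>r<length \<gamma>. int r * (int (m (i, j)) * (of_bool (r = i) - of_bool (r = j))))
      = (\<Sum>r<length \<gamma>. (if r = i then int r * int (m (i, j)) else 0) - (if r = j then int r * int (m (i, j)) else 0))"
      by (rule sum.cong) auto
    also have "\<dots> = - (int (m (i, j)) * (int j - int i))"
      using p by (simp add: sum_subtractf algebra_simps)
    finally show "(\<Sum>r<length \<gamma>. case p of (i, j) \<Rightarrow> int r * (int (m (i, j)) * (of_bool (r = i) - of_bool (r = j))))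
      = (case p of (i, j) \<Rightarrow> - (int (m (i, j)) * (int j - int i)))"
      using p by simp
  qed
  finally show ?thesis
    by (simp add: case_prod_unfold sum_negf)
qed

lemma moment_add_roots_less:
  assumes "S \<subseteq> all_roots (length \<gamma>)" "S \<noteq> {}"
  shows "moment (add_roots S \<gamma>) < moment \<gamma>"
proof -
  have "0 < (\<Sum>(i, j)\<in>S. int j - int i)"
    using assms finite_roots[OF assms(1)] by (intro sum_pos) (auto simp: all_roots_def)
  then show ?thesis
    using moment_raise[OF assms(1), of "\<lambda>_. 1"] by (simp add: case_prod_unfold)
qed

lemma add_roots_insert:
  assumes "insert \<beta> S \<subseteq> all_roots (length \<gamma>)" "\<beta> \<notin> S"
  shows "add_roots S (add_root \<beta> \<gamma>) = add_roots (insert \<beta> S) \<gamma>"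
proof (rule nth_equalityI)
  fix r assume "r < length (add_roots S (add_root \<beta> \<gamma>))"
  then have r: "r < length \<gamma>"
    by simp
  have "finite S"
    using finite_roots[OF assms(1)] by simp
  then show "add_roots S (add_root \<beta> \<gamma>) ! r = add_roots (insert \<beta> S) \<gamma> ! r"
    using r assms nth_add_root[of \<beta> \<gamma> r] by (cases \<beta>) (simp add: nth_raise)
qed simp

text \<open>Membership in a span suffices below, so the coefficients, signed powers of
  \<open>t\<close>, are not tracked. Splitting off the leading term leaves nonempty
  \<open>S\<close>, and this strictness drives the later inductions.\<close>

lemma catalan_diff_expand:
  assumes "finite T" "T \<subseteq> \<Psi>" "\<Psi> \<subseteq> all_roots (length \<gamma>)"
  shows "catalan (\<Psi> - T) \<gamma> - catalan \<Psi> \<gamma> \<in> Sym.span {catalan \<Psi> (add_roots S \<gamma>) |S. S \<subseteq> T \<and> S \<noteq> {}}"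
  using assms
proof (induction T arbitrary: \<gamma>)
  case (insert \<beta> T)
  let ?\<gamma>' = "add_root \<beta> \<gamma>"
  let ?W = "Sym.span {catalan \<Psi> (add_roots S \<gamma>) |S. S \<subseteq> insert \<beta> T \<and> S \<noteq> {}}"
  have rem: "catalan (\<Psi> - insert \<beta> T) \<gamma> = catalan (\<Psi> - T) \<gamma> - tvar *\<^sub>t catalan (\<Psi> - T) ?\<gamma>'"
  proof -
    have "\<Psi> - T \<subseteq> all_roots (length \<gamma>)" "\<beta> \<in> \<Psi> - T"
      using insert.hyps insert.prems by auto
    from catalan_remove_root[OF this] show ?thesis
      by (simp only: Diff_insert[of \<Psi> \<beta> T])
  qed
  have 1: "catalan (\<Psi> - T) \<gamma> - catalan \<Psi> \<gamma> \<in> ?W"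
  proof -
    have "{catalan \<Psi> (add_roots S \<gamma>) |S. S \<subseteq> T \<and> S \<noteq> {}} \<subseteq> {catalan \<Psi> (add_roots S \<gamma>) |S. S \<subseteq> insert \<beta> T \<and> S \<noteq> {}}"
      by blast
    from subsetD[OF Sym.span_mono[OF this] insert.IH[of \<gamma>]] show ?thesis
      using insert.prems by simp
  qed
  have add: "add_roots S ?\<gamma>' = add_roots (insert \<beta> S) \<gamma>" if "S \<subseteq> T" for S
    using that insert.hyps insert.prems by (intro add_roots_insert) auto
  have 2: "catalan (\<Psi> - T) ?\<gamma>' - catalan \<Psi> ?\<gamma>' \<in> ?W"
  proof -
    have "{catalan \<Psi> (add_roots S ?\<gamma>') |S. S \<subseteq> T \<and> S \<noteq> {}} \<subseteq> {catalan \<Psi> (add_roots S \<gamma>) |S. S \<subseteq> insert \<beta> T \<and> S \<noteq> {}}"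
    proof clarify
      fix S assume "S \<subseteq> T" "S \<noteq> {}"
      with add[OF this(1)] show "\<exists>S'. catalan \<Psi> (add_roots S ?\<gamma>') = catalan \<Psi> (add_roots S' \<gamma>) \<and> S' \<subseteq> insert \<beta> T \<and> S' \<noteq> {}"
        by (intro exI[of _ "insert \<beta> S"]) auto
    qed
    from subsetD[OF Sym.span_mono[OF this] insert.IH[of ?\<gamma>']] show ?thesis
      using insert.prems by simp
  qed
  have "add_roots {} ?\<gamma>' = ?\<gamma>'"
    by (rule nth_equalityI) (auto simp: nth_raise)
  then have "catalan \<Psi> ?\<gamma>' = catalan \<Psi> (add_roots {\<beta>} \<gamma>)"
    using add[of "{}"] by simp
  then have 3: "catalan \<Psi> ?\<gamma>' \<in> ?W"
    by (auto intro!: Sym.span_base)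
  have "catalan (\<Psi> - insert \<beta> T) \<gamma> - catalan \<Psi> \<gamma> = (catalan (\<Psi> - T) \<gamma> - catalan \<Psi> \<gamma>)
    - tvar *\<^sub>t (catalan (\<Psi> - T) ?\<gamma>' - catalan \<Psi> ?\<gamma>') - tvar *\<^sub>t catalan \<Psi> ?\<gamma>'"
    by (simp add: rem Sym.scale_right_diff_distrib)
  moreover have "\<dots> \<in> ?W"
    by (intro Sym.span_diff[of "_ - _" _ "_ *\<^sub>t _"] Sym.span_diff[of "catalan (\<Psi> - T) \<gamma> - catalan \<Psi> \<gamma>"]
      Sym.span_scale 1 2 3)
  ultimately show ?case
    by (simp only:)
qed (simp add: Sym.span_zero)

lemma catalan_expand:
  assumes "\<Psi>' \<subseteq> \<Psi>" "\<Psi> \<subseteq> all_roots (length \<gamma>)"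
  shows "catalan \<Psi>' \<gamma> - catalan \<Psi> \<gamma> \<in> Sym.span {catalan \<Psi> (add_roots S \<gamma>) |S. S \<subseteq> \<Psi> - \<Psi>' \<and> S \<noteq> {}}"
proof -
  have "\<Psi> - (\<Psi> - \<Psi>') = \<Psi>'" "finite (\<Psi> - \<Psi>')"
    using assms finite_roots[OF assms(2)] by auto
  then show ?thesis
    using catalan_diff_expand[of "\<Psi> - \<Psi>'" \<Psi> \<gamma>] assms by auto
qed

lemma kschur_roots_subset: "kschur_roots k \<mu> \<subseteq> all_roots (length \<mu>)"
  by (auto simp: kschur_roots_def)

text \<open>The roots come from \<open>\<eta> @ \<tau>\<close>, while the weight
  \<open>\<eta>' @ \<tau>'\<close> may differ. With \<open>r = length \<eta>\<close>, the second
  assumption on the rows keeps \<open>k\<close>-Schur roots out of the head. Row \<open>p\<close>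
  misses the columns from \<open>r\<close> to at most \<open>k - \<eta>\<^sub>p + p\<close>; column
  \<open>r + q\<close> misses only rows \<open>i \<ge> r + q - (k - c)\<close>, as
  \<open>\<eta>\<^sub>i \<ge> c\<close>. Counting gives the two bounds. Each added root moves one
  unit from the tail into the head, hence the strict growth of the sum.\<close>

lemma kschur_block_expand:
  fixes c :: int
  assumes len: "length \<eta>' = length \<eta>" "length \<tau>' = length \<tau>"
    and rows: "\<And>p. p < length \<eta> \<Longrightarrow> c \<le> \<eta> ! p"
      "\<And>p. p < length \<eta> \<Longrightarrow> \<eta> ! p \<le> int k - (int (length \<eta>) - 1) + int p"
  shows "catalan (kschur_roots k (\<eta> @ \<tau>)) (\<eta>' @ \<tau>') - Bvec \<eta>' (catalan (kschur_roots k \<tau>) \<tau>')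
    \<in> Sym.span {Bvec \<nu> (catalan (kschur_roots k \<tau>) \<sigma>) |\<nu> \<sigma>. length \<nu> = length \<eta> \<and> length \<sigma> = length \<tau> \<and>
      (\<forall>p<length \<eta>. \<eta>' ! p \<le> \<nu> ! p \<and>
        \<nu> ! p \<le> \<eta>' ! p + (int k - \<eta> ! p + int p - (int (length \<eta>) - 1))) \<and>
      (\<forall>q<length \<tau>. \<sigma> ! q \<le> \<tau>' ! q \<and> \<tau>' ! q - max 0 (int k - c - int q) \<le> \<sigma> ! q) \<and>
      sum_list \<eta>' < sum_list \<nu>}" (is "_ \<in> Sym.span ?W")
proof -
  define r where "r = length \<eta>"
  define l where "l = length \<tau>"
  define \<Psi>' where "\<Psi>' = kschur_roots k (\<eta> @ \<tau>)"
  define \<Psi> where "\<Psi> = block_roots r l \<union> shift_roots r (kschur_roots k \<tau>)"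
  have \<Psi>: "\<Psi> \<subseteq> all_roots (r + l)"
    using shift_roots_subset[OF kschur_roots_subset[of k \<tau>], of r]
    by (auto simp: \<Psi>_def l_def block_roots_def all_roots_def)
  have sh: "(i, j) \<in> shift_roots r (kschur_roots k \<tau>) \<longleftrightarrow> r \<le> i \<and> i < j \<and> j < r + l \<and> int k - \<tau> ! (i - r) + int i < int j" for i j
  proof
    assume "r \<le> i \<and> i < j \<and> j < r + l \<and> int k - \<tau> ! (i - r) + int i < int j"
    then have "(i - r, j - r) \<in> kschur_roots k \<tau>" "(i, j) = map_prod ((+) r) ((+) r) (i - r, j - r)"
      by (auto simp: kschur_roots_def all_roots_def l_def of_nat_diff)
    then show "(i, j) \<in> shift_roots r (kschur_roots k \<tau>)"
      unfolding shift_roots_def by (rule image_eqI[rotated])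
  qed (auto simp: shift_roots_def kschur_roots_def all_roots_def l_def)
  have \<Psi>'_iff: "(i, j) \<in> \<Psi>' \<longleftrightarrow> i < j \<and> j < r + l \<and> int k - (if i < r then \<eta> ! i else \<tau> ! (i - r)) + int i < int j" for i j
    by (auto simp: \<Psi>'_def kschur_roots_def all_roots_def r_def l_def nth_append)
  have sub: "\<Psi>' \<subseteq> \<Psi>"
  proof
    fix p assume p: "p \<in> \<Psi>'"
    obtain i j where ij: "p = (i, j)"
      by (cases p)
    show "p \<in> \<Psi>"
    proof (cases "i < r")
      case True
      then have "int r - 1 < int j"
        using p ij rows(2)[of i] by (auto simp: \<Psi>'_iff r_def)
      then show ?thesis
        using p True by (auto simp: ij \<Psi>_def \<Psi>'_iff block_roots_def)
    next
      case False
      then show ?thesis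
        using p by (auto simp: ij \<Psi>_def \<Psi>'_iff sh)
    qed
  qed
  have diff: "\<Psi> - \<Psi>' \<subseteq> {(i, j). i < r \<and> r \<le> j \<and> j < r + l \<and> int j \<le> int k - \<eta> ! i + int i}"
    by (auto simp: \<Psi>_def \<Psi>'_iff block_roots_def sh)
  have cat: "catalan \<Psi> \<gamma> = Bvec (take r \<gamma>) (catalan (kschur_roots k \<tau>) (drop r \<gamma>))" if "length \<gamma> = r + l" for \<gamma>
    using Bvec_catalan[of "kschur_roots k \<tau>" "drop r \<gamma>" "take r \<gamma>"] kschur_roots_subset[of k \<tau>] that
    by (simp add: \<Psi>_def l_def)
  have "catalan \<Psi>' (\<eta>' @ \<tau>') - catalan \<Psi> (\<eta>' @ \<tau>')
    \<in> Sym.span {catalan \<Psi> (add_roots S (\<eta>' @ \<tau>')) |S. S \<subseteq> \<Psi> - \<Psi>' \<and> S \<noteq> {}}"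
    using \<Psi> len by (intro catalan_expand[OF sub]) (simp add: r_def l_def)
  moreover have "{catalan \<Psi> (add_roots S (\<eta>' @ \<tau>')) |S. S \<subseteq> \<Psi> - \<Psi>' \<and> S \<noteq> {}} \<subseteq> ?W"
  proof clarify
    fix S assume S: "S \<subseteq> \<Psi> - \<Psi>'" "S \<noteq> {}"
    define \<delta> where "\<delta> = add_roots S (\<eta>' @ \<tau>')"
    have len\<delta>: "length \<delta> = r + l"
      using len by (simp add: \<delta>_def r_def l_def)
    have Sall: "S \<subseteq> all_roots (r + l)"
      using S \<Psi> by auto
    have fin: "finite S"
      by (rule finite_roots[OF Sall])
    have Smem: "i < r \<and> r \<le> j \<and> j < r + l \<and> int j \<le> int k - \<eta> ! i + int i" if "(i, j) \<in> S" for i j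
      using that S diff by auto
    have row: "take r \<delta> ! p = \<eta>' ! p + int (card {j. (p, j) \<in> S})" if "p < r" for p
    proof -
      have "{i. (i, p) \<in> S} = {}"
        using Smem that by fastforce
      then show ?thesis
        using nth_add_roots[OF fin, of p "\<eta>' @ \<tau>'"] that len by (simp add: \<delta>_def nth_append r_def)
    qed
    have col: "drop r \<delta> ! q = \<tau>' ! q - int (card {i. (i, r + q) \<in> S})" if "q < l" for q
    proof -
      have "{j. (r + q, j) \<in> S} = {}"
        using Smem by fastforce
      then show ?thesis
        using nth_add_roots[OF fin, of "r + q" "\<eta>' @ \<tau>'"] that len len\<delta>
        by (simp add: \<delta>_def nth_append r_def l_def)
    qed
    have rowle: "int (card {j. (p, j) \<in> S}) \<le> int k - \<eta> ! p + int p - (int r - 1)" if "p < r" for p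
    proof -
      define N where "N = nat (int k - \<eta> ! p + int p + 1)"
      have N: "int N = int k - \<eta> ! p + int p + 1" "r \<le> N"
        using rows(2)[of p] that by (auto simp: N_def r_def)
      have "{j. (p, j) \<in> S} \<subseteq> {r..<N}"
        using Smem[of p] N by fastforce
      then have "card {j. (p, j) \<in> S} \<le> card {r..<N}"
        by (intro card_mono) auto
      then show ?thesis
        using N by simp
    qed
    have colle: "int (card {i. (i, r + q) \<in> S}) \<le> max 0 (int k - c - int q)" for q
    proof -
      define N where "N = nat (int r + int q - (int k - c))"
      have "{i. (i, r + q) \<in> S} \<subseteq> {N..<r}"
      proof
        fix i assume "i \<in> {i. (i, r + q) \<in> S}"
        then show "i \<in> {N..<r}"
          using Smem[of i "r + q"] rows(1)[of i] by (auto simp: N_def r_def)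
      qed
      then have "card {i. (i, r + q) \<in> S} \<le> card {N..<r}"
        by (intro card_mono) auto
      then show ?thesis
        by (simp add: N_def)
    qed
    have sum: "sum_list \<eta>' < sum_list (take r \<delta>)"
    proof -
      obtain p j where pj: "(p, j) \<in> S"
        using S by auto
      have "(\<Sum>p = 0..<r. \<eta>' ! p) < (\<Sum>p = 0..<r. take r \<delta> ! p)"
      proof (rule sum_strict_mono_ex1)
        have "finite {j. (p, j) \<in> S}"
          by (rule finite_subset[of _ "snd ` S"]) (use fin in \<open>force+\<close>)
        then have "0 < card {j. (p, j) \<in> S}"
          using pj by (auto simp: card_gt_0_iff)
        then show "\<exists>p\<in>{0..<r}. \<eta>' ! p < take r \<delta> ! p"
          using Smem[OF pj] row[of p] by (intro bexI[of _ p]) auto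
      qed (use row in auto)
      then show ?thesis
        using len len\<delta> by (simp add: sum_list_sum_nth r_def)
    qed
    show "\<exists>\<nu> \<sigma>. catalan \<Psi> \<delta> = Bvec \<nu> (catalan (kschur_roots k \<tau>) \<sigma>) \<and>
      length \<nu> = length \<eta> \<and> length \<sigma> = length \<tau> \<and>
      (\<forall>p<length \<eta>. \<eta>' ! p \<le> \<nu> ! p \<and>
        \<nu> ! p \<le> \<eta>' ! p + (int k - \<eta> ! p + int p - (int (length \<eta>) - 1))) \<and>
      (\<forall>q<length \<tau>. \<sigma> ! q \<le> \<tau>' ! q \<and> \<tau>' ! q - max 0 (int k - c - int q) \<le> \<sigma> ! q) \<and>
      sum_list \<eta>' < sum_list \<nu>"
    proof (intro exI conjI allI impI)
      show "catalan \<Psi> \<delta> = Bvec (take r \<delta>) (catalan (kschur_roots k \<tau>) (drop r \<delta>))"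
        by (rule cat[OF len\<delta>])
      fix p assume "p < length \<eta>"
      then have "p < r"
        by (simp add: r_def)
      then show "\<eta>' ! p \<le> take r \<delta> ! p"
        "take r \<delta> ! p \<le> \<eta>' ! p + (int k - \<eta> ! p + int p - (int (length \<eta>) - 1))"
        using row[of p] rowle[of p] by (simp_all add: r_def)
    next
      fix q assume "q < length \<tau>"
      then have "q < l"
        by (simp add: l_def)
      then show "drop r \<delta> ! q \<le> \<tau>' ! q" "\<tau>' ! q - max 0 (int k - c - int q) \<le> drop r \<delta> ! q"
        using col[of q] colle[of q] by simp_all
    qed (use len\<delta> sum in \<open>simp_all add: r_def l_def\<close>)
  qed
  ultimately have "catalan \<Psi>' (\<eta>' @ \<tau>') - catalan \<Psi> (\<eta>' @ \<tau>') \<in> Sym.span ?W"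
    using Sym.span_mono by blast
  then show ?thesis
    using cat[of "\<eta>' @ \<tau>'"] len by (simp add: \<Psi>'_def r_def l_def)
qed

text \<open>The set \<open>Par\<^sup>k\<^sub>n\<close>. Trailing zeros are kept, since raising and
  straightening preserve the length of a list but not its number of nonzero parts.\<close>

definition kbounded :: "nat \<Rightarrow> nat \<Rightarrow> int list set"
  where "kbounded k n = {\<mu>. length \<mu> = n \<and> sorted_wrt (\<ge>) \<mu> \<and> (\<forall>a\<in>set \<mu>. 0 \<le> a \<and> a \<le> int k)}"

lemma span_Bvec:
  assumes "f \<in> Sym.span F" "\<And>g. g \<in> F \<Longrightarrow> Bvec \<nu> g \<in> Sym.span V"
  shows "Bvec \<nu> f \<in> Sym.span V"
  using assms(1)
  by (induction rule: Sym.span_induct_alt)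
    (use assms(2) in \<open>auto simp: Bvec_add Bvec_tscale Sym.span_zero intro!: Sym.span_add Sym.span_scale\<close>)

lemma span_Bvec_sort:
  assumes "f \<in> Sym.span F"
    "\<And>\<kappa> g. length \<kappa> = length \<nu> \<Longrightarrow> sorted_wrt (\<ge>) \<kappa> \<Longrightarrow> mset (beta_list \<kappa>) = mset (beta_list \<nu>)
      \<Longrightarrow> g \<in> F \<Longrightarrow> Bvec \<kappa> g \<in> Sym.span V"
  shows "Bvec \<nu> f \<in> Sym.span V"
proof (rule span_Bvec[OF assms(1)])
  fix g assume g: "g \<in> F"
  show "Bvec \<nu> g \<in> Sym.span V"
  proof (rule antisym_sort[of "length \<nu>" "\<lambda>\<nu>. Bvec \<nu> g" \<nu>])
    fix \<kappa>
    assume \<kappa>: "length \<kappa> = length \<nu>" "sorted_wrt (\<ge>) \<kappa>" "mset (beta_list \<kappa>) = mset (beta_list \<nu>)"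
      "Bvec \<nu> g = Bvec \<kappa> g \<or> Bvec \<nu> g = - Bvec \<kappa> g"
    have "Bvec \<kappa> g \<in> Sym.span V"
      by (rule assms(2)[OF \<kappa>(1-3) g])
    then show ?thesis
      using \<kappa>(4) by (auto intro: Sym.span_neg)
  qed (use Bvec_dot_swap in \<open>auto simp: Sym.span_zero\<close>)
qed

text \<open>The way bounds survive sorting: a bound on all \<open>\<nu>\<^sub>q - q\<close> also
  holds for every \<open>\<kappa>\<^sub>p - p\<close>. At \<open>p = 0\<close> it controls the
  largest entry of a decreasing \<open>\<kappa>\<close>, at the last position the smallest.\<close>

lemma beta_list_boundsD:
  assumes "mset (beta_list \<kappa>) = mset (beta_list \<nu>)" "p < length \<kappa>"
  obtains q where "q < length \<nu>" "\<kappa> ! p - int p = \<nu> ! q - int q"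
proof -
  have "beta_list \<kappa> ! p \<in> set (beta_list \<kappa>)"
    using assms(2) by (intro nth_mem) simp
  then have "beta_list \<kappa> ! p \<in> set (beta_list \<nu>)"
    using mset_eq_setD[OF assms(1)] by simp
  then obtain q where "q < length \<nu>" "beta_list \<kappa> ! p = beta_list \<nu> ! q"
    by (auto simp: in_set_conv_nth)
  then show ?thesis
    using that assms(2) by simp
qed

lemma sum_list_beta_list: "sum_list (beta_list \<gamma>) = sum_list \<gamma> - (\<Sum>p<length \<gamma>. int p)"
  by (simp add: sum_list_sum_nth sum_subtractf atLeast0LessThan)

lemma sum_list_eq_of_beta_list:
  assumes "mset (beta_list \<kappa>) = mset (beta_list \<nu>)"
  shows "sum_list \<kappa> = sum_list \<nu>"
proof -
  have "length \<kappa> = length \<nu>"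
    using mset_eq_length[OF assms] by simp
  moreover have "sum_list (beta_list \<kappa>) = sum_list (beta_list \<nu>)"
    using assms by (metis sum_mset_sum_list)
  ultimately show ?thesis
    by (simp add: sum_list_beta_list)
qed

lemma decreasing_nth:
  fixes \<mu> :: "int list"
  assumes "sorted_wrt (\<ge>) \<mu>" "i \<le> j" "j < length \<mu>"
  shows "\<mu> ! j \<le> \<mu> ! i"
  using assms sorted_wrt_nth_less[OF assms(1), of i j] by (cases "i = j") auto

lemma span_subset_span: "S \<subseteq> Sym.span T \<Longrightarrow> Sym.span S \<subseteq> Sym.span T"
  by (intro Sym.span_minimal Sym.subspace_span)

lemma kboundedD:
  assumes "\<mu> \<in> kbounded k n"
  shows "length \<mu> = n" "sorted_wrt (\<ge>) \<mu>" "\<And>p. p < n \<Longrightarrow> 0 \<le> \<mu> ! p" "\<And>p. p < n \<Longrightarrow> \<mu> ! p \<le> int k"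
  using assms by (auto simp: kbounded_def)

lemma kboundedI:
  assumes "length \<mu> = n" "sorted_wrt (\<ge>) \<mu>" "\<And>p. p < n \<Longrightarrow> 0 \<le> \<mu> ! p" "\<And>p. p < n \<Longrightarrow> \<mu> ! p \<le> int k"
  shows "\<mu> \<in> kbounded k n"
  using assms by (auto simp: kbounded_def in_set_conv_nth)

lemma first_part_nth: "0 < length \<mu> \<Longrightarrow> first_part \<mu> = \<mu> ! 0"
  by (cases \<mu>) (auto simp: first_part_def)

lemma kbounded_drop: "\<mu> \<in> kbounded k n \<Longrightarrow> drop r \<mu> \<in> kbounded k (n - r)"
  by (auto simp: kbounded_def sorted_wrt_drop dest: in_set_dropD)

lemma kbounded_append:
  assumes "sorted_wrt (\<ge>) \<nu>" "\<nu> \<noteq> []" "\<nu> ! 0 \<le> int k" "\<tau> \<in> kbounded k l" "0 \<le> c" "first_part \<tau> \<le> c"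
    "\<And>p. p < length \<nu> \<Longrightarrow> c \<le> \<nu> ! p"
  shows "\<nu> @ \<tau> \<in> kbounded k (length \<nu> + l)"
proof -
  have le: "b \<le> c" if "b \<in> set \<tau>" for b
  proof -
    obtain q where "q < length \<tau>" "b = \<tau> ! q"
      using \<open>b \<in> set \<tau>\<close> by (auto simp: in_set_conv_nth)
    then have "b \<le> \<tau> ! 0" "0 < length \<tau>"
      using decreasing_nth[of \<tau> 0 q] assms(4) by (auto simp: kbounded_def)
    then show ?thesis
      using assms(6) first_part_nth[of \<tau>] by simp
  qed
  have ge: "c \<le> a" "a \<le> int k" if "a \<in> set \<nu>" for a
  proof -
    obtain q where q: "q < length \<nu>" "a = \<nu> ! q"
      using \<open>a \<in> set \<nu>\<close> by (auto simp: in_set_conv_nth)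
    then show "c \<le> a" "a \<le> int k"
      using decreasing_nth[of \<nu> 0 q] assms by auto
  qed
  show ?thesis
    using assms(1,4,5) ge le by (force simp: kbounded_def sorted_wrt_append)
qed

lemma kschur_no_roots:
  assumes "\<mu> \<in> kbounded k n" "0 < n \<Longrightarrow> int n \<le> int k - \<mu> ! 0 + 1"
  shows "kschur_roots k \<mu> = {}"
proof -
  note \<mu> = kboundedD[OF assms(1)]
  have False if "(i, j) \<in> kschur_roots k \<mu>" for i j
  proof -
    have "i < j" "j < n" "int k - \<mu> ! i + int i < int j"
      using that \<mu>(1) by (auto simp: kschur_roots_def all_roots_def)
    moreover have "\<mu> ! i \<le> \<mu> ! 0"
      using decreasing_nth[OF \<mu>(2), of 0 i] \<mu>(1) calculation by simp
    ultimately show False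
      using assms(2) by simp
  qed
  then show ?thesis
    by auto
qed

definition kschur_span :: "nat \<Rightarrow> nat \<Rightarrow> int \<Rightarrow> sym set"
  where "kschur_span k n a = Sym.span (kschur k ` {\<mu> \<in> kbounded k n. first_part \<mu> \<le> a})"

lemma kschur_span_mono: "a \<le> b \<Longrightarrow> kschur_span k n a \<subseteq> kschur_span k n b"
  unfolding kschur_span_def by (intro Sym.span_mono) auto

text \<open>
  The staircase bound: with \<open>m = k - \<mu>\<^sub>1\<close>, entry \<open>p\<close> (counted from 0) is lowered by at most \<open>m - p\<close>.
  Column \<open>q\<close> of the tail of \<open>\<mu>\<close> misses at most \<open>m' - q\<close> roots, where \<open>m'\<close> belongs to the tail, which
  is why the bound passes to the tail.
\<close>

definition lowered :: "nat \<Rightarrow> int list \<Rightarrow> int list \<Rightarrow> bool"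
  where "lowered k \<mu> \<gamma> \<longleftrightarrow> length \<gamma> = length \<mu> \<and>
    (\<forall>p<length \<mu>. \<gamma> ! p \<le> \<mu> ! p \<and> \<mu> ! p - max 0 (int k - first_part \<mu> - int p) \<le> \<gamma> ! p)"

text \<open>
  The expansion of \<open>kschur k (\<nu> @ \<tau>)\<close> has leading term \<open>Bvec \<nu> (kschur k \<tau>)\<close>, and all other heads have
  a larger sum; hence the induction on \<open>sum_list \<nu>\<close>.
\<close>

lemma Bvec_kschur_in_span:
  fixes c a :: int
  assumes IH: "\<And>\<tau> \<sigma>. \<tau> \<in> kbounded k l \<Longrightarrow> lowered k \<tau> \<sigma> \<Longrightarrow>
      catalan (kschur_roots k \<tau>) \<sigma> \<in> kschur_span k l (first_part \<tau>)"
    and r: "int r = int k - a + 1" "0 < r" and c: "0 \<le> c" "c \<le> a" "a \<le> int k"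
    and \<nu>: "length \<nu> = r" "sorted_wrt (\<ge>) \<nu>" "\<nu> ! 0 \<le> a" "\<And>p. p < r \<Longrightarrow> c \<le> \<nu> ! p"
    and \<tau>: "\<tau> \<in> kbounded k l" "first_part \<tau> \<le> c" and l: "0 < l"
  shows "Bvec \<nu> (kschur k \<tau>) \<in> kschur_span k (r + l) a"
  using \<nu> \<tau>
\<comment> \<open>\<open>r * a\<close> is the largest sum that a head with entries at most
  \<open>a\<close> can have.\<close>
proof (induction "nat (int r * a - sum_list \<nu>)" arbitrary: \<nu> \<tau> rule: less_induct)
  case (less \<nu> \<tau>)
  note \<nu> = less.prems(1-4) and \<tau> = less.prems(5,6)
  have len\<tau>: "length \<tau> = l"
    using \<tau>(1) by (simp add: kbounded_def)
  have \<nu>le: "\<nu> ! p \<le> a" if "p < r" for p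
    using decreasing_nth[OF \<nu>(2), of 0 p] \<nu> that by simp
  have mem: "\<nu> @ \<tau> \<in> kbounded k (r + l)"
  proof -
    have "\<nu> \<noteq> []" "\<nu> ! 0 \<le> int k"
      using \<nu>(1,3) r(2) c(3) by auto
    from kbounded_append[OF \<nu>(2) this \<tau>(1) c(1) \<tau>(2)] show ?thesis
      using \<nu>(1,4) by simp
  qed
  have "first_part (\<nu> @ \<tau>) \<le> a"
    using \<nu> r first_part_nth[of "\<nu> @ \<tau>"] by (simp add: nth_append)
  then have K: "kschur k (\<nu> @ \<tau>) \<in> kschur_span k (r + l) a"
    unfolding kschur_span_def by (intro Sym.span_base imageI) (use mem in simp)
  have rl: "r = length \<nu>" "l = length \<tau>"
    using \<nu>(1) len\<tau> by simp_all
  have "kschur k (\<nu> @ \<tau>) - Bvec \<nu> (kschur k \<tau>) \<in> Sym.span {Bvec \<nu>' (catalan (kschur_roots k \<tau>) \<sigma>) |\<nu>' \<sigma>.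
      length \<nu>' = length \<nu> \<and> length \<sigma> = length \<tau> \<and>
      (\<forall>p<length \<nu>. \<nu> ! p \<le> \<nu>' ! p \<and> \<nu>' ! p \<le> \<nu> ! p + (int k - \<nu> ! p + int p - (int (length \<nu>) - 1))) \<and>
      (\<forall>q<length \<tau>. \<sigma> ! q \<le> \<tau> ! q \<and> \<tau> ! q - max 0 (int k - c - int q) \<le> \<sigma> ! q) \<and> sum_list \<nu> < sum_list \<nu>'}"
    (is "_ \<in> Sym.span ?E")
    unfolding kschur_def
  proof (rule kschur_block_expand)
    fix p assume "p < length \<nu>"
    then show "c \<le> \<nu> ! p" "\<nu> ! p \<le> int k - (int (length \<nu>) - 1) + int p"
      using \<nu> \<nu>le[of p] r by auto
  qed simp_all
  moreover have "Sym.span ?E \<subseteq> kschur_span k (r + l) a"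
  proof -
    have "?E \<subseteq> kschur_span k (r + l) a"
    proof clarify
      fix \<nu>' \<sigma>
      assume A: "length \<nu>' = length \<nu>" "length \<sigma> = length \<tau>"
        "\<forall>p<length \<nu>. \<nu> ! p \<le> \<nu>' ! p \<and> \<nu>' ! p \<le> \<nu> ! p + (int k - \<nu> ! p + int p - (int (length \<nu>) - 1))"
        "\<forall>q<length \<tau>. \<sigma> ! q \<le> \<tau> ! q \<and> \<tau> ! q - max 0 (int k - c - int q) \<le> \<sigma> ! q"
        "sum_list \<nu> < sum_list \<nu>'"
      have "lowered k \<tau> \<sigma>"
        unfolding lowered_def
      proof (intro conjI allI impI)
        fix p assume p: "p < length \<tau>"
        have "max 0 (int k - c - int p) \<le> max 0 (int k - first_part \<tau> - int p)"
          using \<tau>(2) by simp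
        then show "\<sigma> ! p \<le> \<tau> ! p" "\<tau> ! p - max 0 (int k - first_part \<tau> - int p) \<le> \<sigma> ! p"
          using A(4) p by fastforce+
      qed (use A in simp)
      from IH[OF \<tau>(1) this] have cat: "catalan (kschur_roots k \<tau>) \<sigma> \<in> kschur_span k l c"
        using kschur_span_mono[OF \<tau>(2)] by blast
      show "Bvec \<nu>' (catalan (kschur_roots k \<tau>) \<sigma>) \<in> kschur_span k (r + l) a"
        unfolding kschur_span_def[of k "r + l"]
      proof (rule span_Bvec_sort[OF cat[unfolded kschur_span_def]])
        fix \<kappa> g
        assume \<kappa>: "length \<kappa> = length \<nu>'" "sorted_wrt (\<ge>) \<kappa>" "mset (beta_list \<kappa>) = mset (beta_list \<nu>')"
          and g: "g \<in> kschur k ` {\<mu> \<in> kbounded k l. first_part \<mu> \<le> c}"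
        then obtain \<tau>' where \<tau>': "\<tau>' \<in> kbounded k l" "first_part \<tau>' \<le> c" "g = kschur k \<tau>'"
          by auto
        have len: "length \<kappa> = r"
          using \<kappa> A \<nu> by simp
        \<comment> \<open>As \<open>r - 1 = k - a\<close>, the row bound collapses to
          \<open>\<nu>'\<^sub>q \<le> a + q\<close>, whatever \<open>\<nu>\<^sub>q\<close> was; the
          lower bound combines \<open>c \<le> \<nu>'\<^sub>q\<close> with
          \<open>q \<le> r - 1\<close>.\<close>
        have bnd: "c - (int r - 1) \<le> \<nu>' ! q - int q \<and> \<nu>' ! q - int q \<le> a" if "q < length \<nu>'" for q
        proof -
          have q: "q < r" "q < length \<nu>"
            using that A(1) \<nu>(1) by simp_all
          then have "\<nu> ! q \<le> \<nu>' ! q" "\<nu>' ! q \<le> \<nu> ! q + (int k - \<nu> ! q + int q - (int (length \<nu>) - 1))"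
            using A(3) by blast+
          then show ?thesis
            using \<nu>(1) \<nu>(4)[OF q(1)] q(1) r(1) by linarith
        qed
        have "\<kappa> ! 0 \<le> a"
        proof -
          obtain q where "q < length \<nu>'" "\<kappa> ! 0 - int 0 = \<nu>' ! q - int q"
            using beta_list_boundsD[OF \<kappa>(3), of 0] len r by auto
          then show ?thesis
            using bnd[of q] by simp
        qed
        moreover have "c \<le> \<kappa> ! p" if "p < r" for p
        proof -
          obtain q where "q < length \<nu>'" "\<kappa> ! (r - 1) - int (r - 1) = \<nu>' ! q - int q"
            using beta_list_boundsD[OF \<kappa>(3), of "r - 1"] len r by auto
          then have "c \<le> \<kappa> ! (r - 1)"
            using bnd[of q] r(2) by (simp add: of_nat_diff)
          moreover have "p \<le> r - 1" "r - 1 < length \<kappa>"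
            using that len by simp_all
          ultimately show ?thesis
            using decreasing_nth[OF \<kappa>(2)] order_trans by blast
        qed
        moreover have "nat (int r * a - sum_list \<kappa>) < nat (int r * a - sum_list \<nu>)"
        proof -
          have "sum_list \<nu> < sum_list \<kappa>"
            using A(5) sum_list_eq_of_beta_list[OF \<kappa>(3)] by simp
          moreover have "sum_list \<kappa> \<le> int r * a"
          proof -
            have "\<kappa> ! p \<le> a" if "p < r" for p
              using decreasing_nth[OF \<kappa>(2), of 0 p] \<open>\<kappa> ! 0 \<le> a\<close> len that by simp
            then have "(\<Sum>p = 0..<r. \<kappa> ! p) \<le> (\<Sum>p = 0..<r. a)"
              by (intro sum_mono) simp
            then show ?thesis
              by (simp add: sum_list_sum_nth len)
          qed
          ultimately show ?thesis
            by linarith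
        qed
        ultimately show "Bvec \<kappa> g \<in> Sym.span (kschur k ` {\<mu> \<in> kbounded k (r + l). first_part \<mu> \<le> a})"
          using less.hyps[of \<kappa> \<tau>'] \<kappa>(2) len \<tau>' by (simp add: kschur_span_def)
      qed
    qed
    then show ?thesis
      unfolding kschur_span_def by (rule span_subset_span)
  qed
  ultimately have "kschur k (\<nu> @ \<tau>) - Bvec \<nu> (kschur k \<tau>) \<in> kschur_span k (r + l) a"
    by blast
  from Sym.span_diff[OF K[unfolded kschur_span_def] this[unfolded kschur_span_def]]
  show ?case
    by (simp add: kschur_span_def)
qed

text \<open>Brings a function with the roots of \<open>\<mu>\<close> but a lower weight back to
  \<open>k\<close>-Schur functions. The first part cannot grow because the head entries encountered
  exceed \<open>a\<close> by at most their position, a property that sorting preserves.\<close>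

lemma lowered_catalan:
  assumes "\<mu> \<in> kbounded k n" "lowered k \<mu> \<gamma>"
  shows "catalan (kschur_roots k \<mu>) \<gamma> \<in> kschur_span k n (first_part \<mu>)"
  using assms
proof (induction n arbitrary: \<mu> \<gamma> rule: less_induct)
  case (less n)
  note \<mu> = kboundedD[OF less.prems(1)]
  have len: "length \<gamma> = n"
    using less.prems \<mu>(1) by (simp add: lowered_def)
  have low: "\<gamma> ! p \<le> \<mu> ! p" "\<mu> ! p - max 0 (int k - first_part \<mu> - int p) \<le> \<gamma> ! p" if "p < n" for p
    using less.prems(2) \<mu>(1) that by (auto simp: lowered_def)
  show ?case
  proof (cases "n = 0")
    case True
    then have "\<mu> = []" "\<gamma> = []"
      using \<mu>(1) len by auto
    then show ?thesis
      using less.prems(1) unfolding kschur_span_def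
      by (intro Sym.span_base) (auto simp: kschur_def)
  next
    case n0: False
    define a where "a = first_part \<mu>"
    have a: "a = \<mu> ! 0"
      using n0 \<mu>(1) first_part_nth[of \<mu>] unfolding a_def by simp
    have ak: "0 \<le> a" "a \<le> int k"
      using \<mu>(3,4)[of 0] n0 by (auto simp: a)
    have \<mu>le: "\<mu> ! p \<le> a" if "p < n" for p
      using decreasing_nth[OF \<mu>(2), of 0 p] \<mu>(1) that by (simp add: a)
    define r where "r = nat (int k - a) + 1"
    have r: "int r = int k - a + 1" "0 < r"
      using ak by (simp_all add: r_def)
    show ?thesis
    proof (cases "n \<le> r")
      \<comment> \<open>A single block: a list of this length with first part at most
        \<open>a\<close> has no roots, so only Schur functions occur.\<close>
      case True
      have "kschur_roots k \<mu> = {}"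
        by (rule kschur_no_roots[OF less.prems(1)]) (use True r a in simp)
      then have cat: "catalan (kschur_roots k \<mu>) \<gamma> = schur \<gamma>"
        by (simp add: catalan_empty)
      show ?thesis
        unfolding cat
      proof (rule schur_straighten[of \<gamma>])
        fix \<kappa>
        assume \<kappa>: "length \<kappa> = length \<gamma>" "sorted_wrt (\<ge>) \<kappa>" "\<forall>a\<in>set \<kappa>. 0 \<le> a"
          "mset (beta_list \<kappa>) = mset (beta_list \<gamma>)" "schur \<gamma> = schur \<kappa> \<or> schur \<gamma> = - schur \<kappa>"
        have \<kappa>0: "\<kappa> ! 0 \<le> a"
        proof -
          obtain q where "q < length \<gamma>" "\<kappa> ! 0 - int 0 = \<gamma> ! q - int q"
            using beta_list_boundsD[OF \<kappa>(4), of 0] \<kappa>(1) len n0 by auto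
          then show ?thesis
            using low(1)[of q] \<mu>le[of q] len by simp
        qed
        have kb: "\<kappa> \<in> kbounded k n"
        proof (rule kboundedI)
          fix p assume "p < n"
          then show "\<kappa> ! p \<le> int k"
            using decreasing_nth[OF \<kappa>(2), of 0 p] \<kappa>(1) \<kappa>0 ak len by simp
        qed (use \<kappa> len in auto)
        have "kschur_roots k \<kappa> = {}"
          by (rule kschur_no_roots[OF kb]) (use True r \<kappa>0 in simp)
        then have "schur \<kappa> = kschur k \<kappa>"
          by (simp add: kschur_def catalan_empty)
        moreover have "first_part \<kappa> \<le> first_part \<mu>"
          using \<kappa>0 \<kappa>(1) len n0 first_part_nth[of \<kappa>] by (simp add: a_def)
        ultimately have "schur \<kappa> \<in> kschur_span k n (first_part \<mu>)"
          unfolding kschur_span_def using kb by (auto intro!: Sym.span_base)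
        then show "schur \<gamma> \<in> kschur_span k n (first_part \<mu>)"
          using \<kappa>(5) unfolding kschur_span_def by (auto intro: Sym.span_neg)
      qed (simp add: kschur_span_def Sym.span_zero)
    next
      case False
      define l where "l = n - r"
      have l: "0 < l" "n = r + l" "l < n"
        using False r by (simp_all add: l_def)
      define \<tau> where "\<tau> = drop r \<mu>"
      define c where "c = \<mu> ! r"
      have \<tau>: "\<tau> \<in> kbounded k l"
        unfolding \<tau>_def l_def by (rule kbounded_drop[OF less.prems(1)])
      have c: "0 \<le> c" "c \<le> a" "first_part \<tau> = c"
        using \<mu>(1) \<mu>(3)[of r] \<mu>le[of r] l first_part_nth[of \<tau>] by (auto simp: c_def \<tau>_def)
      have ge: "c \<le> \<mu> ! p" if "p < r" for p
        using decreasing_nth[OF \<mu>(2), of p r] \<mu>(1) that l by (simp add: c_def)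
      have split: "\<mu> = take r \<mu> @ \<tau>" "\<gamma> = take r \<gamma> @ drop r \<gamma>"
        by (simp_all add: \<tau>_def)
      let ?\<eta> = "take r \<mu>" and ?\<eta>' = "take r \<gamma>" and ?\<tau>' = "drop r \<gamma>"
      have lens: "length ?\<eta> = r" "length ?\<eta>' = r" "length \<tau> = l" "length ?\<tau>' = l"
        using \<mu>(1) len l by (simp_all add: \<tau>_def)
      \<comment> \<open>From position \<open>r > k - a\<close> on the staircase bound is 0, so the
        weight agrees with \<open>\<mu>\<close> on the tail.\<close>
      have \<tau>': "?\<tau>' = \<tau>"
      proof (rule nth_equalityI)
        fix q assume "q < length ?\<tau>'"
        then have "r + q < n"
          using lens l by simp
        then show "?\<tau>' ! q = \<tau> ! q"
          using low[of "r + q"] r len \<mu>(1) by (simp add: \<tau>_def a_def[symmetric])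
      qed (use lens in simp)
      \<comment> \<open>The bounds on the head say
        \<open>c - (r - 1) \<le> \<nu>\<^sub>p - p \<le> a\<close>, a form that sorting preserves
        and that puts all entries of the sorted head between \<open>c\<close> and
        \<open>a\<close>.\<close>
      let ?P = "\<lambda>\<nu> \<sigma>. length \<nu> = r \<and> length \<sigma> = l \<and> (\<forall>p<r. \<nu> ! p \<le> a + int p \<and> c - (int r - 1) + int p \<le> \<nu> ! p) \<and>
        lowered k \<tau> \<sigma>"
      have PB: "Bvec \<nu> (catalan (kschur_roots k \<tau>) \<sigma>) \<in> kschur_span k n a" if P: "?P \<nu> \<sigma>" for \<nu> \<sigma>
      proof -
        have cat: "catalan (kschur_roots k \<tau>) \<sigma> \<in> kschur_span k l c"
          using less.IH[OF l(3) \<tau>] P c by auto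
        show ?thesis
          unfolding kschur_span_def[of k n]
        proof (rule span_Bvec_sort[OF cat[unfolded kschur_span_def]])
          fix \<kappa> g
          assume \<kappa>: "length \<kappa> = length \<nu>" "sorted_wrt (\<ge>) \<kappa>" "mset (beta_list \<kappa>) = mset (beta_list \<nu>)"
            and g: "g \<in> kschur k ` {\<mu> \<in> kbounded k l. first_part \<mu> \<le> c}"
          then obtain \<tau>' where \<tau>': "\<tau>' \<in> kbounded k l" "first_part \<tau>' \<le> c" "g = kschur k \<tau>'"
            by auto
          have len: "length \<kappa> = r"
            using \<kappa> P by simp
          have \<kappa>0: "\<kappa> ! 0 \<le> a"
          proof -
            obtain q where "q < length \<nu>" "\<kappa> ! 0 - int 0 = \<nu> ! q - int q"
              using beta_list_boundsD[OF \<kappa>(3), of 0] len r by auto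
            moreover from this have "\<nu> ! q \<le> a + int q"
              using P by simp
            ultimately show ?thesis
              by simp
          qed
          have "c \<le> \<kappa> ! p" if "p < r" for p
          proof -
            obtain q where "q < length \<nu>" "\<kappa> ! (r - 1) - int (r - 1) = \<nu> ! q - int q"
              using beta_list_boundsD[OF \<kappa>(3), of "r - 1"] len r by auto
            moreover from this have "c - (int r - 1) + int q \<le> \<nu> ! q"
              using P by simp
            ultimately have "c \<le> \<kappa> ! (r - 1)"
              using r(2) by (simp add: of_nat_diff)
            moreover have "p \<le> r - 1" "r - 1 < length \<kappa>"
              using that len by simp_all
            ultimately show ?thesis
              using decreasing_nth[OF \<kappa>(2)] order_trans by blast
          qed
          then have "Bvec \<kappa> (kschur k \<tau>') \<in> kschur_span k (r + l) a"
            by (intro Bvec_kschur_in_span[OF less.IH[OF l(3)] r c(1,2) ak(2) len \<kappa>(2) \<kappa>0 _ \<tau>'(1,2) l(1)])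
          then show "Bvec \<kappa> g \<in> Sym.span (kschur k ` {\<mu> \<in> kbounded k n. first_part \<mu> \<le> a})"
            using \<tau>' l by (simp add: kschur_span_def)
        qed
      qed
      have "catalan (kschur_roots k (?\<eta> @ \<tau>)) (?\<eta>' @ ?\<tau>') - Bvec ?\<eta>' (catalan (kschur_roots k \<tau>) ?\<tau>')
        \<in> Sym.span {Bvec \<nu> (catalan (kschur_roots k \<tau>) \<sigma>) |\<nu> \<sigma>. length \<nu> = length ?\<eta> \<and> length \<sigma> = length \<tau> \<and>
          (\<forall>p<length ?\<eta>. ?\<eta>' ! p \<le> \<nu> ! p \<and>
            \<nu> ! p \<le> ?\<eta>' ! p + (int k - ?\<eta> ! p + int p - (int (length ?\<eta>) - 1))) \<and>
          (\<forall>q<length \<tau>. \<sigma> ! q \<le> ?\<tau>' ! q \<and> ?\<tau>' ! q - max 0 (int k - c - int q) \<le> \<sigma> ! q) \<and>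
          sum_list ?\<eta>' < sum_list \<nu>}" (is "_ \<in> Sym.span ?E")
      proof (rule kschur_block_expand)
        fix p assume "p < length ?\<eta>"
        then show "c \<le> ?\<eta> ! p" "?\<eta> ! p \<le> int k - (int (length ?\<eta>) - 1) + int p"
          using ge[of p] \<mu>le[of p] r lens l by auto
      qed (use lens in simp_all)
      \<comment> \<open>Row \<open>p\<close> is lowered by at most
        \<open>k - a - p = r - 1 - p\<close>; this staircase shape is what makes the lower bound on
        \<open>\<gamma>\<^sub>p - p\<close> uniform in \<open>p\<close>.\<close>
      moreover have low': "c - (int r - 1) + int p \<le> \<gamma> ! p" "\<gamma> ! p + (int k - \<mu> ! p + int p - (int r - 1)) \<le> a + int p"
        if "p < r" for p
        using low[of p] ge[of p] that l r by (auto simp: a_def[symmetric])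
      have "?E \<subseteq> kschur_span k n a"
      proof clarify
        fix \<nu> \<sigma>
        assume A: "length \<nu> = length ?\<eta>" "length \<sigma> = length \<tau>"
          "\<forall>p<length ?\<eta>. ?\<eta>' ! p \<le> \<nu> ! p \<and>
            \<nu> ! p \<le> ?\<eta>' ! p + (int k - ?\<eta> ! p + int p - (int (length ?\<eta>) - 1))"
          "\<forall>q<length \<tau>. \<sigma> ! q \<le> ?\<tau>' ! q \<and> ?\<tau>' ! q - max 0 (int k - c - int q) \<le> \<sigma> ! q"
        show "Bvec \<nu> (catalan (kschur_roots k \<tau>) \<sigma>) \<in> kschur_span k n a"
        proof (rule PB, intro conjI allI impI)
          fix p assume p: "p < r"
          then have "\<gamma> ! p \<le> \<nu> ! p" "\<nu> ! p \<le> \<gamma> ! p + (int k - \<mu> ! p + int p - (int r - 1))"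
            using A(3) lens by simp_all
          then show "\<nu> ! p \<le> a + int p" "c - (int r - 1) + int p \<le> \<nu> ! p"
            using low'[OF p] by linarith+
        next
          show "lowered k \<tau> \<sigma>"
            using A(2,4) c(3) \<tau>' by (simp add: lowered_def)
        qed (use A lens in simp_all)
      qed
      then have "Sym.span ?E \<subseteq> kschur_span k n a"
        unfolding kschur_span_def by (rule span_subset_span)
      ultimately have "catalan (kschur_roots k (?\<eta> @ \<tau>)) (?\<eta>' @ ?\<tau>')
        - Bvec ?\<eta>' (catalan (kschur_roots k \<tau>) ?\<tau>') \<in> kschur_span k n a"
        by blast
      then have 1: "catalan (kschur_roots k \<mu>) \<gamma> - Bvec ?\<eta>' (catalan (kschur_roots k \<tau>) \<tau>) \<in> kschur_span k n a"
        unfolding split(1)[symmetric] split(2)[symmetric] by (simp only: \<tau>')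
      have 2: "Bvec ?\<eta>' (catalan (kschur_roots k \<tau>) \<tau>) \<in> kschur_span k n a"
      proof (rule PB, intro conjI allI impI)
        fix p assume p: "p < r"
        have "0 \<le> int k - \<mu> ! p + int p - (int r - 1)"
          using \<mu>le[of p] p l r by simp
        then show "?\<eta>' ! p \<le> a + int p" "c - (int r - 1) + int p \<le> ?\<eta>' ! p"
          using low'[OF p] p by simp_all
      next
        show "lowered k \<tau> \<tau>"
          by (simp add: lowered_def)
      qed (use lens in simp_all)
      show ?thesis
        using Sym.span_add[OF 1[unfolded kschur_span_def] 2[unfolded kschur_span_def]]
        by (simp add: kschur_span_def a_def)
    qed
  qed
qed

section \<open>\<open>k\<close>-split polynomials\<close>

text \<open>
  A \<open>k\<close>-split polynomial indexed by a partition of fixed length, with trailing zeros kept. The last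
  block may be short, which makes no difference by \<open>block_prod_append_zeros\<close>.
\<close>

function block_prod :: "nat \<Rightarrow> int list \<Rightarrow> sym" where
  "block_prod k [] = 1"
| "block_prod k (a # \<nu>) = (let r = nat (int k - a) + 1 in
    Bvec (take r (a # \<nu>)) (block_prod k (drop r (a # \<nu>))))"
  by pat_completeness auto
termination by (relation "measure (\<lambda>(k, \<nu>). length \<nu>)") auto

lemma block_prod_rec:
  "\<mu> \<noteq> [] \<Longrightarrow> r = nat (int k - \<mu> ! 0) + 1 \<Longrightarrow>
    block_prod k \<mu> = Bvec (take r \<mu>) (block_prod k (drop r \<mu>))"
  by (cases \<mu>) (simp_all add: Let_def)

declare block_prod.simps(2) [simp del]

lemma Bvec_one: "Bvec \<nu> 1 = schur \<nu>"
proof -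
  have "block_roots (length \<nu>) 0 = {}"
    by (simp add: block_roots_def)
  then show ?thesis
    using Bvec_catalan[of "{}" "[]" \<nu>] by (simp add: catalan_empty shift_roots_def)
qed

definition block_span :: "nat \<Rightarrow> nat \<Rightarrow> (int \<Rightarrow> bool) \<Rightarrow> sym set"
  where "block_span k n P = Sym.span (block_prod k ` {\<mu> \<in> kbounded k n. P (first_part \<mu>)})"

lemma lowered_refl: "lowered k \<mu> \<mu>"
  by (simp add: lowered_def)

text \<open>The sorted head never drops below \<open>c\<close> and the tail is re-expanded with
  first parts at most \<open>c\<close>, so both concatenate to a partition again. The tail passes
  through \<open>lowered_catalan\<close> first and the induction hypothesis second.\<close>

lemma kschur_in_block_span:
  assumes "\<mu> \<in> kbounded k n"
  shows "kschur k \<mu> \<in> block_span k n (\<lambda>b. b = first_part \<mu>)"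
  using assms
proof (induction n arbitrary: \<mu> rule: less_induct)
  case (less n)
  note \<mu> = kboundedD[OF less.prems]
  show ?case
  proof (cases "n = 0")
    case True
    then have "\<mu> = []"
      using \<mu>(1) by simp
    then show ?thesis
      using less.prems True unfolding block_span_def
      by (intro Sym.span_base image_eqI[of _ _ "[]"])
        (auto simp: kschur_def kschur_roots_def all_roots_def catalan_empty)
  next
    case n0: False
    define a where "a = first_part \<mu>"
    have a: "a = \<mu> ! 0"
      using n0 \<mu>(1) first_part_nth[of \<mu>] unfolding a_def by simp
    have ak: "0 \<le> a" "a \<le> int k"
      using \<mu>(3,4)[of 0] n0 by (auto simp: a)
    have \<mu>le: "\<mu> ! p \<le> a" if "p < n" for p
      using decreasing_nth[OF \<mu>(2), of 0 p] \<mu>(1) that by (simp add: a)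
    define r where "r = nat (int k - a) + 1"
    have r: "int r = int k - a + 1" "0 < r"
      using ak by (simp_all add: r_def)
    show ?thesis
    proof (cases "n \<le> r")
      case True
      have "kschur_roots k \<mu> = {}"
        by (rule kschur_no_roots[OF less.prems(1)]) (use True r a in simp)
      then have "kschur k \<mu> = block_prod k \<mu>"
      proof -
        have "\<mu> \<noteq> []"
          using n0 \<mu>(1) by auto
        then show ?thesis
          using \<open>kschur_roots k \<mu> = {}\<close> \<mu>(1) True block_prod_rec[of \<mu> r k]
          by (simp add: kschur_def catalan_empty r_def a Bvec_one)
      qed
      then show ?thesis
        using less.prems unfolding block_span_def by (auto intro!: Sym.span_base)
    next
      case False
      define l where "l = n - r"
      have l: "0 < l" "n = r + l" "l < n"
        using False r by (simp_all add: l_def)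
      define \<tau> where "\<tau> = drop r \<mu>"
      define c where "c = \<mu> ! r"
      have \<tau>: "\<tau> \<in> kbounded k l"
        unfolding \<tau>_def l_def by (rule kbounded_drop[OF less.prems(1)])
      have c: "0 \<le> c" "c \<le> a" "first_part \<tau> = c"
        using \<mu>(1) \<mu>(3)[of r] \<mu>le[of r] l first_part_nth[of \<tau>] by (auto simp: c_def \<tau>_def)
      have ge: "c \<le> \<mu> ! p" if "p < r" for p
        using decreasing_nth[OF \<mu>(2), of p r] \<mu>(1) that l by (simp add: c_def)
      let ?\<eta> = "take r \<mu>"
      have split: "\<mu> = ?\<eta> @ \<tau>"
        by (simp add: \<tau>_def)
      have lens: "length ?\<eta> = r" "length \<tau> = l"
        using \<mu>(1) l by (simp_all add: \<tau>_def)
      have sub: "kschur_span k l c \<subseteq> block_span k l (\<lambda>b. b \<le> c)"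
        unfolding kschur_span_def block_span_def
      proof (rule span_subset_span, clarify)
        fix \<mu>' assume \<mu>': "\<mu>' \<in> kbounded k l" "first_part \<mu>' \<le> c"
        have "block_span k l (\<lambda>b. b = first_part \<mu>') \<subseteq> block_span k l (\<lambda>b. b \<le> c)"
          unfolding block_span_def using \<mu>'(2) by (intro Sym.span_mono) auto
        then show "kschur k \<mu>' \<in> Sym.span (block_prod k ` {\<mu> \<in> kbounded k l. first_part \<mu> \<le> c})"
          using less.IH[OF l(3) \<mu>'(1)] by (auto simp: block_span_def)
      qed
      have PB: "Bvec \<nu> (catalan (kschur_roots k \<tau>) \<sigma>) \<in> block_span k n (\<lambda>b. b = a)"
        if len\<nu>: "length \<nu> = r" and low: "lowered k \<tau> \<sigma>" and \<nu>0: "\<nu> ! 0 = a"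
          and \<nu>: "\<And>p. p < r \<Longrightarrow> \<nu> ! p \<le> a + int p" "\<And>p. p < r \<Longrightarrow> c \<le> \<nu> ! p" for \<nu> \<sigma>
      proof -
        have cat: "catalan (kschur_roots k \<tau>) \<sigma> \<in> block_span k l (\<lambda>b. b \<le> c)"
          using lowered_catalan[OF \<tau> low] c sub by auto
        show ?thesis
          unfolding block_span_def[of k n]
        proof (rule span_Bvec_sort[OF cat[unfolded block_span_def]])
          fix \<kappa> g
          assume \<kappa>: "length \<kappa> = length \<nu>" "sorted_wrt (\<ge>) \<kappa>" "mset (beta_list \<kappa>) = mset (beta_list \<nu>)"
            and g: "g \<in> block_prod k ` {\<mu> \<in> kbounded k l. first_part \<mu> \<le> c}"
          then obtain \<tau>' where \<tau>': "\<tau>' \<in> kbounded k l" "first_part \<tau>' \<le> c" "g = block_prod k \<tau>'"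
            by auto
          have len: "length \<kappa> = r"
            using \<kappa> len\<nu> by simp
          have "\<kappa> ! 0 \<le> a"
          proof -
            obtain q where "q < length \<nu>" "\<kappa> ! 0 - int 0 = \<nu> ! q - int q"
              using beta_list_boundsD[OF \<kappa>(3), of 0] len r by auto
            then show ?thesis
              using \<nu>(1)[of q] len\<nu> by simp
          qed
          \<comment> \<open>Position 0 of \<open>\<nu>\<close> contributes the number
            \<open>a\<close>, so \<open>\<kappa>\<^sub>q = a + q\<close> for some \<open>q\<close>,
            and \<open>\<kappa>\<close> is decreasing.\<close>
          moreover have "a \<le> \<kappa> ! 0"
          proof -
            obtain q where q: "q < length \<kappa>" "\<nu> ! 0 - int 0 = \<kappa> ! q - int q"
              using beta_list_boundsD[OF \<kappa>(3)[symmetric], of 0] len\<nu> r by auto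
            then show ?thesis
              using decreasing_nth[OF \<kappa>(2), of 0 q] \<nu>0 by simp
          qed
          ultimately have \<kappa>0: "\<kappa> ! 0 = a"
            by simp
          have \<kappa>c: "c \<le> \<kappa> ! p" if "p < length \<kappa>" for p
          proof -
            obtain q where q: "q < length \<nu>" "\<kappa> ! (r - 1) - int (r - 1) = \<nu> ! q - int q"
              using beta_list_boundsD[OF \<kappa>(3), of "r - 1"] len r by auto
            then have "c \<le> \<kappa> ! (r - 1)"
              using \<nu>(2)[of q] len\<nu> r(2) by (simp add: of_nat_diff)
            moreover have "p \<le> r - 1" "r - 1 < length \<kappa>"
              using that len r by simp_all
            ultimately show ?thesis
              using decreasing_nth[OF \<kappa>(2)] order_trans by blast
          qed
          have ne: "\<kappa> \<noteq> []" "\<kappa> ! 0 \<le> int k"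
            using len r \<kappa>0 ak by auto
          have mem: "\<kappa> @ \<tau>' \<in> kbounded k n"
            using kbounded_append[OF \<kappa>(2) ne \<tau>'(1) c(1) \<tau>'(2) \<kappa>c] len l by simp
          have nth0: "(\<kappa> @ \<tau>') ! 0 = a"
            using \<kappa>0 ne by (simp add: nth_append)
          then have "first_part (\<kappa> @ \<tau>') = a"
            using first_part_nth[of "\<kappa> @ \<tau>'"] ne by simp
          \<comment> \<open>The block length depends on the first entry only, which is still
            \<open>a\<close>; so \<open>\<kappa>\<close> is precisely the first block.\<close>
          moreover have "block_prod k (\<kappa> @ \<tau>') = Bvec \<kappa> g"
            using block_prod_rec[of "\<kappa> @ \<tau>'" r k] ne nth0 len \<tau>'(3) by (simp add: r_def)
          ultimately show "Bvec \<kappa> g \<in> Sym.span (block_prod k ` {\<mu> \<in> kbounded k n. first_part \<mu> = a})"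
            using mem by (metis (mono_tags, lifting) Sym.span_base image_eqI mem_Collect_eq)
        qed
      qed
      have "catalan (kschur_roots k (?\<eta> @ \<tau>)) (?\<eta> @ \<tau>) - Bvec ?\<eta> (catalan (kschur_roots k \<tau>) \<tau>)
        \<in> Sym.span {Bvec \<nu> (catalan (kschur_roots k \<tau>) \<sigma>) |\<nu> \<sigma>. length \<nu> = length ?\<eta> \<and> length \<sigma> = length \<tau> \<and>
          (\<forall>p<length ?\<eta>. ?\<eta> ! p \<le> \<nu> ! p \<and>
            \<nu> ! p \<le> ?\<eta> ! p + (int k - ?\<eta> ! p + int p - (int (length ?\<eta>) - 1))) \<and>
          (\<forall>q<length \<tau>. \<sigma> ! q \<le> \<tau> ! q \<and> \<tau> ! q - max 0 (int k - c - int q) \<le> \<sigma> ! q) \<and>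
          sum_list ?\<eta> < sum_list \<nu>}" (is "_ \<in> Sym.span ?E")
      proof (rule kschur_block_expand)
        fix p assume "p < length ?\<eta>"
        then show "c \<le> ?\<eta> ! p" "?\<eta> ! p \<le> int k - (int (length ?\<eta>) - 1) + int p"
          using ge[of p] \<mu>le[of p] r lens l by auto
      qed simp_all
      moreover have "?E \<subseteq> block_span k n (\<lambda>b. b = a)"
      proof clarify
        fix \<nu> \<sigma>
        assume A: "length \<nu> = length ?\<eta>" "length \<sigma> = length \<tau>"
          "\<forall>p<length ?\<eta>. ?\<eta> ! p \<le> \<nu> ! p \<and>
            \<nu> ! p \<le> ?\<eta> ! p + (int k - ?\<eta> ! p + int p - (int (length ?\<eta>) - 1))"
          "\<forall>q<length \<tau>. \<sigma> ! q \<le> \<tau> ! q \<and> \<tau> ! q - max 0 (int k - c - int q) \<le> \<sigma> ! q"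
        have B: "\<mu> ! p \<le> \<nu> ! p" "\<nu> ! p \<le> a + int p" if "p < r" for p
        proof -
          have "\<mu> ! p \<le> \<nu> ! p \<and> \<nu> ! p \<le> \<mu> ! p + (int k - \<mu> ! p + int p - (int r - 1))"
            using A(3) that lens by simp
          then show "\<mu> ! p \<le> \<nu> ! p" "\<nu> ! p \<le> a + int p"
            using r by simp_all
        qed
        show "Bvec \<nu> (catalan (kschur_roots k \<tau>) \<sigma>) \<in> block_span k n (\<lambda>b. b = a)"
        proof (rule PB)
          show "\<nu> ! 0 = a"
            using B[of 0] r a by simp
          show "lowered k \<tau> \<sigma>"
            using A(2,4) c(3) by (simp add: lowered_def)
          show "c \<le> \<nu> ! p" if "p < r" for p
            using B(1)[OF that] ge[OF that] by simp
        qed (use A B lens in simp_all)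
      qed
      then have "Sym.span ?E \<subseteq> block_span k n (\<lambda>b. b = a)"
        unfolding block_span_def by (rule span_subset_span)
      ultimately have "catalan (kschur_roots k (?\<eta> @ \<tau>)) (?\<eta> @ \<tau>) - Bvec ?\<eta> (catalan (kschur_roots k \<tau>) \<tau>)
        \<in> block_span k n (\<lambda>b. b = a)"
        by blast
      then have 1: "kschur k \<mu> - Bvec ?\<eta> (catalan (kschur_roots k \<tau>) \<tau>) \<in> block_span k n (\<lambda>b. b = a)"
        unfolding split[symmetric] by (simp only: kschur_def)
      have 2: "Bvec ?\<eta> (catalan (kschur_roots k \<tau>) \<tau>) \<in> block_span k n (\<lambda>b. b = a)"
      proof (rule PB)
        fix p assume "p < r"
        then show "?\<eta> ! p \<le> a + int p" "c \<le> ?\<eta> ! p"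
          using \<mu>le[of p] ge[of p] l by simp_all
      qed (use lens lowered_refl a r in simp_all)
      show ?thesis
        using Sym.span_add[OF 1[unfolded block_span_def] 2[unfolded block_span_def]]
        by (simp add: block_span_def a_def)
    qed
  qed
qed

section \<open>Triangularity between block products and the functions
  \<open>Btilde \<gamma> 1\<close>\<close>

lemma Btilde_one: "Btilde \<gamma> 1 = catalan (all_roots (length \<gamma>)) \<gamma>"
proof -
  have "row_roots (length \<gamma>) 0 = all_roots (length \<gamma>)"
    by (auto simp: row_roots_def all_roots_def)
  then show ?thesis
    using Btilde_catalan[of "{}" "[]" \<gamma>] by (simp add: catalan_empty shift_roots_def)
qed

text \<open>Iterating \<open>Bvec_catalan\<close> merges the blocks into one root set. The last
  clause says that this set includes \<open>kschur_roots k \<mu>\<close>, which limits row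
  \<open>p\<close> to \<open>k - \<mu>\<^sub>p\<close> missing roots.\<close>

lemma ex_block_prod_catalan:
  assumes "\<mu> \<in> kbounded k n"
  shows "\<exists>\<Psi> \<subseteq> all_roots n. block_prod k \<mu> = catalan \<Psi> \<mu> \<and>
    (\<forall>p j. p < j \<and> j < n \<and> (p, j) \<notin> \<Psi> \<longrightarrow> int j \<le> int p + int k - \<mu> ! p)"
  using assms
proof (induction n arbitrary: \<mu> rule: less_induct)
  case (less n)
  note \<mu> = kboundedD[OF less.prems]
  show ?case
  proof (cases "n = 0")
    case True
    then have "\<mu> = []"
      using \<mu>(1) by simp
    then show ?thesis
      using True by (intro exI[of _ "{}"]) (simp add: catalan_empty)
  next
    case n0: False
    then have ne: "\<mu> \<noteq> []"
      using \<mu>(1) by auto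
    define r where "r = nat (int k - \<mu> ! 0) + 1"
    have r: "int r = int k - \<mu> ! 0 + 1" "0 < r"
      using \<mu>(4)[of 0] n0 by (simp_all add: r_def)
    \<comment> \<open>The last block may have fewer than \<open>r\<close> entries.\<close>
    define s where "s = min r n"
    have tau: "drop r \<mu> \<in> kbounded k (n - r)"
      by (rule kbounded_drop[OF less.prems])
    obtain \<Psi> where \<Psi>: "\<Psi> \<subseteq> all_roots (n - r)" "block_prod k (drop r \<mu>) = catalan \<Psi> (drop r \<mu>)"
      "\<forall>p j. p < j \<and> j < n - r \<and> (p, j) \<notin> \<Psi> \<longrightarrow> int j \<le> int p + int k - drop r \<mu> ! p"
      using less.IH[OF _ tau] n0 r by auto
    let ?\<Phi> = "block_roots s (n - r) \<union> shift_roots s \<Psi>"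
    have sn: "s + (n - r) = n"
      by (simp add: s_def)
    have "block_prod k \<mu> = catalan ?\<Phi> \<mu>"
      using block_prod_rec[OF ne r_def] Bvec_catalan[of \<Psi> "drop r \<mu>" "take r \<mu>"] \<Psi> \<mu>(1)
      by (simp add: s_def min.commute)
    moreover have "?\<Phi> \<subseteq> all_roots n"
      using shift_roots_subset[OF \<Psi>(1), of s] sn by (auto simp: block_roots_def all_roots_def)
    moreover have "int j \<le> int p + int k - \<mu> ! p" if "p < j" "j < n" "(p, j) \<notin> ?\<Phi>" for p j
    proof (cases "p < s")
      case True
      then have "j < s"
        using that sn by (auto simp: block_roots_def)
      moreover have "\<mu> ! p \<le> \<mu> ! 0"
        using decreasing_nth[OF \<mu>(2), of 0 p] that \<mu>(1) by simp
      ultimately show ?thesis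
        using r(1) by (simp add: s_def)
    next
      case False
      then have s: "s = r" "r \<le> p"
        using that by (auto simp: s_def min_def split: if_splits)
      have "(p - r, j - r) \<notin> \<Psi>"
      proof
        assume "(p - r, j - r) \<in> \<Psi>"
        moreover have "(p, j) = map_prod ((+) s) ((+) s) (p - r, j - r)"
          using s that by simp
        ultimately have "(p, j) \<in> shift_roots s \<Psi>"
          unfolding shift_roots_def by (rule image_eqI[rotated])
        with that(3) show False
          by simp
      qed
      moreover have "p - r < j - r" "j - r < n - r"
        using that s by simp_all
      ultimately have "int (j - r) \<le> int (p - r) + int k - drop r \<mu> ! (p - r)"
        using \<Psi>(3) by blast
      then show ?thesis
        using s that \<mu>(1) by (simp add: of_nat_diff)
    qed
    ultimately show ?thesis
      by blast
  qed
qed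

text \<open>Higher in the sense of dominance, as measured by a smaller moment. The lists need not be
  decreasing or nonnegative; what must not get lost is the upper bound \<open>k\<close> and the
  first entry.\<close>

definition bounded_higher :: "nat \<Rightarrow> int list \<Rightarrow> int list set"
  where "bounded_higher k \<gamma> = {\<delta>. length \<delta> = length \<gamma> \<and> (\<forall>p<length \<gamma>. \<delta> ! p \<le> int k) \<and>
    sum_list \<delta> = sum_list \<gamma> \<and> moment \<delta> < moment \<gamma> \<and> (0 < length \<gamma> \<longrightarrow> \<gamma> ! 0 \<le> \<delta> ! 0)}"

text \<open>The assumption \<open>band\<close> leaves at most \<open>k - \<gamma>\<^sub>p\<close>
  missing roots in row \<open>p\<close>, so adding them cannot push an entry above
  \<open>k\<close>.\<close>

lemma catalan_Btilde_expand:
  assumes \<Psi>: "\<Psi> \<subseteq> all_roots (length \<gamma>)"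
    and band: "\<And>p j. p < j \<Longrightarrow> j < length \<gamma> \<Longrightarrow> (p, j) \<notin> \<Psi> \<Longrightarrow> int j \<le> int p + int k - \<gamma> ! p"
    and le: "\<And>p. p < length \<gamma> \<Longrightarrow> \<gamma> ! p \<le> int k"
  shows "catalan \<Psi> \<gamma> - Btilde \<gamma> 1 \<in> Sym.span ((\<lambda>\<delta>. Btilde \<delta> 1) ` bounded_higher k \<gamma>)"
proof -
  have "{catalan (all_roots (length \<gamma>)) (add_roots S \<gamma>) |S. S \<subseteq> all_roots (length \<gamma>) - \<Psi> \<and> S \<noteq> {}}
    \<subseteq> (\<lambda>\<delta>. Btilde \<delta> 1) ` bounded_higher k \<gamma>"
  proof clarify
    fix S assume S: "S \<subseteq> all_roots (length \<gamma>) - \<Psi>" "S \<noteq> {}"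
    then have Sall: "S \<subseteq> all_roots (length \<gamma>)"
      by auto
    have fin: "finite S"
      by (rule finite_roots[OF Sall])
    have row: "int (card {j. (p, j) \<in> S}) \<le> int k - \<gamma> ! p" if "p < length \<gamma>" for p
    proof -
      define N where "N = nat (int p + int k - \<gamma> ! p + 1)"
      have N: "int N = int p + int k - \<gamma> ! p + 1"
        using le[OF that] by (simp add: N_def)
      have "{j. (p, j) \<in> S} \<subseteq> {Suc p..<N}"
      proof
        fix j assume "j \<in> {j. (p, j) \<in> S}"
        then have "p < j" "j < length \<gamma>" "(p, j) \<notin> \<Psi>"
          using S(1) by (auto simp: all_roots_def)
        with band[OF this] N show "j \<in> {Suc p..<N}"
          by simp
      qed
      then have "card {j. (p, j) \<in> S} \<le> card {Suc p..<N}"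
        by (intro card_mono) auto
      then show ?thesis
        using N le[OF that] by simp
    qed
    have "add_roots S \<gamma> \<in> bounded_higher k \<gamma>"
      unfolding bounded_higher_def
    proof (intro CollectI conjI allI impI)
      fix p assume "p < length \<gamma>"
      then show "add_roots S \<gamma> ! p \<le> int k"
        using nth_add_roots[OF fin, of p \<gamma>] row[of p] by simp
    next
      assume "0 < length \<gamma>"
      moreover have "{i. (i, 0) \<in> S} = {}"
        using Sall by (auto simp: all_roots_def)
      ultimately show "\<gamma> ! 0 \<le> add_roots S \<gamma> ! 0"
        using nth_add_roots[OF fin, of 0 \<gamma>] by simp
    next
      show "sum_list (add_roots S \<gamma>) = sum_list \<gamma>"
        by (rule sum_list_raise[OF Sall])
      show "moment (add_roots S \<gamma>) < moment \<gamma>"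
        by (rule moment_add_roots_less[OF Sall S(2)])
    qed simp
    then show "catalan (all_roots (length \<gamma>)) (add_roots S \<gamma>) \<in> (\<lambda>\<delta>. Btilde \<delta> 1) ` bounded_higher k \<gamma>"
      by (intro image_eqI) (simp_all add: Btilde_one)
  qed
  from subsetD[OF Sym.span_mono[OF this] catalan_expand[OF \<Psi> order_refl]]
  show ?thesis
    by (simp add: Btilde_one)
qed

lemma sum_list_update_int:
  "i < length \<gamma> \<Longrightarrow> sum_list (\<gamma>[i := x]) = sum_list \<gamma> + (x - \<gamma> ! i :: int)"
  by (simp add: sum_list_sum_nth sum.remove[of "{0..<length \<gamma>}" i])

text \<open>
  Jing's relation: without the root \<open>(i, i + 1)\<close> the function
  \<open>H(all_roots n - {(i, i + 1)}; \<delta>) = Btilde \<delta> 1 - t Btilde (\<delta> + \<epsilon>\<^sub>i - \<epsilon>\<^sub>i\<^sub>+\<^sub>1) 1\<close> is antisymmetric under the dot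
  action, which rewrites an ascent in terms of lists of smaller moment.
\<close>

lemma Btilde_straighten:
  assumes step: "\<And>\<gamma>. \<gamma> \<in> kbounded k n \<Longrightarrow> b \<le> \<gamma> ! 0 \<Longrightarrow>
      (\<And>\<delta>. \<delta> \<in> bounded_higher k \<gamma> \<Longrightarrow> Btilde \<delta> 1 \<in> Sym.span W) \<Longrightarrow> Btilde \<gamma> 1 \<in> Sym.span W"
    and n: "0 < n" and \<gamma>: "length \<gamma> = n" "\<And>p. p < n \<Longrightarrow> \<gamma> ! p \<le> int k" "b \<le> \<gamma> ! 0"
  shows "Btilde \<gamma> 1 \<in> Sym.span W"
proof -
  \<comment> \<open>Nonnegative for lists bounded by \<open>k\<close>, and for a given sum equal to
    the moment up to a constant. The moment itself may be negative, so this is the termination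
    measure.\<close>
  define M where "M \<delta> = (\<Sum>p<n. (int n - int p) * (int k - \<delta> ! p))" for \<delta> :: "int list"
  have M: "M \<delta> = int n * (int n * int k - sum_list \<delta>) - int k * (\<Sum>p<n. int p) + moment \<delta>"
    if "length \<delta> = n" for \<delta>
  proof -
    have "M \<delta> = (\<Sum>p<n. int n * int k - int n * \<delta> ! p - int k * int p + int p * \<delta> ! p)"
      unfolding M_def by (rule sum.cong) (simp_all add: algebra_simps)
    also have "\<dots> = int n * int n * int k - int n * (\<Sum>p<n. \<delta> ! p) - int k * (\<Sum>p<n. int p) + (\<Sum>p<n. int p * \<delta> ! p)"
      by (simp add: sum.distrib sum_subtractf sum_distrib_left)
    finally show ?thesis
      using that by (simp add: moment_def sum_list_sum_nth atLeast0LessThan algebra_simps)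
  qed
  have Mpos: "0 \<le> M \<delta>" if "\<And>p. p < n \<Longrightarrow> \<delta> ! p \<le> int k" for \<delta>
    unfolding M_def by (rule sum_nonneg) (use that in simp)
  have Mless: "nat (M \<delta>) < nat (M \<gamma>)"
    if "length \<delta> = n" "length \<gamma> = n" "sum_list \<delta> = sum_list \<gamma>" "moment \<delta> < moment \<gamma>" "\<And>p. p < n \<Longrightarrow> \<delta> ! p \<le> int k"
    for \<delta> \<gamma>
  proof -
    have "M \<delta> < M \<gamma>"
      using M[of \<delta>] M[of \<gamma>] that by simp
    then show ?thesis
      using Mpos[of \<delta>] that by simp
  qed
  show ?thesis
    using \<gamma>
  proof (induction "nat (M \<gamma>)" arbitrary: \<gamma> rule: less_induct)
    case (less \<gamma>)
    note \<gamma> = less.prems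
    have IH: "Btilde \<delta> 1 \<in> Sym.span W"
      if "length \<delta> = n" "\<And>p. p < n \<Longrightarrow> \<delta> ! p \<le> int k" "b \<le> \<delta> ! 0" "sum_list \<delta> = sum_list \<gamma>" "moment \<delta> < moment \<gamma>" for \<delta>
      using less.hyps[OF Mless[OF that(1) \<gamma>(1) that(4,5,2)] that(1-3)] by simp
    show ?case
    proof (cases "sorted_wrt (\<ge>) \<gamma>")
      case srt: True
      show ?thesis
      proof (cases "\<forall>p<n. 0 \<le> \<gamma> ! p")
        case True
        then have "\<gamma> \<in> kbounded k n"
          using \<gamma> srt by (intro kboundedI) auto
        then show ?thesis
        proof (rule step[OF _ \<gamma>(3)])
          fix \<delta> assume "\<delta> \<in> bounded_higher k \<gamma>"
          then show "Btilde \<delta> 1 \<in> Sym.span W"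
            using n \<gamma> by (intro IH) (auto simp: bounded_higher_def)
        qed
      next
        case False
        then obtain p where "p < n" "\<gamma> ! p < 0"
          by auto
        then have "\<gamma> ! (n - 1) < 0"
        proof -
          have "p \<le> n - 1" "n - 1 < length \<gamma>"
            using \<open>p < n\<close> \<gamma>(1) by simp_all
          from decreasing_nth[OF srt this] show ?thesis
            using \<open>\<gamma> ! p < 0\<close> by simp
        qed
        moreover have "drop (n - 1) \<gamma> = [\<gamma> ! (n - 1)]"
          using n \<gamma>(1) by (simp add: Cons_nth_drop_Suc[symmetric])
        ultimately have "Btilde \<gamma> 1 = 0"
          unfolding Btilde_one by (intro catalan_zero_drop[of _ _ "n - 1"]) auto
        then show ?thesis
          by (simp add: Sym.span_zero)
      qed
    next
      case False
      then obtain i where i: "Suc i < length \<gamma>" "\<gamma> ! i < \<gamma> ! Suc i"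
        by (rule not_decreasingE)
      let ?\<beta> = "(i, Suc i)"
      let ?\<Psi> = "all_roots n - {?\<beta>}"
      let ?s = "dot_swap i \<gamma>"
      have root: "?\<beta> \<in> all_roots n"
        using i \<gamma>(1) by (simp add: all_roots_def)
      have X: "catalan ?\<Psi> \<delta> = Btilde \<delta> 1 - tvar *\<^sub>t Btilde (add_root ?\<beta> \<delta>) 1" if "length \<delta> = n" for \<delta>
        using catalan_remove_root[of "all_roots n" \<delta> ?\<beta>] root that by (simp add: Btilde_one)
      have anti: "catalan ?\<Psi> ?s = - catalan ?\<Psi> \<gamma>"
      proof (rule catalan_dot_swap[OF _ i(1)])
        fix a b assume "(a, b) \<in> ?\<Psi>"
        then show "(transpose i (Suc i) a, transpose i (Suc i) b) \<in> ?\<Psi>"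
          using i(1) \<gamma>(1) by (auto simp: all_roots_def transpose_def split: if_splits)
      qed (use \<gamma>(1) in auto)
      \<comment> \<open>At an ascent
        \<open>\<gamma>\<^sub>i + 1 \<le> \<gamma>\<^sub>i\<^sub>+\<^sub>1\<close>, so raising
        \<open>\<gamma>\<^sub>i\<close> by one respects the bound \<open>k\<close>.\<close>
      have up: "Btilde (add_root ?\<beta> \<gamma>) 1 \<in> Sym.span W"
      proof (rule IH)
        show "add_root ?\<beta> \<gamma> ! p \<le> int k" if "p < n" for p
          using nth_add_root[of ?\<beta> \<gamma> p] root that \<gamma>(1) \<gamma>(2)[OF that] \<gamma>(2)[of "Suc i"] i by auto
        show "b \<le> add_root ?\<beta> \<gamma> ! 0"
          using nth_add_root[of ?\<beta> \<gamma> 0] root n \<gamma>(1,3) by simp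
        show "sum_list (add_root ?\<beta> \<gamma>) = sum_list \<gamma>"
          using i by (simp add: add_root_def sum_list_update_int nth_list_update)
        show "moment (add_root ?\<beta> \<gamma>) < moment \<gamma>"
          using i by (simp add: add_root_def moment_update algebra_simps)
      qed (use \<gamma> in simp)
      show ?thesis
      proof (cases "\<gamma> ! Suc i = \<gamma> ! i + 1")
        case True
        then have "?s = \<gamma>"
          using i by (intro nth_equalityI) (auto simp: dot_swap_def nth_list_update)
        then have "catalan ?\<Psi> \<gamma> = 0"
          using anti sym_eq_minus_self by metis
        then have "Btilde \<gamma> 1 = tvar *\<^sub>t Btilde (add_root ?\<beta> \<gamma>) 1"
          using X[OF \<gamma>(1)] by simp
        then show ?thesis
          using up by (simp add: Sym.span_scale)
      next
        case False
        have nth: "?s ! p = (if p = i then \<gamma> ! Suc i - 1 else if p = Suc i then \<gamma> ! i + 1 else \<gamma> ! p)" if "p < n" for p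
          using that i \<gamma>(1) by (auto simp: dot_swap_def nth_list_update)
        have sum_s: "sum_list ?s = sum_list \<gamma>"
          using i by (simp add: dot_swap_def sum_list_update_int nth_list_update)
        have moment_s: "moment ?s = moment \<gamma> + (\<gamma> ! i + 1 - \<gamma> ! Suc i)"
          using i by (simp add: dot_swap_def moment_update algebra_simps)
        have s: "Btilde ?s 1 \<in> Sym.span W"
        proof (rule IH)
          show "?s ! p \<le> int k" if "p < n" for p
            using nth[OF that] \<gamma>(2)[OF that] \<gamma>(2)[of "Suc i"] i \<gamma>(1) by auto
          show "b \<le> ?s ! 0"
            using nth[OF n] \<gamma>(3) i by auto
          show "moment ?s < moment \<gamma>"
            using moment_s i False by simp
        qed (use \<gamma> sum_s in auto)
        have nth': "add_root ?\<beta> ?s ! p = ?s ! p + of_bool (p = i) - of_bool (p = Suc i)" if "p < n" for p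
          using nth_add_root[of ?\<beta> ?s p] root that \<gamma>(1) by simp
        \<comment> \<open>Adding the root undoes the shifts of the dot action: the list is
          \<open>\<gamma>\<close> with entries \<open>i\<close> and \<open>i + 1\<close>
          exchanged.\<close>
        have s': "Btilde (add_root ?\<beta> ?s) 1 \<in> Sym.span W"
        proof (rule IH)
          show "add_root ?\<beta> ?s ! p \<le> int k" if "p < n" for p
            using nth'[OF that] nth[OF that] \<gamma>(2)[OF that] \<gamma>(2)[of "Suc i"] i \<gamma>(1) by auto
          show "b \<le> add_root ?\<beta> ?s ! 0"
            using nth'[OF n] nth[OF n] \<gamma>(3) i by auto
          have len: "Suc i < length ?s"
            using i by simp
          show "sum_list (add_root ?\<beta> ?s) = sum_list \<gamma>"
            using len sum_s by (simp add: add_root_def sum_list_update_int nth_list_update)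
          have "moment (add_root ?\<beta> ?s) = moment ?s - 1"
            using len by (simp add: add_root_def moment_update algebra_simps)
          then show "moment (add_root ?\<beta> ?s) < moment \<gamma>"
            using moment_s i by simp
        qed (use \<gamma> in simp)
        have "Btilde \<gamma> 1 = tvar *\<^sub>t Btilde (add_root ?\<beta> \<gamma>) 1 - Btilde ?s 1 + tvar *\<^sub>t Btilde (add_root ?\<beta> ?s) 1"
          using anti X[OF \<gamma>(1)] X[of ?s] \<gamma>(1) by (simp add: algebra_simps)
        then show ?thesis
          using up s s' by (simp add: Sym.span_add Sym.span_diff Sym.span_scale)
      qed
    qed
  qed
qed

text \<open>Inverts a unitriangular expansion: \<open>Btilde \<gamma> 1\<close> is
  \<open>block_prod k \<gamma>\<close> up to higher lists, and a higher list never has a smaller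
  first entry, so the bound \<open>b\<close> persists.\<close>

lemma Btilde_in_block_span:
  assumes "0 < n" "length \<gamma> = n" "\<And>p. p < n \<Longrightarrow> \<gamma> ! p \<le> int k" "b \<le> \<gamma> ! 0"
  shows "Btilde \<gamma> 1 \<in> block_span k n (\<lambda>c. b \<le> c)"
  unfolding block_span_def
proof (rule Btilde_straighten[of k n b, OF _ assms])
  fix \<gamma>
  assume \<gamma>: "\<gamma> \<in> kbounded k n" "b \<le> \<gamma> ! 0"
    and IH: "\<And>\<delta>. \<delta> \<in> bounded_higher k \<gamma> \<Longrightarrow> Btilde \<delta> 1 \<in> Sym.span (block_prod k ` {\<mu> \<in> kbounded k n. b \<le> first_part \<mu>})"
  note D = kboundedD[OF \<gamma>(1)]
  let ?W = "Sym.span (block_prod k ` {\<mu> \<in> kbounded k n. b \<le> first_part \<mu>})"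
  obtain \<Psi> where \<Psi>: "\<Psi> \<subseteq> all_roots n" "block_prod k \<gamma> = catalan \<Psi> \<gamma>"
    "\<forall>p j. p < j \<and> j < n \<and> (p, j) \<notin> \<Psi> \<longrightarrow> int j \<le> int p + int k - \<gamma> ! p"
    using ex_block_prod_catalan[OF \<gamma>(1)] by blast
  have "block_prod k \<gamma> - Btilde \<gamma> 1 \<in> Sym.span ((\<lambda>\<delta>. Btilde \<delta> 1) ` bounded_higher k \<gamma>)"
    unfolding \<Psi>(2) by (rule catalan_Btilde_expand) (use \<Psi> D in auto)
  moreover have "Sym.span ((\<lambda>\<delta>. Btilde \<delta> 1) ` bounded_higher k \<gamma>) \<subseteq> ?W"
    by (rule span_subset_span) (use IH in auto)
  moreover have "block_prod k \<gamma> \<in> ?W"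
    using \<gamma> D(1) assms(1) first_part_nth[of \<gamma>] by (intro Sym.span_base imageI) auto
  ultimately have "block_prod k \<gamma> - (block_prod k \<gamma> - Btilde \<gamma> 1) \<in> ?W"
    using Sym.span_diff by blast
  then show "Btilde \<gamma> 1 \<in> ?W"
    by simp
qed

lemma Btilde_append_zeros: "Btilde (\<gamma> @ replicate n 0) 1 = Btilde \<gamma> 1"
proof -
  have "Bop 0 1 = 1"
    using Bop_catalan[of "{}" "[]" 0] by (simp add: catalan_empty shift_roots_def schur_singleton)
  then have "Btilde (replicate n 0) 1 = 1"
    by (induction n) (simp_all add: Btilde_def)
  then show ?thesis
    by (simp add: Btilde_def)
qed

lemma filter_kbounded:
  assumes "\<mu> \<in> kbounded k n"
  obtains m where "\<mu> = filter (\<lambda>a. a \<noteq> 0) \<mu> @ replicate m 0" "filter (\<lambda>a. a \<noteq> 0) \<mu> \<in> Par k"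
    "first_part (filter (\<lambda>a. a \<noteq> 0) \<mu>) = first_part \<mu>"
proof -
  have \<mu>: "sorted_wrt (\<ge>) \<mu>" "\<forall>a\<in>set \<mu>. 0 \<le> a" "\<forall>a\<in>set \<mu>. a \<le> int k"
    using assms by (auto simp: kbounded_def)
  let ?\<rho> = "filter (\<lambda>a. a \<noteq> 0) \<mu>"
  obtain m where m: "\<mu> = ?\<rho> @ replicate m 0"
    using schur_eq_strip[OF \<mu>(1,2)] by blast
  have "?\<rho> \<in> Par k"
    using filter_partition[OF \<mu>(1,2)] \<mu>(3) by (simp add: Par_def)
  moreover have "first_part ?\<rho> = first_part (?\<rho> @ replicate m 0)"
    by (cases m) (auto simp: first_part_def hd_append)
  ultimately show ?thesis
    using that m by metis
qed

lemma Btilde_in_Lambda: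
  assumes "0 < n" "length \<gamma> = n" "\<And>p. p < n \<Longrightarrow> \<gamma> ! p \<le> int k"
  shows "Btilde \<gamma> 1 \<in> Lambda k"
  unfolding Lambda_def
proof (rule Btilde_straighten[of k n "\<gamma> ! 0", OF _ assms order_refl])
  fix \<delta> assume "\<delta> \<in> kbounded k n"
  then obtain m where m: "\<delta> = filter (\<lambda>a. a \<noteq> 0) \<delta> @ replicate m 0" "filter (\<lambda>a. a \<noteq> 0) \<delta> \<in> Par k"
    by (rule filter_kbounded)
  have "Btilde \<delta> 1 = Btilde (filter (\<lambda>a. a \<noteq> 0) \<delta>) 1"
    by (subst m(1)) (rule Btilde_append_zeros)
  then show "Btilde \<delta> 1 \<in> Sym.span ((\<lambda>\<mu>. catalan (all_roots (length \<mu>)) \<mu>) ` Par k)"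
    using m(2) by (auto simp: Btilde_one intro!: Sym.span_base)
qed

lemma block_prod_zeros: "block_prod k (replicate n 0) = 1"
proof (induction n rule: less_induct)
  case (less n)
  show ?case
  proof (cases "n = 0")
    case False
    then have "block_prod k (replicate n 0)
      = Bvec (replicate (min (Suc k) n) 0) (block_prod k (replicate (n - Suc k) 0))"
      by (subst block_prod_rec[of _ "Suc k"]) (auto simp: min.commute)
    then show ?thesis
      using less[of "n - Suc k"] False by (simp add: Bvec_one)
  qed simp
qed

lemma ParD:
  assumes "\<mu> \<in> Par k"
  shows "sorted_wrt (\<ge>) \<mu>" "\<And>a. a \<in> set \<mu> \<Longrightarrow> 0 < a" "\<And>a. a \<in> set \<mu> \<Longrightarrow> a \<le> int k" "\<mu> \<in> partitions"
  using assms by (auto simp: Par_def partitions_def)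

lemma Par_drop: "\<mu> \<in> Par k \<Longrightarrow> drop r \<mu> \<in> Par k"
  by (auto simp: Par_def partitions_def sorted_wrt_drop dest: in_set_dropD)

lemma block_prod_append_zeros:
  "\<mu> \<in> Par k \<Longrightarrow> block_prod k (\<mu> @ replicate n 0) = ksplit_poly k \<mu>"
proof (induction "length \<mu>" arbitrary: \<mu> rule: less_induct)
  case less
  show ?case
  proof (cases \<mu>)
    case Nil
    then show ?thesis
      by (simp add: block_prod_zeros ksplit_poly_def)
  next
    case (Cons a \<nu>)
    define r where "r = nat (int k - a) + 1"
    let ?\<mu> = "\<mu> @ replicate n 0"
    have rec: "block_prod k ?\<mu> = Bvec (take r ?\<mu>) (block_prod k (drop r ?\<mu>))"
      by (rule block_prod_rec) (use Cons in \<open>simp_all add: r_def\<close>)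
    have ks: "ksplit k \<mu> = (take r \<mu> @ replicate (r - length \<mu>) 0) # ksplit k (drop r \<mu>)"
      unfolding Cons by (simp add: r_def Let_def)
    show ?thesis
    proof (cases "length \<mu> \<le> r")
      case True
      then have "block_prod k ?\<mu> = schur \<mu>"
        using rec by (simp add: block_prod_zeros Bvec_one schur_append_zeros min_def)
      moreover have "ksplit_poly k \<mu> = schur \<mu>"
      proof -
        have "ksplit k \<mu> = [\<mu> @ replicate (r - length \<mu>) 0]" "\<mu> \<noteq> []"
          using True ks Cons by simp_all
        then show ?thesis
          by (simp add: ksplit_poly_def schur_append_zeros)
      qed
      ultimately show ?thesis
        by simp
    next
      case False
      let ?\<tau> = "drop r \<mu>"
      have ne: "?\<tau> \<noteq> []"
        using False by simp
      then have "ksplit k ?\<tau> \<noteq> []"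
        by (cases ?\<tau>) (auto simp: Let_def)
      then have "ksplit_poly k \<mu> = Bvec (take r \<mu>) (ksplit_poly k ?\<tau>)"
      proof -
        have "ksplit k \<mu> = take r \<mu> # ksplit k ?\<tau>" "\<mu> \<noteq> []"
          using ks Cons False by (simp_all del: ksplit.simps)
        then show ?thesis
          using ne \<open>ksplit k ?\<tau> \<noteq> []\<close> by (simp add: ksplit_poly_def del: ksplit.simps)
      qed
      moreover have "block_prod k (?\<tau> @ replicate n 0) = ksplit_poly k ?\<tau>"
        using less False by (intro less.hyps) (auto simp: Par_drop r_def)
      ultimately show ?thesis
        using rec False by simp
    qed
  qed
qed

lemma block_prod_kbounded:
  assumes "\<mu> \<in> kbounded k n"
  obtains \<rho> where "\<rho> \<in> Par k" "first_part \<rho> = first_part \<mu>" "block_prod k \<mu> = ksplit_poly k \<rho>"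
proof (rule filter_kbounded[OF assms])
  fix m
  assume "\<mu> = filter (\<lambda>a. a \<noteq> 0) \<mu> @ replicate m 0" "filter (\<lambda>a. a \<noteq> 0) \<mu> \<in> Par k"
    "first_part (filter (\<lambda>a. a \<noteq> 0) \<mu>) = first_part \<mu>"
  then show thesis
    using that block_prod_append_zeros by metis
qed

section \<open>Linear independence of the \<open>k\<close>-split polynomials\<close>

definition ksplit_span :: "nat \<Rightarrow> (int \<Rightarrow> bool) \<Rightarrow> sym set"
  where "ksplit_span k P = Sym.span (ksplit_poly k ` {\<mu> \<in> Par k. P (first_part \<mu>)})"

lemma block_span_subset: "block_span k n P \<subseteq> ksplit_span k P"
  unfolding block_span_def ksplit_span_def
proof (rule span_subset_span, clarify)
  fix \<mu> assume "\<mu> \<in> kbounded k n" "P (first_part \<mu>)"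
  then show "block_prod k \<mu> \<in> Sym.span (ksplit_poly k ` {\<mu> \<in> Par k. P (first_part \<mu>)})"
    by (metis (mono_tags, lifting) Sym.span_base block_prod_kbounded image_eqI mem_Collect_eq)
qed

lemma moment_append_zeros: "moment (\<gamma> @ replicate m 0) = moment \<gamma>"
proof -
  have "moment (\<gamma> @ replicate m 0) = (\<Sum>p<length \<gamma> + m. int p * (\<gamma> @ replicate m 0) ! p)"
    by (simp add: moment_def)
  also have "\<dots> = (\<Sum>p<length \<gamma>. int p * (\<gamma> @ replicate m 0) ! p)"
    by (rule sum.mono_neutral_right) (auto simp: nth_append)
  finally show ?thesis
    by (simp add: moment_def nth_append)
qed

text \<open>Every nonzero exponent lowers the moment, and straightening lowers it further or leaves
  the list alone.\<close>

lemma catalan_leading_term: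
  assumes \<Psi>: "\<Psi> \<subseteq> all_roots (length \<gamma>)"
  shows "catalan \<Psi> \<gamma> - schur \<gamma> \<in> Sym.span (schur ` {\<kappa> \<in> partitions. moment \<kappa> < moment \<gamma>})"
    (is "_ \<in> ?W")
proof -
  let ?B = "exponent_box \<Psi> (abs_sum \<gamma>)"
  have fin: "finite ?B"
    by (rule finite_exponent_box[OF finite_roots[OF \<Psi>]])
  have 0: "(\<lambda>_. 0) \<in> ?B"
    by (rule boxI) simp_all
  have "raise \<Psi> (\<lambda>_. 0) \<gamma> = \<gamma>"
    by (rule nth_equalityI) (simp_all add: nth_raise)
  then have "catalan_term \<Psi> \<gamma> (\<lambda>_. 0) = schur \<gamma>"
    by (simp add: catalan_term_def)
  then have "catalan \<Psi> \<gamma> - schur \<gamma> = (\<Sum>m\<in>?B - {\<lambda>_. 0}. catalan_term \<Psi> \<gamma> m)"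
    by (simp add: catalan_eq_sum[OF \<Psi> order_refl] sum.remove[OF fin 0])
  also have "\<dots> \<in> ?W"
  proof (rule Sym.span_sum)
    fix m assume m: "m \<in> ?B - {\<lambda>_. 0}"
    then obtain p where p: "m p \<noteq> 0"
      by fastforce
    then have p\<Psi>: "p \<in> \<Psi>"
      using m exponent_box_zero[of m \<Psi> "abs_sum \<gamma>" p] by auto
    have "0 < (\<Sum>(i, j)\<in>\<Psi>. int (m (i, j)) * (int j - int i))"
      using p p\<Psi> \<Psi> finite_roots[OF \<Psi>] by (intro sum_pos2[of _ p]) (auto simp: all_roots_def)
    then have less: "moment (raise \<Psi> m \<gamma>) < moment \<gamma>"
      using moment_raise[OF \<Psi>, of m] by simp
    have "schur (raise \<Psi> m \<gamma>) \<in> ?W"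
    proof (rule schur_straighten[of "raise \<Psi> m \<gamma>"])
      fix \<kappa>
      assume \<kappa>: "sorted_wrt (\<ge>) \<kappa>" "\<forall>a\<in>set \<kappa>. 0 \<le> a"
        "schur (raise \<Psi> m \<gamma>) = schur \<kappa> \<or> schur (raise \<Psi> m \<gamma>) = - schur \<kappa>"
        "\<kappa> = raise \<Psi> m \<gamma> \<or> moment \<kappa> < moment (raise \<Psi> m \<gamma>)"
      have "moment (filter (\<lambda>a. a \<noteq> 0) \<kappa>) = moment \<kappa>"
        using schur_eq_strip[OF \<kappa>(1,2)] moment_append_zeros by metis
      then have "moment (filter (\<lambda>a. a \<noteq> 0) \<kappa>) < moment \<gamma>"
        using \<kappa>(4) less by auto
      then have "schur \<kappa> \<in> ?W"
        using schur_filter[OF \<kappa>(1,2)] filter_partition[OF \<kappa>(1,2)]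
        by (metis (mono_tags, lifting) Sym.span_base image_eqI mem_Collect_eq)
      then show ?thesis
        using \<kappa>(3) by (auto intro: Sym.span_neg)
    qed (simp add: Sym.span_zero)
    then show "catalan_term \<Psi> \<gamma> m \<in> ?W"
      by (simp add: catalan_term_def Sym.span_scale)
  qed
  finally show ?thesis .
qed

lemma Par_kbounded: "\<mu> \<in> Par k \<Longrightarrow> \<mu> \<in> kbounded k (length \<mu>)"
  using ParD[of \<mu> k] by (auto simp: kbounded_def less_imp_le)

lemma hall_ksplit_schur:
  assumes \<mu>: "\<mu> \<in> Par k" and \<rho>: "\<rho> \<in> partitions" "moment \<mu> \<le> moment \<rho>"
  shows "hall (ksplit_poly k \<mu>) (schur \<rho>) = (if \<mu> = \<rho> then 1 else 0)"
proof -
  obtain \<Psi> where \<Psi>: "\<Psi> \<subseteq> all_roots (length \<mu>)" "block_prod k \<mu> = catalan \<Psi> \<mu>"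
    using ex_block_prod_catalan[OF Par_kbounded[OF \<mu>]] by blast
  have "ksplit_poly k \<mu> = catalan \<Psi> \<mu>"
    using block_prod_append_zeros[OF \<mu>, of 0] \<Psi>(2) by simp
  then have "ksplit_poly k \<mu> - schur \<mu> \<in> Sym.span (schur ` {\<kappa> \<in> partitions. moment \<kappa> < moment \<mu>})"
    using catalan_leading_term[OF \<Psi>(1)] by simp
  then have "hall (ksplit_poly k \<mu> - schur \<mu>) (schur \<rho>) = 0"
  proof (induction rule: Sym.span_induct_alt)
    case (step c x y)
    then obtain \<kappa> where "x = schur \<kappa>" "\<kappa> \<in> partitions" "moment \<kappa> < moment \<mu>"
      by auto
    then show ?case
      using step \<rho> by (auto simp: hall_add_left hall_tscale_left hall_schur)
  qed simp
  then show ?thesis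
    using hall_add_left[of "ksplit_poly k \<mu> - schur \<mu>" "schur \<mu>" "schur \<rho>"] hall_schur[OF ParD(4)[OF \<mu>] \<rho>(1)]
    by simp
qed

text \<open>With \<open>\<rho>\<close> of maximal moment among the indices of nonzero coefficients,
  the pairing with \<open>schur \<rho>\<close> sees the coefficient of \<open>\<rho>\<close>
  alone.\<close>

lemma ksplit_poly_independent:
  assumes "finite T" "T \<subseteq> Par k" "(\<Sum>\<mu>\<in>T. c \<mu> *\<^sub>t ksplit_poly k \<mu>) = 0" "\<mu> \<in> T"
  shows "c \<mu> = 0"
proof (rule ccontr)
  assume "c \<mu> \<noteq> 0"
  define T' where "T' = {\<mu> \<in> T. c \<mu> \<noteq> 0}"
  have T': "finite T'" "T' \<noteq> {}"
    using assms \<open>c \<mu> \<noteq> 0\<close> by (auto simp: T'_def)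
  obtain \<rho> where \<rho>: "\<rho> \<in> T'" "\<And>\<nu>. \<nu> \<in> T' \<Longrightarrow> moment \<nu> \<le> moment \<rho>"
  proof -
    have "Max (moment ` T') \<in> moment ` T'"
      using T' by (intro Max_in) auto
    then obtain \<rho> where "\<rho> \<in> T'" "moment \<rho> = Max (moment ` T')"
      by auto
    then show ?thesis
      using that[of \<rho>] T' by simp
  qed
  have \<rho>P: "\<rho> \<in> Par k"
    using \<rho>(1) assms(2) by (auto simp: T'_def)
  have "0 = hall (\<Sum>\<mu>\<in>T. c \<mu> *\<^sub>t ksplit_poly k \<mu>) (schur \<rho>)"
    by (simp add: assms(3))
  also have "\<dots> = (\<Sum>\<mu>\<in>T. c \<mu> * hall (ksplit_poly k \<mu>) (schur \<rho>))"
    by (simp add: hall_sum_left hall_tscale_left)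
  also have "\<dots> = (\<Sum>\<mu>\<in>T. if \<mu> = \<rho> then c \<rho> else 0)"
  proof (rule sum.cong[OF refl])
    fix \<nu> assume "\<nu> \<in> T"
    then show "c \<nu> * hall (ksplit_poly k \<nu>) (schur \<rho>) = (if \<nu> = \<rho> then c \<rho> else 0)"
      using hall_ksplit_schur[of \<nu> k \<rho>] \<rho>(2)[of \<nu>] ParD(4)[OF \<rho>P] assms(2)
      by (cases "c \<nu> = 0") (auto simp: T'_def)
  qed
  also have "\<dots> = c \<rho>"
    using assms(1) \<rho>(1) by (simp add: T'_def)
  finally show False
    using \<rho>(1) by (simp add: T'_def)
qed

lemma ksplit_span_coeffs:
  assumes "f \<in> ksplit_span k P"
  obtains T c where "finite T" "T \<subseteq> {\<mu> \<in> Par k. P (first_part \<mu>)}" "\<forall>\<mu>. \<mu> \<notin> T \<longrightarrow> c \<mu> = 0"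
    "f = (\<Sum>\<mu>\<in>T. c \<mu> *\<^sub>t ksplit_poly k \<mu>)"
proof -
  have "\<exists>T c. finite T \<and> T \<subseteq> {\<mu> \<in> Par k. P (first_part \<mu>)} \<and> (\<forall>\<mu>. \<mu> \<notin> T \<longrightarrow> c \<mu> = 0) \<and>
    f = (\<Sum>\<mu>\<in>T. c \<mu> *\<^sub>t ksplit_poly k \<mu>)"
    using assms unfolding ksplit_span_def
  proof (induction rule: Sym.span_induct_alt)
    case base
    show ?case
      by (intro exI[of _ "{}"] exI[of _ "\<lambda>_. 0"]) simp
  next
    case (step d x y)
    then obtain \<rho> T c where \<rho>: "x = ksplit_poly k \<rho>" "\<rho> \<in> Par k" "P (first_part \<rho>)"
      and T: "finite T" "T \<subseteq> {\<mu> \<in> Par k. P (first_part \<mu>)}" "\<forall>\<mu>. \<mu> \<notin> T \<longrightarrow> c \<mu> = 0"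
        "y = (\<Sum>\<mu>\<in>T. c \<mu> *\<^sub>t ksplit_poly k \<mu>)"
      by auto
    have "(\<Sum>\<mu>\<in>insert \<rho> T. (c \<mu> + (if \<mu> = \<rho> then d else 0)) *\<^sub>t ksplit_poly k \<mu>)
      = (\<Sum>\<mu>\<in>insert \<rho> T. c \<mu> *\<^sub>t ksplit_poly k \<mu>) + (\<Sum>\<mu>\<in>insert \<rho> T. if \<mu> = \<rho> then d *\<^sub>t ksplit_poly k \<rho> else 0)"
      unfolding sum.distrib[symmetric] by (rule sum.cong) (auto simp: Sym.scale_left_distrib)
    also have "(\<Sum>\<mu>\<in>insert \<rho> T. c \<mu> *\<^sub>t ksplit_poly k \<mu>) = y"
      unfolding T(4) using T(1,3) by (intro sum.mono_neutral_right) auto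
    also have "(\<Sum>\<mu>\<in>insert \<rho> T. if \<mu> = \<rho> then d *\<^sub>t ksplit_poly k \<rho> else 0) = d *\<^sub>t x"
      using T(1) \<rho>(1) by (subst sum.delta) auto
    finally show ?case
      using T \<rho> by (intro exI[of _ "insert \<rho> T"] exI[of _ "\<lambda>\<mu>. c \<mu> + (if \<mu> = \<rho> then d else 0)"])
        (auto simp: add.commute)
  qed
  then show ?thesis
    by (elim exE conjE) (rule that)
qed

lemma ksplit_span_disjoint:
  assumes "f \<in> ksplit_span k P" "f \<in> ksplit_span k Q" "\<And>b. \<not> (P b \<and> Q b)"
  shows "f = 0"
proof -
  obtain T c where T: "finite T" "T \<subseteq> {\<mu> \<in> Par k. P (first_part \<mu>)}" "\<forall>\<mu>. \<mu> \<notin> T \<longrightarrow> c \<mu> = 0"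
    "f = (\<Sum>\<mu>\<in>T. c \<mu> *\<^sub>t ksplit_poly k \<mu>)"
    by (rule ksplit_span_coeffs[OF assms(1)])
  obtain U d where U: "finite U" "U \<subseteq> {\<mu> \<in> Par k. Q (first_part \<mu>)}" "\<forall>\<mu>. \<mu> \<notin> U \<longrightarrow> d \<mu> = 0"
    "f = (\<Sum>\<mu>\<in>U. d \<mu> *\<^sub>t ksplit_poly k \<mu>)"
    by (rule ksplit_span_coeffs[OF assms(2)])
  have "f = (\<Sum>\<mu>\<in>T \<union> U. c \<mu> *\<^sub>t ksplit_poly k \<mu>)"
    by (subst T(4), rule sum.mono_neutral_left) (use T U in auto)
  moreover have "f = (\<Sum>\<mu>\<in>T \<union> U. d \<mu> *\<^sub>t ksplit_poly k \<mu>)"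
    by (subst U(4), rule sum.mono_neutral_left) (use T U in auto)
  ultimately have 0: "(\<Sum>\<mu>\<in>T \<union> U. (c \<mu> - d \<mu>) *\<^sub>t ksplit_poly k \<mu>) = 0"
    by (simp add: Sym.scale_left_diff_distrib sum_subtractf)
  have cd: "c \<mu> - d \<mu> = 0" if "\<mu> \<in> T \<union> U" for \<mu>
    by (rule ksplit_poly_independent[OF _ _ 0 that]) (use T U in auto)
  have "c \<mu> = 0" if "\<mu> \<in> T" for \<mu>
  proof -
    have "\<mu> \<notin> U"
      using that T(2) U(2) assms(3) by blast
    then show ?thesis
      using cd[of \<mu>] U(3) that by simp
  qed
  then show ?thesis
    by (simp add: T(4))
qed

text \<open>Row 0 of \<open>kschur_roots k (a # \<nu>)\<close> misses the columns up to
  \<open>k - a\<close>, and \<open>Bop\<close> supplies them. Using some of these roots raises the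
  first entry by at least 1 and at most \<open>k - a\<close>: above \<open>a\<close>, yet still
  bounded by \<open>k\<close>. The second claim is there because \<open>omega_proj\<close> is
  specified on \<open>Lambda k\<close> only.\<close>

lemma Bop_kschur_diff:
  assumes "a # \<nu> \<in> Par k"
  shows "Bop a (kschur k \<nu>) - kschur k (a # \<nu>) \<in> ksplit_span k (\<lambda>b. a < b)"
    and "Bop a (kschur k \<nu>) \<in> Lambda k"
proof -
  let ?\<mu> = "a # \<nu>"
  define n where "n = length ?\<mu>"
  note \<mu> = ParD[OF assms]
  have n: "0 < n"
    by (simp add: n_def)
  have ak: "a \<le> int k"
    using \<mu>(3) by simp
  define \<Phi> where "\<Phi> = {0} \<times> {1..length \<nu>} \<union> shift_roots 1 (kschur_roots k \<nu>)"
  have \<Phi>: "\<Phi> \<subseteq> all_roots n"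
    using shift_roots_subset[OF kschur_roots_subset[of k \<nu>], of 1]
    by (auto simp: \<Phi>_def n_def all_roots_def)
  have mem: "(i, j) \<in> \<Phi> \<longleftrightarrow> (i, j) \<in> all_roots n \<and> (i = 0 \<or> int k - ?\<mu> ! i + int i < int j)" for i j
  proof (cases i)
    case 0
    then show ?thesis
      by (auto simp: \<Phi>_def shift_roots_def all_roots_def n_def)
  next
    case (Suc i')
    have "(Suc i', j) \<in> shift_roots 1 (kschur_roots k \<nu>) \<longleftrightarrow> 0 < j \<and> (i', j - 1) \<in> kschur_roots k \<nu>"
    proof
      assume "0 < j \<and> (i', j - 1) \<in> kschur_roots k \<nu>"
      then show "(Suc i', j) \<in> shift_roots 1 (kschur_roots k \<nu>)"
        unfolding shift_roots_def by (intro image_eqI[of _ _ "(i', j - 1)"]) auto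
    qed (auto simp: shift_roots_def)
    then show ?thesis
      using Suc by (cases j) (auto simp: \<Phi>_def kschur_roots_def all_roots_def n_def)
  qed
  have sub: "kschur_roots k ?\<mu> \<subseteq> \<Phi>"
    using mem by (auto simp: kschur_roots_def n_def)
  have B: "Bop a (kschur k \<nu>) = catalan \<Phi> ?\<mu>"
    unfolding kschur_def \<Phi>_def by (rule Bop_catalan[OF kschur_roots_subset])
  have \<mu>nth: "?\<mu> ! p \<le> int k" if "p < n" for p
    using \<mu>(3) that nth_mem unfolding n_def by blast
  have band: "int j \<le> int p + int k - ?\<mu> ! p" "p \<noteq> 0" if "p < j" "j < n" "(p, j) \<notin> \<Phi>" for p j
    using that mem[of p j] by (auto simp: all_roots_def)
  have "catalan \<Phi> ?\<mu> - Btilde ?\<mu> 1 \<in> Sym.span ((\<lambda>\<delta>. Btilde \<delta> 1) ` bounded_higher k ?\<mu>)"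
    by (rule catalan_Btilde_expand) (use \<Phi> band \<mu>nth n_def in auto)
  moreover have "Sym.span ((\<lambda>\<delta>. Btilde \<delta> 1) ` bounded_higher k ?\<mu>) \<subseteq> Lambda k"
    unfolding Lambda_def
    by (rule span_subset_span)
      (use Btilde_in_Lambda[OF n, of _ k] in \<open>auto simp: bounded_higher_def n_def Lambda_def\<close>)
  moreover have "Btilde ?\<mu> 1 \<in> Lambda k"
    by (rule Btilde_in_Lambda[OF n]) (use \<mu>nth n_def in auto)
  ultimately have "(catalan \<Phi> ?\<mu> - Btilde ?\<mu> 1) + Btilde ?\<mu> 1 \<in> Lambda k"
    unfolding Lambda_def using Sym.span_add by blast
  then show "Bop a (kschur k \<nu>) \<in> Lambda k"
    by (simp add: B)
  have "{catalan \<Phi> (add_roots S ?\<mu>) |S. S \<subseteq> \<Phi> - kschur_roots k ?\<mu> \<and> S \<noteq> {}} \<subseteq> block_span k n (\<lambda>b. a + 1 \<le> b)"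
  proof clarify
    fix S assume S: "S \<subseteq> \<Phi> - kschur_roots k ?\<mu>" "S \<noteq> {}"
    have Sall: "S \<subseteq> all_roots (length ?\<mu>)"
      using S(1) \<Phi> by (auto simp: n_def)
    have fin: "finite S"
      by (rule finite_roots[OF Sall])
    have S0: "i = 0 \<and> 0 < j \<and> int j \<le> int k - a" if "(i, j) \<in> S" for i j
    proof -
      have "(i, j) \<in> \<Phi>" "(i, j) \<notin> kschur_roots k ?\<mu>" "(i, j) \<in> all_roots n"
        using that S(1) \<Phi> by auto
      then show ?thesis
        using mem[of i j] by (auto simp: kschur_roots_def n_def all_roots_def)
    qed
    define \<delta> where "\<delta> = add_roots S ?\<mu>"
    have len: "length \<delta> = n"
      by (simp add: \<delta>_def n_def)
    have card1: "0 < card {j. (0, j) \<in> S}"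
    proof -
      have "finite {j. (0, j) \<in> S}"
        by (rule finite_subset[of _ "snd ` S"]) (use fin in \<open>force+\<close>)
      moreover have "{j. (0, j) \<in> S} \<noteq> {}"
        using S(2) S0 by fastforce
      ultimately show ?thesis
        by (simp add: card_gt_0_iff)
    qed
    have card2: "int (card {j. (0, j) \<in> S}) \<le> int k - a"
    proof -
      have "{j. (0, j) \<in> S} \<subseteq> {1..nat (int k - a)}"
        using S0 by fastforce
      then have "card {j. (0, j) \<in> S} \<le> card {1..nat (int k - a)}"
        by (intro card_mono) auto
      then show ?thesis
        using ak by simp
    qed
    have \<delta>0: "\<delta> ! 0 = a + int (card {j. (0, j) \<in> S})"
    proof -
      have "{i. (i, 0) \<in> S} = {}"
        using S0 by fastforce
      then show ?thesis
        using nth_add_roots[OF fin, of 0 ?\<mu>] by (simp add: \<delta>_def)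
    qed
    have \<delta>p: "\<delta> ! p \<le> ?\<mu> ! p" if "p < n" "p \<noteq> 0" for p
    proof -
      have "{j. (p, j) \<in> S} = {}"
        using S0 that by fastforce
      then show ?thesis
        using nth_add_roots[OF fin, of p ?\<mu>] that by (simp add: \<delta>_def n_def)
    qed
    have \<delta>k: "\<delta> ! p \<le> int k" if "p < n" for p
      using \<delta>0 card2 \<delta>p[OF that] \<mu>nth[OF that] by (cases "p = 0") auto
    have "catalan \<Phi> \<delta> - Btilde \<delta> 1 \<in> Sym.span ((\<lambda>\<delta>. Btilde \<delta> 1) ` bounded_higher k \<delta>)"
    proof (rule catalan_Btilde_expand)
      \<comment> \<open>\<open>\<Phi>\<close> misses nothing in row 0, and in the other rows adding
        \<open>S\<close> can only lower entries, which weakens the condition.\<close>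
      fix p j assume pj: "p < j" "j < length \<delta>" "(p, j) \<notin> \<Phi>"
      then show "int j \<le> int p + int k - \<delta> ! p"
        using band[of p j] \<delta>p[of p] len by simp
    qed (use \<Phi> \<delta>k len in auto)
    moreover have "Sym.span ((\<lambda>\<delta>. Btilde \<delta> 1) ` bounded_higher k \<delta>) \<subseteq> block_span k n (\<lambda>b. a + 1 \<le> b)"
      unfolding block_span_def
    proof (rule span_subset_span, clarify)
      fix \<epsilon> assume "\<epsilon> \<in> bounded_higher k \<delta>"
      then have "Btilde \<epsilon> 1 \<in> block_span k n (\<lambda>b. a + 1 \<le> b)"
        using \<delta>0 card1 n len by (intro Btilde_in_block_span) (auto simp: bounded_higher_def)
      then show "Btilde \<epsilon> 1 \<in> Sym.span (block_prod k ` {\<mu> \<in> kbounded k n. a + 1 \<le> first_part \<mu>})"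
        by (simp add: block_span_def)
    qed
    moreover have "Btilde \<delta> 1 \<in> block_span k n (\<lambda>b. a + 1 \<le> b)"
      using \<delta>0 card1 by (intro Btilde_in_block_span[OF n len \<delta>k]) auto
    ultimately have "(catalan \<Phi> \<delta> - Btilde \<delta> 1) + Btilde \<delta> 1 \<in> block_span k n (\<lambda>b. a + 1 \<le> b)"
      unfolding block_span_def using Sym.span_add by blast
    then show "catalan \<Phi> \<delta> \<in> block_span k n (\<lambda>b. a + 1 \<le> b)"
      by simp
  qed
  then have "Sym.span {catalan \<Phi> (add_roots S ?\<mu>) |S. S \<subseteq> \<Phi> - kschur_roots k ?\<mu> \<and> S \<noteq> {}}
    \<subseteq> block_span k n (\<lambda>b. a + 1 \<le> b)"
    unfolding block_span_def by (rule span_subset_span)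
  moreover have "kschur k ?\<mu> - catalan \<Phi> ?\<mu>
    \<in> Sym.span {catalan \<Phi> (add_roots S ?\<mu>) |S. S \<subseteq> \<Phi> - kschur_roots k ?\<mu> \<and> S \<noteq> {}}"
    unfolding kschur_def by (rule catalan_expand[OF sub]) (use \<Phi> in \<open>simp add: n_def\<close>)
  ultimately have "kschur k ?\<mu> - catalan \<Phi> ?\<mu> \<in> ksplit_span k (\<lambda>b. a + 1 \<le> b)"
    using block_span_subset by blast
  moreover have "(\<lambda>b. a + 1 \<le> b) = (\<lambda>b. a < b)"
    by auto
  ultimately have "- (kschur k ?\<mu> - catalan \<Phi> ?\<mu>) \<in> ksplit_span k (\<lambda>b. a < b)"
    unfolding ksplit_span_def using Sym.span_neg by metis
  then show "Bop a (kschur k \<nu>) - kschur k ?\<mu> \<in> ksplit_span k (\<lambda>b. a < b)"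
    by (simp add: B)
qed

lemma span_Omega:
  "Sym.span (\<Union>a\<in>{a. 0 \<le> a \<and> a \<le> int k \<and> P a}. Omega k a) = ksplit_span k P"
proof (rule equalityI)
  show "Sym.span (\<Union>a\<in>{a. 0 \<le> a \<and> a \<le> int k \<and> P a}. Omega k a) \<subseteq> ksplit_span k P"
    unfolding ksplit_span_def
  proof (rule span_subset_span, rule UN_least)
    fix a assume "a \<in> {a. 0 \<le> a \<and> a \<le> int k \<and> P a}"
    then show "Omega k a \<subseteq> Sym.span (ksplit_poly k ` {\<mu> \<in> Par k. P (first_part \<mu>)})"
      unfolding Omega_def by (intro Sym.span_mono) auto
  qed
  show "ksplit_span k P \<subseteq> Sym.span (\<Union>a\<in>{a. 0 \<le> a \<and> a \<le> int k \<and> P a}. Omega k a)"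
    unfolding ksplit_span_def
  proof (rule Sym.span_mono, clarify)
    fix \<mu> assume \<mu>: "\<mu> \<in> Par k" "P (first_part \<mu>)"
    have "0 \<le> first_part \<mu>" "first_part \<mu> \<le> int k"
      using ParD(2,3)[OF \<mu>(1)] by (cases \<mu>; force simp: first_part_def)+
    moreover have "ksplit_poly k \<mu> \<in> Omega k (first_part \<mu>)"
      using \<mu>(1) by (auto simp: Omega_def intro!: Sym.span_base)
    ultimately show "ksplit_poly k \<mu> \<in> (\<Union>a\<in>{a. 0 \<le> a \<and> a \<le> int k \<and> P a}. Omega k a)"
      using \<mu>(2) by blast
  qed
qed

theorem theorem6p3:
  fixes k :: nat and \<mu> :: "int list"
  assumes "k \<ge> 1" and "\<mu> \<in> Par k"
  shows "Atilde k \<mu> = kschur k \<mu>"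
  using assms(2)
proof (induction \<mu>)
  case Nil
  show ?case
    by (simp add: kschur_def kschur_roots_def all_roots_def catalan_empty)
next
  case (Cons a \<nu>)
  have "\<nu> \<in> Par k"
    using Par_drop[OF Cons.prems, of 1] by simp
  then have IH: "Atilde k \<nu> = kschur k \<nu>"
    by (rule Cons.IH)
  let ?f = "Bop a (kschur k \<nu>)" and ?g = "kschur k (a # \<nu>)"
  have high: "?f - ?g \<in> ksplit_span k (\<lambda>b. a < b)" and mem: "?f \<in> Lambda k"
    using Bop_kschur_diff[OF Cons.prems] by auto
  have "?g \<in> ksplit_span k (\<lambda>b. b = a)"
    using kschur_in_block_span[OF Par_kbounded[OF Cons.prems]] block_span_subset
    by (force simp: first_part_def)
  moreover have "ksplit_span k (\<lambda>b. b = a) \<subseteq> ksplit_span k (\<lambda>b. b \<le> a)"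
    unfolding ksplit_span_def by (intro Sym.span_mono) auto
  ultimately have low: "?g \<in> ksplit_span k (\<lambda>b. b \<le> a)"
    by blast
  have "(THE g. g \<in> ksplit_span k (\<lambda>b. b \<le> a) \<and> ?f - g \<in> ksplit_span k (\<lambda>b. a < b)) = ?g"
  proof (rule the_equality)
    \<comment> \<open>A competitor differs from \<open>?g\<close> by an element of both spans, and
      these meet only in 0.\<close>
    fix g assume g: "g \<in> ksplit_span k (\<lambda>b. b \<le> a) \<and> ?f - g \<in> ksplit_span k (\<lambda>b. a < b)"
    have "g - ?g = 0"
    proof (rule ksplit_span_disjoint[of _ k "\<lambda>b. b \<le> a" "\<lambda>b. a < b"])
      show "g - ?g \<in> ksplit_span k (\<lambda>b. b \<le> a)"
        using g low unfolding ksplit_span_def by (blast intro: Sym.span_diff)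
      have "(?f - ?g) - (?f - g) \<in> ksplit_span k (\<lambda>b. a < b)"
        using g high unfolding ksplit_span_def by (blast intro: Sym.span_diff)
      then show "g - ?g \<in> ksplit_span k (\<lambda>b. a < b)"
        by simp
    qed auto
    then show "g = ?g"
      by simp
  qed (use low high in simp)
  then show ?case
    using mem by (simp add: IH omega_proj_def span_Omega)
qed

end
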